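(* Let $\mathcal{H}$ be a Hilbert space and $U$ a unitary operator on $\mathcal{H}$ whose spectral measure is a pure point measure (i.e. $\mathcal{H}$ is the closed linear span of the eigenvectors of $U$). Then the Möbius function $\mu$ is linearly disjoint from $(CAR(\mathcal{H}),\alpha_U)$.
   Context: $\mu$ is the Möbius function: $\mu(1)=1$, $\mu(n)=0$ if $n$ is not square-free, and $\mu(n)=(-1)^t$ if $n$ is a product of $t$ distinct primes. For a C$^*$-algebra $\mathfrak{A}$ and an automorphism $\alpha$ of $\mathfrak{A}$, $\mu$ is linearly disjoint from $(\mathfrak{A},\alpha)$ if $\frac1N\sum_{n=1}^N\mu(n)\rho(\alpha^n(A))\to0$ as $N\to\infty$ for every state $\rho$ on $\mathfrak{A}$ and every $A\in\mathfrak{A}$. CAR algebra: for a Hilbert space $\mathcal{H}$ (inner product linear in the first variable), let $\Lambda\mathcal{H}=\bigoplus_{n\ge0}\Lambda^n\mathcal{H}$ be the antisymmetric Fock space, with $\Lambda^0\mathcal{H}=\mathbb{C}1$. For $f\in\mathcal{H}$ let $a(f)$ be the bounded creation operator on $\Lambda\mathcal{H}$, linear in $f$, given by $a(f)(\xi_1\wedge\cdots\wedge\xi_n)=f\wedge\xi_1\wedge\cdots\wedge\xi_n$ (with wedge products normalized so that the following relations hold): $a(f)a(g)+a(g)a(f)=0$ and $a(f)a(g)^*+a(g)^*a(f)=\langle f,g\rangle 1$ for all $f,g\in\mathcal{H}$. $CAR(\mathcal{H})$ is the C$^*$-algebra generated by $\{a(f):f\in\mathcal{H}\}$. For a unitary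 $U$ on $\mathcal{H}$, the Bogoliubov automorphism $\alpha_U$ of $CAR(\mathcal{H})$ is the automorphism determined by $\alpha_U(a(f))=a(Uf)$ for all $f\in\mathcal{H}$. *)

theory Defs
  imports "HOL-Analysis.Analysis" "HOL-Library.Poly_Mapping" "HOL-Combinatorics.Permutations"
    "HOL-Computational_Algebra.Squarefree"
begin

subsection \<open>Complex Hilbert spaces\<close>

class scaleC =
  fixes scaleC :: "complex \<Rightarrow> 'a \<Rightarrow> 'a" (infixr "*\<^sub>C" 75)

class complex_inner = real_normed_vector + scaleC +
  fixes cinner :: "'a \<Rightarrow> 'a \<Rightarrow> complex"
  assumes scaleC_add_right: "c *\<^sub>C (x + y) = c *\<^sub>C x + c *\<^sub>C y"
    and scaleC_add_left: "(c + d) *\<^sub>C x = c *\<^sub>C x + d *\<^sub>C x"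
    and scaleC_scaleC: "c *\<^sub>C d *\<^sub>C x = (c * d) *\<^sub>C x"
    and scaleR_scaleC: "r *\<^sub>R x = complex_of_real r *\<^sub>C x"
    and cinner_commute: "cinner x y = cnj (cinner y x)"
    and cinner_add_left: "cinner (x + y) z = cinner x z + cinner y z"
    and cinner_scaleC_left: "cinner (c *\<^sub>C x) y = c * cinner x y"
    and cinner_ge_zero: "0 \<le> Re (cinner x x)"
    and norm_eq_sqrt_cinner: "norm x = sqrt (Re (cinner x x))"

class chilbert_space = complex_inner + complete_space

lemma scaleC_one: "1 *\<^sub>C x = (x :: 'a::complex_inner)"
  using scaleR_scaleC[of 1 x] by simp

global_interpretation complex_vector:
  vector_space "scaleC :: complex \<Rightarrow> 'a \<Rightarrow> 'a::complex_inner"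
  by standard (auto simp: scaleC_add_right scaleC_add_left scaleC_scaleC scaleC_one)

abbreviation cspan :: "'a::complex_inner set \<Rightarrow> 'a set"
  where "cspan \<equiv> complex_vector.span"

lemma cinner_add_right: "cinner x (y + z) = cinner x y + cinner x (z::'a::complex_inner)"
  by (metis cinner_add_left cinner_commute complex_cnj_add)

lemma cinner_scaleC_right: "cinner x (c *\<^sub>C y) = cnj c * cinner x (y::'a::complex_inner)"
  by (metis cinner_commute cinner_scaleC_left complex_cnj_mult)

lemma cinner_zero_left [simp]: "cinner 0 (x::'a::complex_inner) = 0"
  using cinner_add_left[of 0 0 x] by simp

lemma cinner_zero_right [simp]: "cinner (x::'a::complex_inner) 0 = 0"
  by (subst cinner_commute) simp

lemma cinner_minus_left: "cinner (- x) (y::'a::complex_inner) = - cinner x y"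
  using cinner_add_left[of x "-x" y] by (simp add: eq_neg_iff_add_eq_0 add.commute)

lemma cinner_diff_left: "cinner (x - y) (z::'a::complex_inner) = cinner x z - cinner y z"
  using cinner_add_left[of x "-y" z] by (simp add: cinner_minus_left)

lemma cinner_sum_left: "cinner (sum f A) (y::'a::complex_inner) = (\<Sum>i\<in>A. cinner (f i) y)"
  by (induction A rule: infinite_finite_induct) (auto simp: cinner_add_left)

lemma cinner_sum_right: "cinner (y::'a::complex_inner) (sum f A) = (\<Sum>i\<in>A. cinner y (f i))"
  by (induction A rule: infinite_finite_induct) (auto simp: cinner_add_right)

lemma cinner_self: "cinner x x = of_real ((norm (x::'a::complex_inner))\<^sup>2)"
proof (rule complex_eqI)
  show "Re (cinner x x) = Re (of_real ((norm x)\<^sup>2))"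
    using norm_eq_sqrt_cinner[of x] cinner_ge_zero[of x] by simp
  have "Im (cinner x x) = - Im (cinner x x)"
    using arg_cong[OF cinner_commute[of x x], of Im] by simp
  then show "Im (cinner x x) = Im (of_real ((norm x)\<^sup>2))" by simp
qed

subsection \<open>The inner product of decomposable antisymmetric tensors\<close>

text \<open>The determinant of the matrix of inner products of the two lists, written out by the
  Leibniz formula; it is \<open>1\<close> for two empty lists.\<close>

definition gram :: "'a::complex_inner list \<Rightarrow> 'a list \<Rightarrow> complex" where
  "gram xs ys =
     (if length xs = length ys
      then \<Sum>p | p permutes {..<length xs}.
             of_int (sign p) * (\<Prod>i<length xs. cinner (xs ! i) (ys ! p i))
      else 0)"

lemma orthonormal_expansion:
  assumes "finite (Z :: 'a::complex_inner set)"
  shows "\<exists>N e. (\<forall>i<N. \<forall>j<N. cinner (e i) (e j) = (if i = j then 1 else 0)) \<and>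
           (\<forall>z\<in>Z. z = (\<Sum>i<(N::nat). cinner z (e i) *\<^sub>C e i))"
  using assms
proof (induction Z rule: finite_induct)
  case empty
  show ?case by (intro exI[of _ 0]) auto
next
  case (insert z Z)
  then obtain N :: nat and e where
    on: "\<And>i j. i < N \<Longrightarrow> j < N \<Longrightarrow> cinner (e i) (e j) = (if i = j then 1 else 0)" and
    ex: "\<And>w. w \<in> Z \<Longrightarrow> w = (\<Sum>i<N. cinner w (e i) *\<^sub>C e i)" by metis
  define P where "P = (\<Sum>i<N. cinner z (e i) *\<^sub>C e i)"
  define r where "r = z - P"
  have Pe: "cinner P (e j) = cinner z (e j)" if "j < N" for j
  proof -
    have "cinner P (e j) = (\<Sum>i<N. cinner z (e i) * (if i = j then 1 else 0))"
      unfolding P_def cinner_sum_left using on that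
      by (intro sum.cong) (auto simp: cinner_scaleC_left)
    also have "\<dots> = (\<Sum>i<N. if i = j then cinner z (e i) else 0)"
      by (intro sum.cong) auto
    also have "\<dots> = cinner z (e j)" using that by simp
    finally show ?thesis .
  qed
  have re: "cinner r (e j) = 0" if "j < N" for j
    using Pe[OF that] by (simp add: r_def cinner_diff_left)
  show ?case
  proof (cases "r = 0")
    case True
    then have "z = P" by (simp add: r_def)
    then have "z = (\<Sum>i<N. cinner z (e i) *\<^sub>C e i)" by (simp add: P_def)
    with on ex show ?thesis by (intro exI[of _ N] exI[of _ e]) auto
  next
    case False
    define f where "f = (\<lambda>i. if i < N then e i else complex_of_real (1 / norm r) *\<^sub>C r)"
    have er: "cinner (e j) r = 0" if "j < N" for j
      using re[OF that] by (subst cinner_commute) simp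
    have fN: "f N = complex_of_real (1 / norm r) *\<^sub>C r" and fi: "\<And>i. i < N \<Longrightarrow> f i = e i"
      by (auto simp: f_def)
    have "cinner (f N) (f N) =
        complex_of_real (1 / norm r) * (cnj (complex_of_real (1 / norm r)) * cinner r r)"
      by (simp only: fN cinner_scaleC_left cinner_scaleC_right mult_ac)
    also have "\<dots> = 1" using False by (simp add: cinner_self power2_eq_square)
    finally have NN: "cinner (f N) (f N) = 1" .
    have on': "cinner (f i) (f j) = (if i = j then 1 else 0)" if "i < Suc N" "j < Suc N" for i j
      using that on[of i j] NN
      by (auto simp: less_Suc_eq fi) (auto simp: fN re er cinner_scaleC_left cinner_scaleC_right)
    have ef: "cinner (e i) (f N) = 0" if "i < N" for i
      using er[OF that] by (simp add: fN cinner_scaleC_right)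
    have Pf: "cinner P (f N) = 0"
      unfolding P_def cinner_sum_left by (intro sum.neutral) (auto simp: cinner_scaleC_left ef)
    have "cinner z (f N) = cinner r (f N)"
      using Pf by (simp add: r_def cinner_diff_left)
    also have "\<dots> = complex_of_real (norm r)"
      using False by (simp add: fN cinner_scaleC_right cinner_self power2_eq_square)
    finally have zf: "cinner z (f N) *\<^sub>C f N = r"
      using False by (simp add: fN scaleC_scaleC scaleC_one flip: of_real_mult)
    have "z = P + r" by (simp add: r_def)
    then have z: "z = (\<Sum>i<Suc N. cinner z (f i) *\<^sub>C f i)"
      by (simp add: zf P_def fi)
    have w: "w = (\<Sum>i<Suc N. cinner w (f i) *\<^sub>C f i)" if "w \<in> Z" for w
    proof -
      have "cinner w (f N) = (\<Sum>i<N. cinner w (e i) * cinner (e i) (f N))"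
        by (subst ex[OF that]) (simp add: cinner_sum_left cinner_scaleC_left)
      also have "\<dots> = 0" by (intro sum.neutral) (auto simp: ef)
      finally show ?thesis using ex[OF that] by (simp add: fi)
    qed
    show ?thesis using on' z w by (intro exI[of _ "Suc N"] exI[of _ f]) auto
  qed
qed

lemma cinner_factorization:
  fixes Z :: "'a::complex_inner set"
  assumes "finite Z"
  obtains N :: nat and g where
    "\<And>z w. z \<in> Z \<Longrightarrow> w \<in> Z \<Longrightarrow> cinner z w = (\<Sum>b<N. (g :: nat \<Rightarrow> 'a \<Rightarrow> complex) b z * cnj (g b w))"
proof -
  obtain N e where
    on: "\<And>i j. i < N \<Longrightarrow> j < N \<Longrightarrow> cinner (e i) (e j) = (if i = j then 1 else 0)" and
    ex: "\<And>w. w \<in> Z \<Longrightarrow> w = (\<Sum>i<(N::nat). cinner w (e i) *\<^sub>C e i)"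
    using orthonormal_expansion[OF assms] by metis
  have "cinner z w = (\<Sum>b<N. cinner z (e b) * cnj (cinner w (e b)))" if "z \<in> Z" for z w
  proof -
    have "cinner z w = (\<Sum>b<N. cinner z (e b) * cinner (e b) w)"
      by (subst ex[OF that]) (simp add: cinner_sum_left cinner_scaleC_left)
    then show ?thesis by (subst (asm) (2) cinner_commute) simp
  qed
  then show ?thesis using that[of "\<lambda>b z. cinner z (e b)" N] by blast
qed

lemma Re_sum_nonneg: "(\<And>i. i \<in> A \<Longrightarrow> 0 \<le> Re (f i)) \<Longrightarrow> 0 \<le> Re (sum f A)"
  by (simp add: sum_nonneg)

lemma prod_cinner_nonneg:
  fixes z :: "nat \<Rightarrow> 'j \<Rightarrow> 'a::complex_inner"
  assumes "finite J"
  shows "0 \<le> Re (\<Sum>j\<in>J. \<Sum>k\<in>J. d j * cnj (d k) * (\<Prod>i<n. cinner (z i j) (z i k)))"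
proof (induction n arbitrary: d)
  case 0
  have "(\<Sum>j\<in>J. \<Sum>k\<in>J. d j * cnj (d k)) = (\<Sum>j\<in>J. d j) * cnj (\<Sum>j\<in>J. d j)"
    by (simp add: sum_product)
  also have "\<dots> = of_real ((cmod (\<Sum>j\<in>J. d j))\<^sup>2)"
    by (rule complex_norm_square[symmetric])
  finally show ?case by simp
next
  case (Suc n)
  obtain N g where g: "\<And>a b. a \<in> z n ` J \<Longrightarrow> b \<in> z n ` J \<Longrightarrow>
      cinner a b = (\<Sum>c<(N::nat). g c a * cnj (g c b))"
    using cinner_factorization[of "z n ` J"] assms by blast
  let ?P = "\<lambda>j k. \<Prod>i<n. cinner (z i j) (z i k)"
  have "(\<Sum>j\<in>J. \<Sum>k\<in>J. d j * cnj (d k) * (\<Prod>i<Suc n. cinner (z i j) (z i k))) =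
        (\<Sum>j\<in>J. \<Sum>k\<in>J. \<Sum>c<N. (d j * g c (z n j)) * cnj (d k * g c (z n k)) * ?P j k)"
    by (intro sum.cong refl) (simp add: g sum_distrib_left mult_ac)
  also have "\<dots> = (\<Sum>c<N. \<Sum>j\<in>J. \<Sum>k\<in>J. (d j * g c (z n j)) * cnj (d k * g c (z n k)) * ?P j k)"
    by (subst (2) sum.swap, subst sum.swap) (rule refl)
  finally show ?case
    using Suc.IH by (simp only:) (rule Re_sum_nonneg)
qed


lemma gram_average:
  assumes "length xs = n" "length ys = n"
  shows "(\<Sum>p | p permutes {..<n}. \<Sum>q | q permutes {..<n}.
            of_int (sign p) * of_int (sign q) * (\<Prod>i<n. cinner (xs ! p i) (ys ! q i))) =
         fact n * gram xs ys"
proof -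
  have "(\<Sum>q | q permutes {..<n}.
            of_int (sign p) * of_int (sign q) * (\<Prod>i<n. cinner (xs ! p i) (ys ! q i))) =
        gram xs ys" if p: "p permutes {..<n}" for p
  proof -
    have "(\<Sum>q | q permutes {..<n}.
            of_int (sign p) * of_int (sign q) * (\<Prod>i<n. cinner (xs ! p i) (ys ! q i))) =
        (\<Sum>q | q permutes {..<n}.
            of_int (sign p) * of_int (sign (q \<circ> p)) *
            (\<Prod>i<n. cinner (xs ! p i) (ys ! (q \<circ> p) i)))"
      by (rule sum_permutations_compose_right[OF p])
    also have "\<dots> = (\<Sum>q | q permutes {..<n}.
            of_int (sign q) * (\<Prod>i<n. cinner (xs ! i) (ys ! q i)))"
    proof (rule sum.cong[OF refl])
      fix q assume "q \<in> {q. q permutes {..<n}}"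
      then have q: "q permutes {..<n}" by simp
      have "sign (q \<circ> p) = sign q * sign p"
        using p q by (intro sign_compose) (auto simp: permutation_permutes)
      moreover have "(\<Prod>i<n. cinner (xs ! p i) (ys ! (q \<circ> p) i)) =
          (\<Prod>i<n. cinner (xs ! i) (ys ! q i))"
        using prod.permute[OF p, of "\<lambda>i. cinner (xs ! i) (ys ! q i)"] by (simp add: comp_def)
      moreover have "complex_of_int (sign p) * of_int (sign p) = 1"
        by (simp add: sign_def)
      ultimately show "of_int (sign p) * of_int (sign (q \<circ> p)) *
            (\<Prod>i<n. cinner (xs ! p i) (ys ! (q \<circ> p) i)) =
          of_int (sign q) * (\<Prod>i<n. cinner (xs ! i) (ys ! q i))"
        by (simp add: mult_ac)
    qed
    finally show ?thesis using assms by (simp add: gram_def)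
  qed
  then show ?thesis by (simp add: card_permutations)
qed

lemma gram_commute: "gram xs ys = cnj (gram ys xs)"
proof (cases "length xs = length ys")
  case True
  define n where "n = length xs"
  have n: "length xs = n" "length ys = n" using True by (auto simp: n_def)
  let ?f = "\<lambda>xs ys p q. of_int (sign p) * of_int (sign q) *
      (\<Prod>i<n. cinner (xs ! p i) ((ys :: 'a list) ! q i))"
  have "fact n * gram xs ys =
      (\<Sum>q | q permutes {..<n}. \<Sum>p | p permutes {..<n}. ?f xs ys p q)"
    unfolding gram_average[OF n, symmetric] by (rule sum.swap)
  also have "\<dots> = (\<Sum>q | q permutes {..<n}. \<Sum>p | p permutes {..<n}. cnj (?f ys xs q p))"
    by (intro sum.cong refl) (simp add: mult_ac flip: cinner_commute)
  also have "\<dots> = cnj (fact n * gram ys xs)"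
    unfolding gram_average[OF n(2,1), symmetric] by simp
  finally show ?thesis by simp
qed (auto simp: gram_def)

lemma gram_nonneg_aux:
  assumes "finite K" "\<And>xs. xs \<in> K \<Longrightarrow> length xs = n"
  shows "0 \<le> Re (\<Sum>xs\<in>K. \<Sum>ys\<in>K. c xs * cnj (c ys) * gram xs ys)"
proof -
  let ?P = "{p. p permutes {..<n}}"
  let ?d = "\<lambda>(xs, p). c xs * of_int (sign p)"
  have "fact n * (\<Sum>xs\<in>K. \<Sum>ys\<in>K. c xs * cnj (c ys) * gram xs ys) =
      (\<Sum>xs\<in>K. \<Sum>ys\<in>K. c xs * cnj (c ys) * (fact n * gram xs ys))"
    by (simp add: sum_distrib_left mult_ac)
  also have "\<dots> = (\<Sum>xs\<in>K. \<Sum>ys\<in>K. \<Sum>p\<in>?P. \<Sum>q\<in>?P. ?d (xs, p) * cnj (?d (ys, q)) *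
      (\<Prod>i<n. cinner (xs ! p i) (ys ! q i)))"
    using assms by (intro sum.cong refl, subst gram_average[symmetric, of _ n])
      (auto simp: sum_distrib_left mult_ac)
  also have "\<dots> = (\<Sum>xs\<in>K. \<Sum>p\<in>?P. \<Sum>ys\<in>K. \<Sum>q\<in>?P. ?d (xs, p) * cnj (?d (ys, q)) *
      (\<Prod>i<n. cinner (xs ! p i) (ys ! q i)))"
    by (intro sum.cong refl sum.swap)
  also have "\<dots> = (\<Sum>a\<in>K \<times> ?P. \<Sum>b\<in>K \<times> ?P. ?d a * cnj (?d b) *
      (\<Prod>i<n. cinner ((\<lambda>(xs, p). xs ! p i) a) ((\<lambda>(xs, p). xs ! p i) b)))"
    by (simp add: sum.cartesian_product')
  finally have eq: "fact n * (\<Sum>xs\<in>K. \<Sum>ys\<in>K. c xs * cnj (c ys) * gram xs ys) =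
      (\<Sum>a\<in>K \<times> ?P. \<Sum>b\<in>K \<times> ?P. ?d a * cnj (?d b) *
      (\<Prod>i<n. cinner ((\<lambda>(xs, p). xs ! p i) a) ((\<lambda>(xs, p). xs ! p i) b)))" .
  have "0 \<le> Re (fact n * (\<Sum>xs\<in>K. \<Sum>ys\<in>K. c xs * cnj (c ys) * gram xs ys))"
    unfolding eq
    by (rule prod_cinner_nonneg[where z = "\<lambda>i (xs, p). xs ! p i"])
      (simp add: assms(1) finite_permutations)
  also have "\<dots> = fact n * Re (\<Sum>xs\<in>K. \<Sum>ys\<in>K. c xs * cnj (c ys) * gram xs ys)"
    by (simp only: of_real_fact[where 'a = complex, symmetric] times_complex.sel
        Re_complex_of_real Im_complex_of_real mult_zero_left diff_zero)
  finally have le: "0 \<le> fact n * Re (\<Sum>xs\<in>K. \<Sum>ys\<in>K. c xs * cnj (c ys) * gram xs ys)" .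
  have "0 \<le> s" if "0 \<le> r * s" "0 < r" for r s :: real
    using that by (simp add: zero_le_mult_iff)
  from this[OF le fact_gt_zero] show ?thesis .
qed

lemma gram_nonneg:
  assumes "finite K"
  shows "0 \<le> Re (\<Sum>xs\<in>K. \<Sum>ys\<in>K. c xs * cnj (c ys) * gram xs ys)"
proof -
  let ?f = "\<lambda>xs ys. c xs * cnj (c ys) * gram xs ys"
  let ?K = "\<lambda>n. {xs \<in> K. length xs = n}"
  have "(\<Sum>xs\<in>K. \<Sum>ys\<in>K. ?f xs ys) = (\<Sum>n\<in>length ` K. \<Sum>xs\<in>?K n. \<Sum>ys\<in>K. ?f xs ys)"
    by (rule sum.image_gen[OF assms])
  also have "\<dots> = (\<Sum>n\<in>length ` K. \<Sum>xs\<in>?K n. \<Sum>ys\<in>?K n. ?f xs ys)"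
    using assms by (intro sum.cong refl sum.mono_neutral_right) (auto simp: gram_def)
  finally show ?thesis
    using assms by (simp only:) (rule Re_sum_nonneg, rule gram_nonneg_aux, auto)
qed

subsection \<open>The antisymmetric Fock space\<close>

text \<open>The Fock space is the Hilbert space completion of the space of formal linear
  combinations of lists, where the list \<open>[x\<^sub>1, \<dots>, x\<^sub>n]\<close> stands for
  the decomposable tensor \<open>x\<^sub>1 \<and> \<dots> \<and> x\<^sub>n\<close>,
  with respect to the semidefinite form which extends \<^const>\<open>gram\<close>. Lists of
  different lengths are orthogonal, so the completion is the orthogonal direct sum of the
  exterior powers; the multilinear and alternating relations hold because a combination of lists
  is identified with \<open>0\<close> when its seminorm vanishes. It is realized by Cauchy sequences
  modulo null sequences.\<close>

type_synonym 'a formal = "'a list \<Rightarrow>\<^sub>0 complex"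

definition fscale :: "complex \<Rightarrow> 'a formal \<Rightarrow> 'a formal" where
  "fscale c = Poly_Mapping.map ((*) c)"

definition finner :: "'a::complex_inner formal \<Rightarrow> 'a formal \<Rightarrow> complex" where
  "finner u v = (\<Sum>xs\<in>Poly_Mapping.keys u. \<Sum>ys\<in>Poly_Mapping.keys v. Poly_Mapping.lookup u xs * cnj (Poly_Mapping.lookup v ys) * gram xs ys)"

definition fnorm :: "'a::complex_inner formal \<Rightarrow> real" where
  "fnorm u = sqrt (Re (finner u u))"

definition fcauchy :: "(nat \<Rightarrow> 'a::complex_inner formal) \<Rightarrow> bool" where
  "fcauchy X \<longleftrightarrow> (\<forall>e>0. \<exists>M. \<forall>m\<ge>M. \<forall>n\<ge>M. fnorm (X m - X n) < e)"

definition frel ::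
    "(nat \<Rightarrow> 'a::complex_inner formal) \<Rightarrow> (nat \<Rightarrow> 'a formal) \<Rightarrow> bool" where
  "frel X Y \<longleftrightarrow> fcauchy X \<and> fcauchy Y \<and> (\<lambda>n. fnorm (X n - Y n)) \<longlonglongrightarrow> 0"

lemma lookup_fscale [simp]: "Poly_Mapping.lookup (fscale c u) k = c * Poly_Mapping.lookup u k"
  unfolding fscale_def by transfer (simp add: when_def)

lemma keys_fscale: "Poly_Mapping.keys (fscale c u) \<subseteq> Poly_Mapping.keys u"
  by (auto simp: in_keys_iff)

lemma finner_superset:
  assumes "finite A" "Poly_Mapping.keys u \<subseteq> A" "finite B" "Poly_Mapping.keys v \<subseteq> B"
  shows "finner u v = (\<Sum>xs\<in>A. \<Sum>ys\<in>B. Poly_Mapping.lookup u xs * cnj (Poly_Mapping.lookup v ys) * gram xs ys)"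
proof -
  have "finner u v = (\<Sum>xs\<in>A. \<Sum>ys\<in>Poly_Mapping.keys v. Poly_Mapping.lookup u xs * cnj (Poly_Mapping.lookup v ys) * gram xs ys)"
    unfolding finner_def using assms
    by (intro sum.mono_neutral_left) (auto simp: in_keys_iff)
  also have "\<dots> = (\<Sum>xs\<in>A. \<Sum>ys\<in>B. Poly_Mapping.lookup u xs * cnj (Poly_Mapping.lookup v ys) * gram xs ys)"
    using assms by (intro sum.cong refl sum.mono_neutral_left) (auto simp: in_keys_iff)
  finally show ?thesis .
qed

lemma finner_add_left: "finner (u + v) w = finner u w + finner v w"
proof -
  let ?A = "Poly_Mapping.keys u \<union> Poly_Mapping.keys v" and ?B = "Poly_Mapping.keys w"
  show ?thesis
    using keys_add[of u v]
    by (simp add: finner_superset[of ?A _ ?B] lookup_add sum.distrib algebra_simps)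
qed

lemma finner_scale_left: "finner (fscale c u) w = c * finner u w"
  using keys_fscale[of c u]
  by (simp add: finner_superset[of "Poly_Mapping.keys u" _ "Poly_Mapping.keys w"] sum_distrib_left mult_ac)

lemma finner_commute: "finner u v = cnj (finner v u)"
proof -
  have "finner u v =
      (\<Sum>ys\<in>Poly_Mapping.keys v. \<Sum>xs\<in>Poly_Mapping.keys u. Poly_Mapping.lookup u xs * cnj (Poly_Mapping.lookup v ys) * gram xs ys)"
    unfolding finner_def by (rule sum.swap)
  also have "\<dots> = cnj (finner v u)"
    by (simp add: finner_def mult_ac flip: gram_commute)
  finally show ?thesis .
qed

lemma finner_add_right: "finner w (u + v) = finner w u + finner w v"
  by (metis finner_add_left finner_commute complex_cnj_add)

lemma finner_scale_right: "finner w (fscale c u) = cnj c * finner w u"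
  by (metis finner_scale_left finner_commute complex_cnj_mult)

lemma finner_zero_left [simp]: "finner 0 u = 0"
  by (simp add: finner_def)

lemma finner_diff_left: "finner (u - v) w = finner u w - finner v w"
  using finner_add_left[of "u - v" v w] by simp

lemma finner_diff_right: "finner w (u - v) = finner w u - finner w v"
  using finner_add_right[of w "u - v" v] by simp

lemma finner_nonneg: "0 \<le> Re (finner u u)"
  unfolding finner_def by (rule gram_nonneg) simp

lemma finner_self: "finner u u = of_real ((fnorm u)\<^sup>2)"
proof (rule complex_eqI)
  show "Re (finner u u) = Re (of_real ((fnorm u)\<^sup>2))"
    using finner_nonneg[of u] by (simp add: fnorm_def)
  have "Im (finner u u) = - Im (finner u u)"
    using arg_cong[OF finner_commute[of u u], of Im] by simp
  then show "Im (finner u u) = Im (of_real ((fnorm u)\<^sup>2))" by simp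
qed

lemma fnorm_nonneg [simp]: "0 \<le> fnorm u"
  using finner_nonneg[of u] by (simp add: fnorm_def)

lemma fnorm_zero [simp]: "fnorm 0 = 0"
  by (simp add: fnorm_def)

lemma fnorm_fscale: "fnorm (fscale c u) = cmod c * fnorm u"
proof -
  have "finner (fscale c u) (fscale c u) = c * (cnj c * finner u u)"
    by (simp only: finner_scale_left finner_scale_right mult_ac)
  also have "\<dots> = of_real ((cmod c * fnorm u)\<^sup>2)"
  proof -
    have "c * cnj c = of_real ((cmod c)\<^sup>2)" by (rule complex_norm_square[symmetric])
    then show ?thesis
      by (simp only: mult.assoc[symmetric] finner_self) (simp add: power_mult_distrib)
  qed
  finally show ?thesis by (simp add: fnorm_def[of "fscale c u"] del: of_real_power)
qed

lemma fnorm_minus_commute: "fnorm (u - v) = fnorm (v - u)"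
proof -
  have "u - v = fscale (-1) (v - u)"
    by (rule poly_mapping_eqI) (simp add: lookup_minus)
  then show ?thesis by (simp add: fnorm_fscale)
qed

lemma finner_cauchy_schwarz: "cmod (finner u v) \<le> fnorm u * fnorm v"
proof -
  define a b c where "a = (fnorm u)\<^sup>2" and "b = finner u v" and "c = (fnorm v)\<^sup>2"
  have ineq: "0 \<le> a - 2 * t * (cmod b)\<^sup>2 + t\<^sup>2 * (cmod b)\<^sup>2 * c" for t :: real
  proof -
    let ?w = "fscale (of_real t * b) v"
    have b': "finner v u = cnj b" by (simp add: b_def flip: finner_commute)
    have bb: "b * cnj b = of_real ((cmod b)\<^sup>2)" by (rule complex_norm_square[symmetric])
    have "finner (u - ?w) (u - ?w) = finner u u - finner u ?w - finner ?w u + finner ?w ?w"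
      by (simp only: finner_diff_left finner_diff_right) simp
    also have "\<dots> = of_real a - of_real t * (b * cnj b) - of_real t * (b * cnj b)
          + of_real (t\<^sup>2) * (b * cnj b) * of_real c"
      unfolding finner_scale_left finner_scale_right b' b_def[symmetric]
      by (simp add: finner_self a_def c_def power2_eq_square mult_ac)
    also have "\<dots> = of_real (a - 2 * t * (cmod b)\<^sup>2 + t\<^sup>2 * (cmod b)\<^sup>2 * c)"
      unfolding bb by simp
    finally show ?thesis
      using finner_nonneg[of "u - ?w"] by (simp only: Re_complex_of_real)
  qed
  have "(cmod b)\<^sup>2 \<le> a * c"
  proof (cases "c = 0")
    case True
    have "(cmod b)\<^sup>2 = 0"
    proof (rule ccontr)
      assume "(cmod b)\<^sup>2 \<noteq> 0"
      then show False using ineq[of "(a + 1) / (2 * (cmod b)\<^sup>2)"] True by simp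
    qed
    then show ?thesis using True by simp
  next
    case False
    then have c: "c > 0" by (simp add: c_def)
    have "0 \<le> (a - (cmod b)\<^sup>2 / c) * c"
      using ineq[of "1 / c"] c by (simp add: power2_eq_square)
    then show ?thesis using c by (simp add: left_diff_distrib)
  qed
  then have "(cmod b)\<^sup>2 \<le> (fnorm u * fnorm v)\<^sup>2"
    by (simp add: a_def c_def power_mult_distrib)
  then show ?thesis unfolding b_def by (rule power2_le_imp_le) simp
qed

lemma fnorm_triangle: "fnorm (u + v) \<le> fnorm u + fnorm v"
proof (rule power2_le_imp_le)
  have "complex_of_real ((fnorm (u + v))\<^sup>2) =
      of_real ((fnorm u)\<^sup>2 + (fnorm v)\<^sup>2) + (finner u v + cnj (finner u v))"
    unfolding of_real_add finner_self[symmetric] finner_commute[of v u, symmetric]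
    by (simp only: finner_add_left finner_add_right) simp
  from arg_cong[OF this, of Re]
  have "(fnorm (u + v))\<^sup>2 = (fnorm u)\<^sup>2 + (fnorm v)\<^sup>2 + 2 * Re (finner u v)"
    by (simp del: of_real_power)
  also have "Re (finner u v) \<le> fnorm u * fnorm v"
    using finner_cauchy_schwarz[of u v] complex_Re_le_cmod order_trans by blast
  finally show "(fnorm (u + v))\<^sup>2 \<le> (fnorm u + fnorm v)\<^sup>2"
    by (simp add: power2_sum)
qed simp

lemma fnorm_diff_triangle: "fnorm (u - w) \<le> fnorm (u - v) + fnorm (v - w)"
  using fnorm_triangle[of "u - v" "v - w"] by simp

lemma fnorm_abs_diff: "\<bar>fnorm u - fnorm v\<bar> \<le> fnorm (u - v)"
  using fnorm_triangle[of "u - v" v] fnorm_triangle[of "v - u" u] fnorm_minus_commute[of u v]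
  by simp

lemma fcauchy_const: "fcauchy (\<lambda>_. u)"
  by (simp add: fcauchy_def)

lemma fcauchy_add:
  assumes "fcauchy X" "fcauchy Y"
  shows "fcauchy (\<lambda>n. X n + Y n)"
  unfolding fcauchy_def
proof (intro allI impI)
  fix e :: real assume "e > 0"
  then obtain M N where
    M: "\<And>m n. m \<ge> M \<Longrightarrow> n \<ge> M \<Longrightarrow> fnorm (X m - X n) < e / 2" and
    N: "\<And>m n. m \<ge> N \<Longrightarrow> n \<ge> N \<Longrightarrow> fnorm (Y m - Y n) < e / 2"
    using assms unfolding fcauchy_def by (meson half_gt_zero)
  have "fnorm (X m + Y m - (X n + Y n)) < e" if "m \<ge> max M N" "n \<ge> max M N" for m n
    using fnorm_triangle[of "X m - X n" "Y m - Y n"] M[of m n] N[of m n] that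
    by (simp add: algebra_simps)
  then show "\<exists>M. \<forall>m\<ge>M. \<forall>n\<ge>M. fnorm (X m + Y m - (X n + Y n)) < e" by blast
qed

lemma fscale_diff: "fscale c u - fscale c v = fscale c (u - v)"
  by (rule poly_mapping_eqI) (simp add: lookup_minus algebra_simps)

lemma fcauchy_fscale:
  assumes "fcauchy X"
  shows "fcauchy (\<lambda>n. fscale c (X n))"
  unfolding fcauchy_def
proof (intro allI impI)
  fix e :: real assume "e > 0"
  then have "e / (cmod c + 1) > 0" by (simp add: add_nonneg_pos)
  then obtain M where
    M: "\<And>m n. m \<ge> M \<Longrightarrow> n \<ge> M \<Longrightarrow> fnorm (X m - X n) < e / (cmod c + 1)"
    using assms unfolding fcauchy_def by meson
  have "fnorm (fscale c (X m) - fscale c (X n)) < e" if "m \<ge> M" "n \<ge> M" for m n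
  proof -
    have "cmod c * fnorm (X m - X n) \<le> (cmod c + 1) * fnorm (X m - X n)"
      by (simp add: mult_right_mono)
    also have "\<dots> < (cmod c + 1) * (e / (cmod c + 1))"
      using M[OF that] by (intro mult_strict_left_mono) (auto simp: add_nonneg_pos)
    also have "\<dots> = e" by (simp add: add_nonneg_pos less_imp_neq[symmetric])
    finally show ?thesis by (simp add: fscale_diff fnorm_fscale)
  qed
  then show "\<exists>M. \<forall>m\<ge>M. \<forall>n\<ge>M. fnorm (fscale c (X m) - fscale c (X n)) < e" by blast
qed

lemma fcauchy_bounded:
  assumes "fcauchy X"
  shows "\<exists>B>0. \<forall>n. fnorm (X n) \<le> B"
proof -
  obtain M where M: "\<And>m n. m \<ge> M \<Longrightarrow> n \<ge> M \<Longrightarrow> fnorm (X m - X n) < 1"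
    using assms unfolding fcauchy_def by (meson zero_less_one)
  define B where "B = fnorm (X M) + 1 + (\<Sum>i<M. fnorm (X i))"
  have s: "0 \<le> (\<Sum>i<M. fnorm (X i))" by (intro sum_nonneg) simp
  have "fnorm (X n) \<le> B" for n
  proof (cases "n < M")
    case True
    then have "fnorm (X n) \<le> (\<Sum>i<M. fnorm (X i))"
      by (intro member_le_sum) auto
    then show ?thesis using fnorm_nonneg[of "X M"] unfolding B_def by linarith
  next
    case False
    then show ?thesis using M[of n M] fnorm_abs_diff[of "X n" "X M"] s by (simp add: B_def)
  qed
  moreover have "B > 0" using s fnorm_nonneg[of "X M"] unfolding B_def by linarith
  ultimately show ?thesis by blast
qed

lemma finner_diff_bound:
  "cmod (finner u v - finner u' v') \<le> fnorm (u - u') * fnorm v + fnorm u' * fnorm (v - v')"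
proof -
  have "finner u v - finner u' v' = finner (u - u') v + finner u' (v - v')"
    by (simp add: finner_diff_left finner_diff_right)
  then show ?thesis
    using norm_triangle_ineq[of "finner (u - u') v" "finner u' (v - v')"]
      finner_cauchy_schwarz[of "u - u'" v] finner_cauchy_schwarz[of u' "v - v'"] by simp
qed

lemma finner_convergent:
  assumes "fcauchy X" "fcauchy Y"
  shows "convergent (\<lambda>n. finner (X n) (Y n))"
proof -
  obtain B where B: "B > 0" "\<And>n. fnorm (X n) \<le> B"
    using fcauchy_bounded[OF assms(1)] by auto
  obtain C where C: "C > 0" "\<And>n. fnorm (Y n) \<le> C"
    using fcauchy_bounded[OF assms(2)] by auto
  have "Cauchy (\<lambda>n. finner (X n) (Y n))"
  proof (rule metric_CauchyI)
    fix e :: real assume e: "e > 0"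
    have "e / (2 * C) > 0" "e / (2 * B) > 0" using B C e by auto
    then obtain M N where
      M: "\<And>m n. m \<ge> M \<Longrightarrow> n \<ge> M \<Longrightarrow> fnorm (X m - X n) < e / (2 * C)" and
      N: "\<And>m n. m \<ge> N \<Longrightarrow> n \<ge> N \<Longrightarrow> fnorm (Y m - Y n) < e / (2 * B)"
      using assms unfolding fcauchy_def by meson
    have "dist (finner (X m) (Y m)) (finner (X n) (Y n)) < e"
      if mn: "m \<ge> max M N" "n \<ge> max M N" for m n
    proof -
      have "fnorm (X m - X n) * fnorm (Y m) \<le> fnorm (X m - X n) * C"
        using C by (intro mult_left_mono) auto
      also have "\<dots> < e / (2 * C) * C"
        using M[of m n] C mn by (intro mult_strict_right_mono) auto
      also have "\<dots> = e / 2" using C by simp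
      finally have 1: "fnorm (X m - X n) * fnorm (Y m) < e / 2" .
      have "fnorm (X n) * fnorm (Y m - Y n) \<le> B * fnorm (Y m - Y n)"
        using B by (intro mult_right_mono) auto
      also have "\<dots> < B * (e / (2 * B))"
        using N[of m n] B mn by (intro mult_strict_left_mono) auto
      also have "\<dots> = e / 2" using B by simp
      finally show ?thesis
        using 1 finner_diff_bound[of "X m" "Y m" "X n" "Y n"] by (simp add: dist_norm)
    qed
    then show "\<exists>M. \<forall>m\<ge>M. \<forall>n\<ge>M. dist (finner (X m) (Y m)) (finner (X n) (Y n)) < e"
      by blast
  qed
  then show ?thesis by (rule Cauchy_convergent)
qed

lemma finner_lim_cong:
  assumes "frel X X'" "frel Y Y'"
  shows "lim (\<lambda>n. finner (X n) (Y n)) = lim (\<lambda>n. finner (X' n) (Y' n))"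
proof -
  have c: "fcauchy X" "fcauchy X'" "fcauchy Y" "fcauchy Y'"
    and n: "(\<lambda>n. fnorm (X n - X' n)) \<longlonglongrightarrow> 0" "(\<lambda>n. fnorm (Y n - Y' n)) \<longlonglongrightarrow> 0"
    using assms by (auto simp: frel_def)
  obtain B where "B > 0" and B: "\<And>n. fnorm (X' n) \<le> B"
    using fcauchy_bounded[OF c(2)] by auto
  obtain C where "C > 0" and C: "\<And>n. fnorm (Y n) \<le> C"
    using fcauchy_bounded[OF c(3)] by auto
  have "(\<lambda>n. fnorm (X n - X' n) * C + B * fnorm (Y n - Y' n)) \<longlonglongrightarrow> 0 * C + B * 0"
    using n by (intro tendsto_intros)
  then have "(\<lambda>n. finner (X n) (Y n) - finner (X' n) (Y' n)) \<longlonglongrightarrow> 0"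
  proof (rule Lim_null_comparison[rotated, OF tendsto_eq_rhs], goal_cases)
    case 2
    show ?case
    proof (intro always_eventually allI)
      fix n
      have "fnorm (X n - X' n) * fnorm (Y n) + fnorm (X' n) * fnorm (Y n - Y' n)
          \<le> fnorm (X n - X' n) * C + B * fnorm (Y n - Y' n)"
        using B C by (intro add_mono mult_left_mono mult_right_mono) auto
      then show "cmod (finner (X n) (Y n) - finner (X' n) (Y' n))
          \<le> fnorm (X n - X' n) * C + B * fnorm (Y n - Y' n)"
        using finner_diff_bound order_trans by blast
    qed
  qed simp
  moreover have "(\<lambda>n. finner (X' n) (Y' n)) \<longlonglongrightarrow> lim (\<lambda>n. finner (X' n) (Y' n))"
    using finner_convergent[OF c(2,4)] by (simp add: convergent_LIMSEQ_iff)
  ultimately have "(\<lambda>n. finner (X n) (Y n)) \<longlonglongrightarrow> lim (\<lambda>n. finner (X' n) (Y' n))"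
    using Lim_transform2 tendsto_add by fastforce
  then show ?thesis by (rule limI)
qed

lemma fnorm_squeeze:
  assumes "\<And>n. fnorm (X n) \<le> g n" "g \<longlonglongrightarrow> 0"
  shows "(\<lambda>n. fnorm (X n)) \<longlonglongrightarrow> 0"
  by (rule Lim_null_comparison[OF always_eventually assms(2)]) (simp add: assms(1))

lemma frel_refl: "fcauchy X \<Longrightarrow> frel X X"
  by (simp add: frel_def)

lemma frel_sym: "frel X Y \<Longrightarrow> frel Y X"
  by (simp add: frel_def fnorm_minus_commute)

lemma frel_trans:
  assumes "frel X Y" "frel Y Z"
  shows "frel X Z"
proof -
  have "(\<lambda>n. fnorm (X n - Y n) + fnorm (Y n - Z n)) \<longlonglongrightarrow> 0 + 0"
    using assms unfolding frel_def by (intro tendsto_add) auto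
  then have "(\<lambda>n. fnorm (X n - Z n)) \<longlonglongrightarrow> 0"
    by (intro fnorm_squeeze[OF fnorm_diff_triangle]) simp
  then show ?thesis using assms by (auto simp: frel_def)
qed

lemma frel_add:
  assumes "frel X X'" "frel Y Y'"
  shows "frel (\<lambda>n. X n + Y n) (\<lambda>n. X' n + Y' n)"
proof -
  have "(\<lambda>n. fnorm (X n - X' n) + fnorm (Y n - Y' n)) \<longlonglongrightarrow> 0 + 0"
    using assms unfolding frel_def by (intro tendsto_add) auto
  then have "(\<lambda>n. fnorm (X n + Y n - (X' n + Y' n))) \<longlonglongrightarrow> 0"
  proof (rule fnorm_squeeze[rotated, OF tendsto_eq_rhs])
    fix n
    show "fnorm (X n + Y n - (X' n + Y' n)) \<le> fnorm (X n - X' n) + fnorm (Y n - Y' n)"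
      using fnorm_triangle[of "X n - X' n" "Y n - Y' n"] by (simp add: algebra_simps)
  qed simp
  then show ?thesis using assms by (auto simp: frel_def intro: fcauchy_add)
qed

lemma frel_fscale:
  assumes "frel X X'"
  shows "frel (\<lambda>n. fscale c (X n)) (\<lambda>n. fscale c (X' n))"
proof -
  have "(\<lambda>n. cmod c * fnorm (X n - X' n)) \<longlonglongrightarrow> cmod c * 0"
    using assms unfolding frel_def by (intro tendsto_intros) auto
  then show ?thesis
    using assms by (auto simp: frel_def fscale_diff fnorm_fscale intro: fcauchy_fscale)
qed

quotient_type (overloaded) 'a fock = "nat \<Rightarrow> 'a::complex_inner formal" / partial: frel
proof (rule part_equivpI)
  show "\<exists>X :: nat \<Rightarrow> 'a formal. frel X X"
    by (rule exI[of _ "\<lambda>_. 0"]) (rule frel_refl[OF fcauchy_const])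
  show "symp (frel :: (nat \<Rightarrow> 'a formal) \<Rightarrow> _)" by (rule sympI) (rule frel_sym)
  show "transp (frel :: (nat \<Rightarrow> 'a formal) \<Rightarrow> _)" by (rule transpI) (rule frel_trans)
qed


lemma fock_cases: "\<exists>X. fcauchy X \<and> x = abs_fock X"
proof -
  have "frel (rep_fock x) (rep_fock x)" by (rule Quotient_rep_reflp[OF Quotient_fock])
  moreover have "x = abs_fock (rep_fock x)" by (simp add: Quotient_abs_rep[OF Quotient_fock])
  ultimately show ?thesis by (auto simp: frel_def)
qed

instantiation fock :: (complex_inner) complex_inner
begin

lift_definition zero_fock :: "'a fock" is "\<lambda>_. 0"
  by (rule frel_refl[OF fcauchy_const])

lift_definition plus_fock :: "'a fock \<Rightarrow> 'a fock \<Rightarrow> 'a fock" is "\<lambda>X Y n. X n + Y n"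
  by (rule frel_add)

lift_definition scaleC_fock :: "complex \<Rightarrow> 'a fock \<Rightarrow> 'a fock" is "\<lambda>c X n. fscale c (X n)"
  by (rule frel_fscale)

lift_definition cinner_fock :: "'a fock \<Rightarrow> 'a fock \<Rightarrow> complex"
  is "\<lambda>X Y. lim (\<lambda>n. finner (X n) (Y n))"
  by (rule finner_lim_cong)

definition uminus_fock :: "'a fock \<Rightarrow> 'a fock" where
  "uminus_fock x = (-1) *\<^sub>C x"

definition minus_fock :: "'a fock \<Rightarrow> 'a fock \<Rightarrow> 'a fock" where
  "minus_fock x y = x + - y"

definition scaleR_fock :: "real \<Rightarrow> 'a fock \<Rightarrow> 'a fock" where
  "scaleR_fock r x = complex_of_real r *\<^sub>C x"

definition norm_fock :: "'a fock \<Rightarrow> real" where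
  "norm_fock x = sqrt (Re (cinner x x))"

definition sgn_fock :: "'a fock \<Rightarrow> 'a fock" where
  "sgn_fock x = inverse (norm x) *\<^sub>R x"

definition dist_fock :: "'a fock \<Rightarrow> 'a fock \<Rightarrow> real" where
  "dist_fock x y = norm (x - y)"

definition uniformity_fock :: "('a fock \<times> 'a fock) filter" where
  "uniformity_fock = (INF e\<in>{0<..}. principal {(x, y). dist x y < e})"

definition open_fock :: "'a fock set \<Rightarrow> bool" where
  "open_fock U \<longleftrightarrow> (\<forall>x\<in>U. eventually (\<lambda>(x', y). x' = x \<longrightarrow> y \<in> U) uniformity)"

lemma plus_abs_fock:
  "fcauchy X \<Longrightarrow> fcauchy Y \<Longrightarrow> abs_fock X + abs_fock Y = abs_fock (\<lambda>n. X n + Y n)"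
  by (rule plus_fock.abs_eq) (auto intro: frel_refl)

lemma scaleC_abs_fock: "fcauchy X \<Longrightarrow> c *\<^sub>C abs_fock X = abs_fock (\<lambda>n. fscale c (X n))"
  by (rule scaleC_fock.abs_eq) (auto intro: frel_refl)

lemma cinner_abs_fock:
  "fcauchy X \<Longrightarrow> fcauchy Y \<Longrightarrow>
     (\<lambda>n. finner (X n) (Y n)) \<longlonglongrightarrow> cinner (abs_fock X) (abs_fock Y)"
  using finner_convergent[of X Y]
  by (subst cinner_fock.abs_eq) (auto intro: frel_refl simp: convergent_LIMSEQ_iff)

lemma abs_fock_eqI: "frel X Y \<Longrightarrow> abs_fock X = abs_fock Y"
  by (rule Quotient_rel_abs[OF Quotient_fock])

lemma norm_abs_fock:
  assumes "fcauchy X"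
  shows "(\<lambda>n. fnorm (X n)) \<longlonglongrightarrow> norm (abs_fock X)"
  unfolding fnorm_def norm_fock_def
  by (intro tendsto_intros cinner_abs_fock assms)

lemma diff_abs_fock:
  assumes "fcauchy X" "fcauchy Y"
  shows "abs_fock X - abs_fock Y = abs_fock (\<lambda>n. X n - Y n)"
proof -
  have eq: "(\<lambda>n. X n - Y n) = (\<lambda>n. X n + fscale (-1) (Y n))"
    by (rule ext, rule poly_mapping_eqI) (simp add: lookup_minus lookup_add)
  show ?thesis
    unfolding eq using assms
    by (simp add: minus_fock_def uminus_fock_def scaleC_abs_fock plus_abs_fock fcauchy_fscale)
qed

instance
proof
  fix x y z :: "'a fock" and a b :: real and c d :: complex
  obtain X where X: "fcauchy X" "x = abs_fock X" using fock_cases by blast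
  obtain Y where Y: "fcauchy Y" "y = abs_fock Y" using fock_cases by blast
  obtain Z where Z: "fcauchy Z" "z = abs_fock Z" using fock_cases by blast
  note XYZ = X(1) Y(1) Z(1) and xyz = X(2) Y(2) Z(2)
  note c = fcauchy_add fcauchy_fscale fcauchy_const XYZ
  note abs = plus_abs_fock scaleC_abs_fock zero_fock.abs_eq
  show add_assoc: "x + y + z = x + (y + z)"
    by (simp add: xyz abs c add.assoc)
  show "x + y = y + x"
    by (simp add: xyz abs c add.commute)
  show "0 + x = x"
    by (simp add: xyz abs c)
  have "fscale (-1) u + u = 0" for u :: "'a formal"
    by (rule poly_mapping_eqI) (simp add: lookup_add)
  then show "- x + x = 0"
    by (simp add: xyz abs c uminus_fock_def)
  show "x - y = x + - y" by (rule minus_fock_def)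
  have f1: "fscale c (u + v) = fscale c u + fscale c v"
    and f2: "fscale (c + d) u = fscale c u + fscale d u"
    and f3: "fscale c (fscale d u) = fscale (c * d) u"
    and f4: "fscale 1 u = u" for c d and u v :: "'a formal"
    by (rule poly_mapping_eqI, simp add: lookup_add algebra_simps)+
  have sr: "c *\<^sub>C (x + y) = c *\<^sub>C x + c *\<^sub>C y"
    and sl: "(c + d) *\<^sub>C x = c *\<^sub>C x + d *\<^sub>C x"
    and ss: "c *\<^sub>C d *\<^sub>C x = (c * d) *\<^sub>C x"
    and s1: "1 *\<^sub>C x = x" for c d
    by (simp_all add: xyz abs c f1 f2 f3 f4)
  show "c *\<^sub>C (x + y) = c *\<^sub>C x + c *\<^sub>C y" "(c + d) *\<^sub>C x = c *\<^sub>C x + d *\<^sub>C x"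
    "c *\<^sub>C d *\<^sub>C x = (c * d) *\<^sub>C x" by (fact sr sl ss)+
  show "a *\<^sub>R (x + y) = a *\<^sub>R x + a *\<^sub>R y" "(a + b) *\<^sub>R x = a *\<^sub>R x + b *\<^sub>R x"
    "a *\<^sub>R b *\<^sub>R x = (a * b) *\<^sub>R x" "1 *\<^sub>R x = x"
    by (simp_all add: scaleR_fock_def sr sl ss s1)
  show "a *\<^sub>R x = complex_of_real a *\<^sub>C x" by (rule scaleR_fock_def)
  show comm: "cinner x y = cnj (cinner y x)"
  proof (rule LIMSEQ_unique)
    show "(\<lambda>n. finner (X n) (Y n)) \<longlonglongrightarrow> cinner x y"
      unfolding xyz by (intro cinner_abs_fock XYZ)
    have "(\<lambda>n. cnj (finner (Y n) (X n))) \<longlonglongrightarrow> cnj (cinner y x)"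
      unfolding xyz by (intro tendsto_intros cinner_abs_fock XYZ)
    then show "(\<lambda>n. finner (X n) (Y n)) \<longlonglongrightarrow> cnj (cinner y x)"
      by (simp flip: finner_commute)
  qed
  show "cinner (x + y) z = cinner x z + cinner y z"
  proof (rule LIMSEQ_unique)
    show "(\<lambda>n. finner (X n + Y n) (Z n)) \<longlonglongrightarrow> cinner (x + y) z"
      unfolding xyz plus_abs_fock[OF XYZ(1,2)] by (intro cinner_abs_fock fcauchy_add XYZ)
    show "(\<lambda>n. finner (X n + Y n) (Z n)) \<longlonglongrightarrow> cinner x z + cinner y z"
      unfolding finner_add_left xyz by (intro tendsto_intros cinner_abs_fock XYZ)
  qed
  show "cinner (c *\<^sub>C x) y = c * cinner x y"
  proof (rule LIMSEQ_unique)
    show "(\<lambda>n. finner (fscale c (X n)) (Y n)) \<longlonglongrightarrow> cinner (c *\<^sub>C x) y"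
      unfolding xyz scaleC_abs_fock[OF XYZ(1)] by (intro cinner_abs_fock fcauchy_fscale XYZ)
    show "(\<lambda>n. finner (fscale c (X n)) (Y n)) \<longlonglongrightarrow> c * cinner x y"
      unfolding finner_scale_left xyz by (intro tendsto_intros cinner_abs_fock XYZ)
  qed
  have "(\<lambda>n. Re (finner (X n) (X n))) \<longlonglongrightarrow> Re (cinner x x)"
    unfolding xyz by (intro tendsto_intros cinner_abs_fock XYZ)
  then show pos: "0 \<le> Re (cinner x x)"
    by (rule LIMSEQ_le_const) (auto intro: finner_nonneg)
  show "norm x = sqrt (Re (cinner x x))" by (rule norm_fock_def)
  have n: "(\<lambda>n. fnorm (X n)) \<longlonglongrightarrow> norm x" "(\<lambda>n. fnorm (Y n)) \<longlonglongrightarrow> norm y"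
    unfolding xyz by (intro norm_abs_fock XYZ)+
  show "norm x = 0 \<longleftrightarrow> x = 0"
  proof
    assume "norm x = 0"
    then have "frel X (\<lambda>_. 0)" using n(1) X(1) by (simp add: frel_def fcauchy_const)
    then show "x = 0" unfolding X(2) zero_fock.abs_eq by (rule abs_fock_eqI)
  next
    assume "x = 0"
    have "(\<lambda>n. fnorm (0 :: 'a formal)) \<longlonglongrightarrow> norm (0 :: 'a fock)"
      unfolding zero_fock.abs_eq by (rule norm_abs_fock, rule fcauchy_const)
    from LIMSEQ_unique[OF this[unfolded fnorm_zero] tendsto_const]
    show "norm x = 0" unfolding \<open>x = 0\<close> .
  qed
  show "norm (x + y) \<le> norm x + norm y"
  proof (rule LIMSEQ_le)
    show "(\<lambda>n. fnorm (X n + Y n)) \<longlonglongrightarrow> norm (x + y)"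
      unfolding xyz plus_abs_fock[OF XYZ(1,2)] by (intro norm_abs_fock fcauchy_add XYZ)
    show "(\<lambda>n. fnorm (X n) + fnorm (Y n)) \<longlonglongrightarrow> norm x + norm y"
      by (intro tendsto_add n)
  qed (auto intro: fnorm_triangle)
  show "norm (a *\<^sub>R x) = \<bar>a\<bar> * norm x"
  proof (rule LIMSEQ_unique)
    show "(\<lambda>n. fnorm (fscale (complex_of_real a) (X n))) \<longlonglongrightarrow> norm (a *\<^sub>R x)"
      unfolding xyz scaleR_fock_def scaleC_abs_fock[OF XYZ(1)]
      by (intro norm_abs_fock fcauchy_fscale XYZ)
    show "(\<lambda>n. fnorm (fscale (complex_of_real a) (X n))) \<longlonglongrightarrow> \<bar>a\<bar> * norm x"
      unfolding fnorm_fscale norm_of_real by (intro tendsto_mult_left n)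
  qed
  show "sgn x = inverse (norm x) *\<^sub>R x" by (rule sgn_fock_def)
  show "dist x y = norm (x - y)" by (rule dist_fock_def)
  show "(uniformity :: ('a fock \<times> 'a fock) filter) =
      (INF e\<in>{0<..}. principal {(x, y). dist x y < e})" by (rule uniformity_fock_def)
  show "open U \<longleftrightarrow> (\<forall>x\<in>U. eventually (\<lambda>(x', y). x' = x \<longrightarrow> y \<in> U) uniformity)"
    for U :: "'a fock set" by (rule open_fock_def)
qed

end

definition fembed :: "'a::complex_inner formal \<Rightarrow> 'a fock" where
  "fembed v = abs_fock (\<lambda>_. v)"

lemma cinner_fembed: "cinner (fembed u) (fembed v) = finner u v"
proof -
  have "(\<lambda>_::nat. finner u v) \<longlonglongrightarrow> cinner (fembed u) (fembed v)"
    unfolding fembed_def by (rule cinner_abs_fock) (rule fcauchy_const)+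
  then show ?thesis using LIMSEQ_unique by blast
qed

lemma fembed_add: "fembed (u + v) = fembed u + fembed v"
  by (simp add: fembed_def plus_abs_fock fcauchy_const)

lemma fembed_diff: "fembed (u - v) = fembed u - fembed v"
  by (simp add: fembed_def diff_abs_fock fcauchy_const)

lemma fembed_fscale: "fembed (fscale c u) = c *\<^sub>C fembed u"
  by (simp add: fembed_def scaleC_abs_fock fcauchy_const)

lemma fembed_zero: "fembed 0 = 0"
  by (simp add: fembed_def zero_fock.abs_eq)

lemma fembed_sum: "fembed (sum f A) = (\<Sum>i\<in>A. fembed (f i))"
  by (induction A rule: infinite_finite_induct) (auto simp: fembed_zero fembed_add)

lemma norm_fembed: "norm (fembed u) = fnorm u"
  by (simp add: norm_eq_sqrt_cinner cinner_fembed fnorm_def)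

lemma fembed_tendsto:
  assumes "fcauchy v"
  shows "(\<lambda>k. fembed (v k)) \<longlonglongrightarrow> abs_fock v"
proof (rule LIMSEQ_I)
  fix e :: real assume e: "e > 0"
  then obtain M where M: "\<And>m n. m \<ge> M \<Longrightarrow> n \<ge> M \<Longrightarrow> fnorm (v m - v n) < e / 2"
    using assms unfolding fcauchy_def by (meson half_gt_zero)
  have "norm (fembed (v k) - abs_fock v) < e" if "k \<ge> M" for k
  proof -
    have "fcauchy (\<lambda>n. v k - v n)"
      using fcauchy_add[OF fcauchy_const[of "v k"] fcauchy_fscale[OF assms, of "-1"]]
      by (rule back_subst[of fcauchy])
        (auto simp: fun_eq_iff lookup_minus lookup_add intro!: poly_mapping_eqI)
    then have "(\<lambda>n. fnorm (v k - v n)) \<longlonglongrightarrow> norm (fembed (v k) - abs_fock v)"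
      unfolding fembed_def diff_abs_fock[OF fcauchy_const assms] by (rule norm_abs_fock)
    moreover have "\<exists>N. \<forall>n\<ge>N. fnorm (v k - v n) \<le> e / 2"
      using M[OF that] by (intro exI[of _ M]) (auto intro: less_imp_le)
    ultimately have "norm (fembed (v k) - abs_fock v) \<le> e / 2"
      by (rule LIMSEQ_le_const2)
    then show ?thesis using e by simp
  qed
  then show "\<exists>M. \<forall>k\<ge>M. norm (fembed (v k) - abs_fock v) < e" by blast
qed

lemma fembed_dense: 
  assumes "e > 0"
  shows "\<exists>v. norm (y - fembed v) < e"
proof -
  obtain X where X: "fcauchy X" "y = abs_fock X" using fock_cases by blast
  obtain k where "norm (fembed (X k) - y) < e"
    using LIMSEQ_D[OF fembed_tendsto[OF X(1)] assms] X(2) by blast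
  then show ?thesis by (auto simp: norm_minus_commute)
qed

instance fock :: (complex_inner) chilbert_space
proof
  fix Y :: "nat \<Rightarrow> 'a fock" assume Y: "Cauchy Y"
  have "\<exists>v. norm (Y k - fembed v) < 1 / real (Suc k)" for k
    by (rule fembed_dense) simp
  then obtain v where v: "\<And>k. norm (Y k - fembed (v k)) < 1 / real (Suc k)" by metis
  have "(\<lambda>k. Y k - fembed (v k)) \<longlonglongrightarrow> 0"
    by (rule Lim_null_comparison[OF always_eventually LIMSEQ_inverse_real_of_nat])
      (use v in \<open>auto simp: inverse_eq_divide intro: less_imp_le\<close>)
  then have d: "Cauchy (\<lambda>k. Y k - fembed (v k))" by (rule LIMSEQ_imp_Cauchy)
  have "Cauchy (\<lambda>k. fembed (v k))"
  proof (rule CauchyI)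
    fix e :: real assume "e > 0"
    then obtain M N where
      M: "\<And>m n. m \<ge> M \<Longrightarrow> n \<ge> M \<Longrightarrow> norm (Y m - Y n) < e / 2" and
      N: "\<And>m n. m \<ge> N \<Longrightarrow> n \<ge> N \<Longrightarrow>
        norm ((Y m - fembed (v m)) - (Y n - fembed (v n))) < e / 2"
      using Y d unfolding Cauchy_iff by (meson half_gt_zero)
    have "norm (fembed (v m) - fembed (v n)) < e" if "m \<ge> max M N" "n \<ge> max M N" for m n
      using M[of m n] N[of m n] that
        norm_triangle_ineq4[of "Y m - Y n" "(Y m - fembed (v m)) - (Y n - fembed (v n))"]
      by (simp add: algebra_simps)
    then show "\<exists>M. \<forall>m\<ge>M. \<forall>n\<ge>M. norm (fembed (v m) - fembed (v n)) < e" by blast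
  qed
  then have fv: "fcauchy v"
    unfolding fcauchy_def by (simp add: Cauchy_iff norm_fembed flip: fembed_diff)
  have "(\<lambda>k. (Y k - fembed (v k)) + fembed (v k)) \<longlonglongrightarrow> 0 + abs_fock v"
    by (rule tendsto_add) (fact | rule fembed_tendsto[OF fv])+
  then show "convergent Y" by (auto simp: convergent_def)
qed

definition wedge :: "'a::complex_inner list \<Rightarrow> 'a fock" where
  "wedge xs = fembed (Poly_Mapping.single xs 1)"

lemma cinner_wedge: "cinner (wedge xs) (wedge ys) = gram xs ys"
  by (simp add: wedge_def cinner_fembed finner_def)

lemma wedge_dense: "closure (cspan (range wedge)) = UNIV"
proof -
  have "fembed v \<in> cspan (range wedge)" for v :: "'a formal"
  proof -
    have "v = (\<Sum>xs\<in>Poly_Mapping.keys v.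
        fscale (Poly_Mapping.lookup v xs) (Poly_Mapping.single xs 1))"
    proof (rule poly_mapping_eqI)
      fix k
      have "(\<Sum>xs\<in>Poly_Mapping.keys v.
            Poly_Mapping.lookup v xs * Poly_Mapping.lookup (Poly_Mapping.single xs 1) k) =
          (\<Sum>xs\<in>Poly_Mapping.keys v. if xs = k then Poly_Mapping.lookup v xs else 0)"
        by (intro sum.cong refl) (simp add: lookup_single when_def)
      then show "Poly_Mapping.lookup v k = Poly_Mapping.lookup (\<Sum>xs\<in>Poly_Mapping.keys v.
          fscale (Poly_Mapping.lookup v xs) (Poly_Mapping.single xs 1)) k"
        by (simp add: lookup_sum in_keys_iff)
    qed
    then have "fembed v = (\<Sum>xs\<in>Poly_Mapping.keys v. Poly_Mapping.lookup v xs *\<^sub>C wedge xs)"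
      by (metis (no_types, lifting) fembed_sum fembed_fscale wedge_def sum.cong)
    also have "\<dots> \<in> cspan (range wedge)"
      by (intro complex_vector.span_sum complex_vector.span_scale complex_vector.span_base) auto
    finally show ?thesis .
  qed
  then have "y \<in> closure (cspan (range wedge))" for y :: "'a fock"
    unfolding closure_approachable dist_norm
    by (metis fembed_dense norm_minus_commute)
  then show ?thesis by blast
qed

subsection \<open>Bounded operators on a complex Hilbert space\<close>

text \<open>The type \<open>'a \<Rightarrow>\<^sub>L 'a\<close> consists of the bounded real-linear
  operators. The operators of interest are the complex-linear ones among them; their operator norm
  is the norm of this type.\<close>

abbreviation clinear :: "('a::complex_inner \<Rightarrow> 'b::complex_inner) \<Rightarrow> bool" where
  "clinear \<equiv> Vector_Spaces.linear scaleC scaleC"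

lemma norm_scaleC: "norm (c *\<^sub>C x) = cmod c * norm (x :: 'a::complex_inner)"
proof -
  have "cinner (c *\<^sub>C x) (c *\<^sub>C x) = (c * cnj c) * cinner x x"
    by (simp only: cinner_scaleC_left cinner_scaleC_right mult_ac)
  also have "\<dots> = of_real ((cmod c * norm x)\<^sup>2)"
    unfolding complex_norm_square[symmetric] cinner_self by (simp add: power_mult_distrib)
  finally show ?thesis
    by (simp add: norm_eq_sqrt_cinner[of "c *\<^sub>C x"] del: of_real_power)
qed

lemma bounded_linear_scaleC_right:
  "bounded_linear (\<lambda>x :: 'a::complex_inner. c *\<^sub>C x)"
proof (rule bounded_linear_intro[where K = "cmod c"])
  show "c *\<^sub>C (r *\<^sub>R x) = r *\<^sub>R c *\<^sub>C x" for r and x :: 'a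
    by (simp add: scaleR_scaleC scaleC_scaleC mult.commute)
qed (simp_all add: scaleC_add_right norm_scaleC mult.commute)

instantiation blinfun :: (real_normed_vector, complex_inner) scaleC
begin

lift_definition scaleC_blinfun :: "complex \<Rightarrow> ('a \<Rightarrow>\<^sub>L 'b) \<Rightarrow> ('a \<Rightarrow>\<^sub>L 'b)"
  is "\<lambda>c A x. c *\<^sub>C A x"
  by (rule bounded_linear_compose[OF bounded_linear_scaleC_right])

instance ..

end

definition cadjoint :: "('a::chilbert_space \<Rightarrow>\<^sub>L 'a) \<Rightarrow> ('a \<Rightarrow>\<^sub>L 'a)" where
  "cadjoint A = (THE B. \<forall>x y. cinner (blinfun_apply A x) y = cinner x (blinfun_apply B y))"

definition unitary :: "('a::chilbert_space \<Rightarrow> 'a) \<Rightarrow> bool" where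
  "unitary U \<longleftrightarrow> clinear U \<and> surj U \<and> (\<forall>x y. cinner (U x) (U y) = cinner x y)"

definition eigenvectors :: "('a::chilbert_space \<Rightarrow> 'a) \<Rightarrow> 'a set" where
  "eigenvectors U = {x. x \<noteq> 0 \<and> (\<exists>c. U x = c *\<^sub>C x)}"

definition pure_point_spectrum :: "('a::chilbert_space \<Rightarrow> 'a) \<Rightarrow> bool" where
  "pure_point_spectrum U \<longleftrightarrow> closure (cspan (eigenvectors U)) = UNIV"

subsection \<open>Algebras of operators, automorphisms and states\<close>

text \<open>Concrete C*-algebras, that is, norm-closed selfadjoint subalgebras of the algebra of all
  bounded operators on a Hilbert space. A unit is not required.\<close>

definition cstar_algebra :: "('a::chilbert_space \<Rightarrow>\<^sub>L 'a) set \<Rightarrow> bool" where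
  "cstar_algebra \<A> \<longleftrightarrow>
     (\<forall>A\<in>\<A>. clinear (blinfun_apply A)) \<and>
     0 \<in> \<A> \<and>
     (\<forall>A\<in>\<A>. \<forall>B\<in>\<A>. A + B \<in> \<A> \<and> A o\<^sub>L B \<in> \<A>) \<and>
     (\<forall>c. \<forall>A\<in>\<A>. c *\<^sub>C A \<in> \<A>) \<and>
     (\<forall>A\<in>\<A>. cadjoint A \<in> \<A>) \<and>
     closed \<A>"

definition star_automorphism ::
    "('a::chilbert_space \<Rightarrow>\<^sub>L 'a) set \<Rightarrow> (('a \<Rightarrow>\<^sub>L 'a) \<Rightarrow> ('a \<Rightarrow>\<^sub>L 'a)) \<Rightarrow> bool"
  where
  "star_automorphism \<A> \<alpha> \<longleftrightarrow>
     bij_betw \<alpha> \<A> \<A> \<and>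
     (\<forall>A\<in>\<A>. \<forall>B\<in>\<A>. \<alpha> (A + B) = \<alpha> A + \<alpha> B \<and> \<alpha> (A o\<^sub>L B) = \<alpha> A o\<^sub>L \<alpha> B) \<and>
     (\<forall>c. \<forall>A\<in>\<A>. \<alpha> (c *\<^sub>C A) = c *\<^sub>C \<alpha> A) \<and>
     (\<forall>A\<in>\<A>. \<alpha> (cadjoint A) = cadjoint (\<alpha> A))"

text \<open>A state is a positive linear functional of norm one; the last two conjuncts say that \<open>1\<close>
  is the least bound of the functional. Values outside the algebra are irrelevant.\<close>

definition state ::
    "('a::chilbert_space \<Rightarrow>\<^sub>L 'a) set \<Rightarrow> (('a \<Rightarrow>\<^sub>L 'a) \<Rightarrow> complex) \<Rightarrow> bool"
  where
  "state \<A> \<rho> \<longleftrightarrow>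
     (\<forall>A\<in>\<A>. \<forall>B\<in>\<A>. \<rho> (A + B) = \<rho> A + \<rho> B) \<and>
     (\<forall>c. \<forall>A\<in>\<A>. \<rho> (c *\<^sub>C A) = c * \<rho> A) \<and>
     (\<forall>A\<in>\<A>. \<rho> (cadjoint A o\<^sub>L A) \<in> \<real>\<^sub>\<ge>\<^sub>0) \<and>
     (\<forall>A\<in>\<A>. cmod (\<rho> A) \<le> norm A) \<and>
     (\<forall>c. (\<forall>A\<in>\<A>. cmod (\<rho> A) \<le> c * norm A) \<longrightarrow> 1 \<le> c)"

subsection \<open>Linear disjointness from the Moebius function\<close>

definition moebius_mu :: "nat \<Rightarrow> int" where
  "moebius_mu n = (if squarefree n then (-1) ^ card (prime_factors n) else 0)"

definition moebius_disjoint ::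
    "('a::chilbert_space \<Rightarrow>\<^sub>L 'a) set \<Rightarrow> (('a \<Rightarrow>\<^sub>L 'a) \<Rightarrow> ('a \<Rightarrow>\<^sub>L 'a)) \<Rightarrow> bool"
  where
  "moebius_disjoint \<A> \<alpha> \<longleftrightarrow>
     (\<forall>\<rho> A. state \<A> \<rho> \<and> A \<in> \<A> \<longrightarrow>
       (\<lambda>N. 1 / of_nat N * (\<Sum>n=1..N. of_int (moebius_mu n) * \<rho> ((\<alpha> ^^ n) A)))
         \<longlonglongrightarrow> 0)"

subsection \<open>The CAR algebra and Bogoliubov automorphisms\<close>

text \<open>Since the inner product of decomposable tensors is the plain determinant, without a factor
  \<open>1 / fact n\<close>, exterior multiplication by \<open>f\<close> is bounded with norm
  \<open>norm f\<close> and satisfies the canonical anticommutation relations exactly as normalized by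
  \<open>cinner f g\<close>.\<close>

definition creation :: "'a::chilbert_space \<Rightarrow> ('a fock \<Rightarrow>\<^sub>L 'a fock)" where
  "creation f =
     (THE A. clinear (blinfun_apply A) \<and>
       (\<forall>xs. blinfun_apply A (wedge xs) = wedge (f # xs)))"

definition CAR :: "('a::chilbert_space fock \<Rightarrow>\<^sub>L 'a fock) set" where
  "CAR = cstar_algebra hull range creation"

definition bogoliubov_automorphism ::
    "('a::chilbert_space \<Rightarrow> 'a) \<Rightarrow>
      (('a fock \<Rightarrow>\<^sub>L 'a fock) \<Rightarrow> ('a fock \<Rightarrow>\<^sub>L 'a fock)) \<Rightarrow> bool"
  where
  "bogoliubov_automorphism U \<alpha> \<longleftrightarrow>
     star_automorphism CAR \<alpha> \<and> (\<forall>f. \<alpha> (creation f) = creation (U f))"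

end

theory Submission
  imports Defs
    "HOL-Complex_Analysis.Complex_Analysis"
    "HOL-Number_Theory.Number_Theory"
    "HOL-Real_Asymp.Real_Asymp"
    "HOL-Probability.Sinc_Integral"
    "Jordan_Normal_Form.Determinant"
begin

text \<open>
  On a creation operator of an eigenvector of \<open>U\<close> the automorphism acts as multiplication by a
  number \<open>l\<close> with \<open>cmod l = 1\<close>. Products and adjoints of such eigenoperators are again
  eigenoperators with unimodular eigenvalues, and since creation operators depend continuously on
  the vector, the finite sums of eigenoperators are dense in \<open>CAR\<close>. The automorphism is contractive
  (\<open>contractive\<close>), so the theorem reduces to the statement that the means of
  \<open>moebius_mu n * l ^ n\<close> tend to zero for every unimodular \<open>l\<close> (\<open>moebius_mean_unimodular\<close>).

  If \<open>l\<close> is not a root of unity, this follows from the Daboussi-Katai criterion: the powers of \<open>l\<close>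
  along the multiples of two distinct primes are uncorrelated, while \<open>moebius_mu\<close> at multiples of a
  prime repeats itself up to sign (\<open>moebius_mean_not_root_of_unity\<close>).

  If \<open>l\<close> is a root of unity, then \<open>l ^ n\<close> is periodic in \<open>n\<close> and a combination of Dirichlet
  characters evaluated at quotients of \<open>n\<close>. For a character \<open>ch\<close> the Dirichlet series of
  \<open>moebius_mu n * ch n\<close> is the reciprocal of the L-function, which extends continuously to the line
  \<open>Re s = 1\<close> because the L-function has no zeros there: away from real characters at \<open>s = 1\<close> by the
  classical inequality \<open>three_four_one\<close>, and in the remaining case by a Lambert series argument
  (\<open>real_nonvanishing\<close>). The Tauberian theorem \<open>mean_zero_of_continuous_dirichlet_series\<close>, proved
  with the Fejer kernel, turns this continuity into the vanishing of the mean.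

  On the operator side, the boundedness of the creation operators comes from the anticommutation
  relation between exterior and interior multiplication on formal combinations of tensors, that
  is, from the expansion of Gram determinants along a row (\<open>gram_Cons\<close>).
\<close>

section \<open>Sums over divisors and the Moebius function\<close>

lemma multiplicity_prime_power_mult:
  fixes p m :: nat
  assumes p: "prime p" and m: "\<not> p dvd m"
  shows "multiplicity p (p ^ k * m) = k"
proof -
  have "m \<noteq> 0" using m by (auto intro!: Nat.gr0I)
  then show ?thesis
    using p m by (simp add: prime_elem_multiplicity_mult_distrib not_dvd_imp_multiplicity_0)
qed

text \<open>A divisor of \<open>p ^ k * m\<close> is \<open>p ^ i * d\<close> for a unique \<open>i \<le> k\<close> and a unique
  divisor \<open>d\<close> of \<open>m\<close>. Together with \<open>prime_power_split\<close> this evaluates divisor sums of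
  multiplicative functions by induction, one prime at a time.\<close>

lemma sum_divisors_prime_power_mult:
  fixes F :: "nat \<Rightarrow> 'a::comm_monoid_add"
  assumes p: "prime p" and m: "\<not> p dvd m" "m > 0"
  shows "(\<Sum>d | d dvd p ^ k * m. F d) = (\<Sum>i\<le>k. \<Sum>d | d dvd m. F (p ^ i * d))"
proof -
  have inj: "inj_on (\<lambda>(i, d). p ^ i * d) ({..k} \<times> {d. d dvd m})"
  proof (rule inj_onI, clarsimp)
    fix i d j e assume d: "d dvd m" and e: "e dvd m" and eq: "p ^ i * d = p ^ j * e"
    have nd: "\<not> p dvd d" "\<not> p dvd e" using d e m(1) dvd_trans by blast+
    have "i = j" using multiplicity_prime_power_mult[OF p] nd eq by metis
    with eq p show "i = j \<and> d = e" by auto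
  qed
  have img: "(\<lambda>(i, d). p ^ i * d) ` ({..k} \<times> {d. d dvd m}) = {d. d dvd p ^ k * m}"
  proof (intro equalityI subsetI)
    fix x assume "x \<in> (\<lambda>(i, d). p ^ i * d) ` ({..k} \<times> {d. d dvd m})"
    then show "x \<in> {d. d dvd p ^ k * m}" by (auto intro!: mult_dvd_mono le_imp_power_dvd)
  next
    fix x assume "x \<in> {d. d dvd p ^ k * m}"
    then have x: "x dvd p ^ k * m" by simp
    have "x \<noteq> 0" using x m(2) p by (auto intro!: Nat.gr0I)
    moreover have "\<not> is_unit p" using p by auto
    ultimately obtain y where y: "x = p ^ multiplicity p x * y" "\<not> p dvd y"
      using multiplicity_decompose' by blast
    define i where "i = multiplicity p x"
    have "p ^ i dvd p ^ k * m" using x y(1) i_def by (metis dvd_mult_left)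
    moreover have "coprime (p ^ i) m" using p m(1) by (simp add: prime_imp_coprime)
    ultimately have "p ^ i dvd p ^ k" using coprime_dvd_mult_left_iff by blast
    then have "i \<le> k" using p by (meson power_dvd_imp_le prime_gt_1_nat)
    moreover have "y dvd p ^ k * m" using x y(1) by (metis dvd_mult_right)
    moreover have "coprime y (p ^ k)" using p y(2)
      by (metis coprime_commute coprime_power_left_iff prime_imp_coprime)
    ultimately have "i \<le> k" "y dvd m" using coprime_dvd_mult_right_iff by blast+
    then show "x \<in> (\<lambda>(i, d). p ^ i * d) ` ({..k} \<times> {d. d dvd m})"
      using y(1) i_def by (intro image_eqI[of _ _ "(i, y)"]) auto
  qed
  have "(\<Sum>d | d dvd p ^ k * m. F d) = (\<Sum>x\<in>{..k} \<times> {d. d dvd m}. F (case x of (i, d) \<Rightarrow> p ^ i * d))"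
    unfolding img[symmetric] by (subst sum.reindex[OF inj]) (simp add: o_def)
  also have "\<dots> = (\<Sum>i\<le>k. \<Sum>d | d dvd m. F (p ^ i * d))"
    by (simp add: sum.cartesian_product')
  finally show ?thesis .
qed

lemma prime_power_split:
  fixes n :: nat
  assumes "n > 1"
  obtains p k m where "prime p" "k > 0" "\<not> p dvd m" "m > 0" "m < n" "n = p ^ k * m"
proof -
  from assms obtain p where p: "prime p" "p dvd n" using prime_factor_nat[of n] by auto
  have "n \<noteq> 0" "\<not> is_unit p" using assms p by auto
  then obtain y where y: "n = p ^ multiplicity p n * y" "\<not> p dvd y"
    using multiplicity_decompose' by blast
  have k: "multiplicity p n > 0" using p assms by (simp add: prime_multiplicity_gt_zero_iff)
  have y0: "y > 0" using y assms by (auto intro!: Nat.gr0I)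
  have "1 < p ^ multiplicity p n" by (rule one_less_power[OF prime_gt_1_nat[OF p(1)] k])
  then have "y < n" using y(1) y0
    by (metis mult.commute mult.right_neutral mult_less_cancel1 nat_mult_1)
  with that[OF p(1) k y(2) y0 _ y(1)] show ?thesis by blast
qed

lemma sum_multiples:
  fixes f :: "nat \<Rightarrow> 'a::comm_monoid_add"
  assumes "d > 0"
  shows "(\<Sum>n | n \<in> {1..N} \<and> d dvd n. f n) = (\<Sum>m=1..N div d. f (d * m))"
  by (rule sum.reindex_bij_witness[of _ "\<lambda>m. d * m" "\<lambda>n. n div d"])
     (use assms in \<open>auto elim!: dvdE simp: less_eq_div_iff_mult_less_eq mult.commute Suc_le_eq\<close>)

lemma card_multiples:
  assumes "d > 0"
  shows "card {n \<in> {1..N}. d dvd n} = N div d"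
  using sum_multiples[OF assms, of "\<lambda>_. 1 :: nat" N] by simp

lemma moebius_mu_1 [simp]: "moebius_mu (Suc 0) = 1"
  by (simp add: moebius_mu_def)

lemma moebius_mu_abs_le: "\<bar>moebius_mu n\<bar> \<le> 1"
  by (simp add: moebius_mu_def)

lemma norm_moebius_mu_le_1: "cmod (of_int (moebius_mu n)) \<le> 1"
  using moebius_mu_abs_le[of n] by (metis norm_of_int of_int_abs of_int_le_1_iff)

lemma moebius_mu_mult_coprime:
  assumes "coprime a b"
  shows "moebius_mu (a * b) = moebius_mu a * moebius_mu b"
proof (cases "squarefree (a * b)")
  case True
  then have sf: "squarefree a" "squarefree b" by (auto dest: squarefree_multD)
  then have "a \<noteq> 0" "b \<noteq> 0" using not_squarefree_0 by metis+
  then have "prime_factors (a * b) = prime_factors a \<union> prime_factors b"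
    by (simp add: prime_factors_product)
  moreover have "prime_factors a \<inter> prime_factors b = {}"
  proof -
    have False if "x \<in> prime_factors a" "x \<in> prime_factors b" for x
    proof -
      have "x dvd a" "x dvd b" "prime x" using that by auto
      then show False using assms coprime_common_divisor not_prime_unit by blast
    qed
    then show ?thesis by blast
  qed
  ultimately have "card (prime_factors (a * b)) = card (prime_factors a) + card (prime_factors b)"
    by (simp add: card_Un_disjoint)
  then show ?thesis using True sf by (simp add: moebius_mu_def power_add)
next
  case False
  then show ?thesis using squarefree_mult_coprime[OF assms] by (auto simp: moebius_mu_def)
qed

lemma moebius_mu_mult_not_coprime:
  assumes "\<not> coprime a b"
  shows "moebius_mu (a * b) = 0"
proof -
  obtain c where c: "c dvd a" "c dvd b" "\<not> c dvd 1"
    using assms by (auto simp: coprime_def)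
  then have "c ^ 2 dvd a * b" by (simp add: power2_eq_square mult_dvd_mono)
  with c(3) have "\<not> squarefree (a * b)" by (intro not_squarefreeI)
  then show ?thesis by (simp add: moebius_mu_def)
qed

lemma moebius_mu_prime:
  assumes "prime p" shows "moebius_mu p = -1"
  using assms squarefree_prime[OF assms] by (simp add: moebius_mu_def prime_factorization_prime)

lemma moebius_mu_prime_mult:
  assumes "prime p" "\<not> p dvd m"
  shows "moebius_mu (p * m) = - moebius_mu m"
  using assms by (simp add: moebius_mu_mult_coprime prime_imp_coprime moebius_mu_prime)

text \<open>Splitting off a power of a prime \<open>p\<close>, only the divisors with exponent \<open>0\<close> or \<open>1\<close> of
  \<open>p\<close> contribute, and they cancel in pairs.\<close>

lemma sum_moebius_mu:
  assumes "n > 0"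
  shows "(\<Sum>d | d dvd n. moebius_mu d) = (if n = 1 then 1 else 0)"
proof (cases "n = 1")
  case False
  then have "n > 1" using assms by simp
  then obtain p k m where pkm: "prime p" "k > 0" "\<not> p dvd m" "m > 0" "n = p ^ k * m"
    by (rule prime_power_split)
  have z: "moebius_mu (p ^ i * d) = 0" if "i \<ge> 2" for i d
  proof -
    have "p ^ 2 dvd p ^ i * d" using that by (simp add: le_imp_power_dvd dvd_mult2)
    then have "\<not> squarefree (p ^ i * d)" using pkm(1) not_prime_unit by (intro not_squarefreeI) auto
    then show ?thesis by (simp add: moebius_mu_def)
  qed
  have m1: "moebius_mu (p * d) = - moebius_mu d" if "d dvd m" for d
    using moebius_mu_prime_mult[OF pkm(1)] that pkm(3) dvd_trans by blast
  have "(\<Sum>d | d dvd n. moebius_mu d) = (\<Sum>i\<le>k. \<Sum>d | d dvd m. moebius_mu (p ^ i * d))"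
    unfolding pkm(5) by (rule sum_divisors_prime_power_mult[OF pkm(1,3,4)])
  also have "\<dots> = (\<Sum>i\<in>{0,1}. \<Sum>d | d dvd m. moebius_mu (p ^ i * d))"
    using pkm(2) z by (intro sum.mono_neutral_right) (auto intro!: sum.neutral)
  also have "\<dots> = 0" by (simp add: m1 sum_negf)
  finally show ?thesis using False by simp
qed simp

text \<open>A pair of positive integers is an integer \<open>n\<close> with a marked divisor. This rearrangement
  underlies both the Dirichlet convolution and the Lambert series below.\<close>

lemma has_sum_divisor_pairs:
  fixes g :: "nat \<times> nat \<Rightarrow> complex"
  assumes "(g has_sum S) ({1..} \<times> {1..})"
  shows "((\<lambda>n. \<Sum>d | d dvd n. g (d, n div d)) has_sum S) {1..}"
proof (rule has_sum_SigmaD)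
  have "((\<lambda>(n, d). g (d, n div d)) has_sum S) (Sigma {1..} (\<lambda>n. {d. d dvd n})) \<longleftrightarrow>
      (g has_sum S) ({1..} \<times> {1..})"
    by (rule has_sum_reindex_bij_witness[of _ "\<lambda>(d, m). (d * m, d)" "\<lambda>(n, d). (d, n div d)"])
       (auto elim!: dvdE simp: Suc_le_eq)
  with assms show "((\<lambda>(n, d). g (d, n div d)) has_sum S) (Sigma {1..} (\<lambda>n. {d. d dvd n}))" by simp
  show "((\<lambda>d. (case (n, d) of (n, d) \<Rightarrow> g (d, n div d))) has_sum (\<Sum>d | d dvd n. g (d, n div d))) {d. d dvd n}"
    if "n \<in> {1..}" for n
    using that by (auto intro!: has_sum_finite)
qed

text \<open>Erdos's argument. If the sum converged, then the primes outside a finite set \<open>F\<close> would have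
  reciprocals of sum below \<open>1/2\<close>, so that at least half of the integers up to \<open>N\<close> would have all
  their prime factors in \<open>F\<close>. But such an integer is determined by its square part, at most
  \<open>sqrt N\<close>, and by a subset of \<open>F\<close>.\<close>

lemma prime_reciprocals_unbounded:
  "\<exists>P. finite P \<and> (\<forall>p\<in>P. prime p) \<and> (\<Sum>p\<in>P. 1 / real p) \<ge> B"
proof (rule ccontr)
  assume neg: "\<not> ?thesis"
  have bd: "sum (\<lambda>p. 1 / real p) F \<le> B" if "F \<subseteq> {p. prime p}" "finite F" for F
    using neg that by (meson Ball_Collect linorder_le_cases)
  have "(\<lambda>p. 1 / real p) summable_on {p. prime p}"
    by (rule nonneg_bounded_partial_sums_imp_summable_on[of _ _ B])
       (auto simp: eventually_finite_subsets_at_top intro!: exI[of _ "{}"] bd)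
  then have "((\<lambda>p. 1 / real p) has_sum (\<Sum>\<^sub>\<infinity>p | prime p. 1 / real p)) {p. prime p}"
    by (rule has_sum_infsum)
  then obtain F where F: "finite F" "F \<subseteq> {p. prime p}"
    and F': "\<And>Y. finite Y \<Longrightarrow> F \<subseteq> Y \<Longrightarrow> Y \<subseteq> {p. prime p} \<Longrightarrow>
        dist (\<Sum>p\<in>Y. 1 / real p) (\<Sum>\<^sub>\<infinity>p | prime p. 1 / real p) < 1 / 4"
    unfolding has_sum_def tendsto_iff eventually_finite_subsets_at_top
    by (metis zero_less_divide_1_iff zero_less_numeral)
  have tail: "(\<Sum>p\<in>Y. 1 / real p) < 1 / 2" if Y: "finite Y" "Y \<subseteq> {p. prime p}" "Y \<inter> F = {}" for Y
  proof -
    have "(\<Sum>p\<in>F \<union> Y. 1 / real p) = (\<Sum>p\<in>F. 1 / real p) + (\<Sum>p\<in>Y. 1 / real p)"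
      using Y F by (intro sum.union_disjoint) auto
    moreover have "dist (\<Sum>p\<in>F \<union> Y. 1 / real p) (\<Sum>\<^sub>\<infinity>p | prime p. 1 / real p) < 1 / 4"
      using F Y by (intro F') auto
    moreover have "dist (\<Sum>p\<in>F. 1 / real p) (\<Sum>\<^sub>\<infinity>p | prime p. 1 / real p) < 1 / 4"
      using F by (intro F') auto
    ultimately show ?thesis unfolding dist_real_def by linarith
  qed
  have count: "real N \<le> 2 * 2 ^ card F * sqrt (real N)" if "N > 0" for N :: nat
  proof -
    define Y where "Y = {p. prime p \<and> p \<le> N \<and> p \<notin> F}"
    define G where "G = {n \<in> {1..N}. prime_factors n \<subseteq> F}"
    have fY: "finite Y" unfolding Y_def by simp
    have "{1..N} \<subseteq> G \<union> (\<Union>p\<in>Y. {n \<in> {1..N}. p dvd n})"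
    proof
      fix n assume n: "n \<in> {1..N}"
      have "p \<le> N" if "p dvd n" for p using that n dvd_imp_le[of p n] by auto
      with n show "n \<in> G \<union> (\<Union>p\<in>Y. {n \<in> {1..N}. p dvd n})"
        by (auto simp: G_def Y_def in_prime_factors_iff)
    qed
    then have "card {1..N} \<le> card (G \<union> (\<Union>p\<in>Y. {n \<in> {1..N}. p dvd n}))"
      using fY by (intro card_mono) (auto simp: G_def)
    also have "\<dots> \<le> card G + card (\<Union>p\<in>Y. {n \<in> {1..N}. p dvd n})" by (rule card_Un_le)
    also have "\<dots> \<le> card G + (\<Sum>p\<in>Y. card {n \<in> {1..N}. p dvd n})"
      by (intro add_left_mono card_UN_le fY)
    finally have "real (card {1..N}) \<le> real (card G + (\<Sum>p\<in>Y. card {n \<in> {1..N}. p dvd n}))"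
      by (rule of_nat_mono)
    then have 1: "real N \<le> real (card G) + (\<Sum>p\<in>Y. real (card {n \<in> {1..N}. p dvd n}))" by simp
    have "(\<Sum>p\<in>Y. real (card {n \<in> {1..N}. p dvd n})) \<le> (\<Sum>p\<in>Y. real N * (1 / real p))"
    proof (intro sum_mono)
      fix p assume "p \<in> Y"
      then have "p > 0" by (auto simp: Y_def prime_gt_0_nat)
      then have "real (card {n \<in> {1..N}. p dvd n}) = real (N div p)"
        using card_multiples[of p N] by simp
      also have "\<dots> \<le> real N / real p" by (rule of_nat_div_le_of_nat)
      finally show "real (card {n \<in> {1..N}. p dvd n}) \<le> real N * (1 / real p)" by simp
    qed
    also have "\<dots> = real N * (\<Sum>p\<in>Y. 1 / real p)" by (simp add: sum_distrib_left)
    also have "\<dots> \<le> real N * (1 / 2)"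
    proof (rule mult_left_mono)
      have "Y \<subseteq> {p. prime p}" "Y \<inter> F = {}" by (auto simp: Y_def)
      then show "(\<Sum>p\<in>Y. 1 / real p) \<le> 1 / 2" using tail[OF fY] less_imp_le by blast
    qed simp
    finally have 2: "real N \<le> 2 * real (card G)" using 1 by simp
    have "G \<subseteq> (\<lambda>(S, m). \<Prod>S * m ^ 2) ` (Pow F \<times> {1..nat \<lfloor>sqrt (real N)\<rfloor>})"
    proof
      fix n assume n: "n \<in> G"
      then have n0: "n > 0" "n \<le> N" by (auto simp: G_def)
      define s where "s = squarefree_part n"
      define m where "m = square_part n"
      have dec: "n = s * m ^ 2" unfolding s_def m_def by (rule squarefree_decompose)
      have sf: "squarefree s" by (simp add: s_def)
      have s0: "s > 0" and m0: "m > 0" using dec n0 by (auto intro!: Nat.gr0I)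
      have "s = \<Prod>(prime_factors s)"
      proof -
        have "s = (\<Prod>p\<in>prime_factors s. p ^ multiplicity p s)"
          using prod_prime_factors[of s] s0 by simp
        also have "\<dots> = (\<Prod>p\<in>prime_factors s. p)"
        proof (intro prod.cong refl)
          fix p assume p: "p \<in> prime_factors s"
          then have "multiplicity p s > 0" using s0 by (simp add: prime_factors_multiplicity)
          moreover have "multiplicity p s \<le> 1"
            using p sf squarefree_factorial_semiring''[of s] s0 by (auto simp: prime_factors_multiplicity)
          ultimately have "multiplicity p s = 1" by simp
          then show "p ^ multiplicity p s = p" by simp
        qed
        finally show ?thesis by simp
      qed
      moreover have "prime_factors s \<subseteq> F"
        using n dec n0 dvd_prime_factors[of n s] by (auto simp: G_def)
      moreover have "m \<le> nat \<lfloor>sqrt (real N)\<rfloor>"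
      proof -
        have "m ^ 2 \<le> n" using dec s0 by (metis One_nat_def Suc_leI mult_le_mono1 nat_mult_1)
        then have "m ^ 2 \<le> N" using n0 by simp
        then have "(real m)\<^sup>2 \<le> real N" by (metis of_nat_le_iff of_nat_power)
        then show ?thesis by (simp add: le_nat_floor real_le_rsqrt)
      qed
      ultimately show "n \<in> (\<lambda>(S, m). \<Prod>S * m ^ 2) ` (Pow F \<times> {1..nat \<lfloor>sqrt (real N)\<rfloor>})"
        using dec m0 by (intro image_eqI[of _ _ "(prime_factors s, m)"]) auto
    qed
    then have "card G \<le> card ((\<lambda>(S, m). \<Prod>S * m ^ 2) ` (Pow F \<times> {1..nat \<lfloor>sqrt (real N)\<rfloor>}))"
      using F by (intro card_mono) auto
    also have "\<dots> \<le> card (Pow F \<times> {1..nat \<lfloor>sqrt (real N)\<rfloor>})"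
      using F by (intro card_image_le) auto
    also have "\<dots> = 2 ^ card F * nat \<lfloor>sqrt (real N)\<rfloor>" using F by (simp add: card_cartesian_product card_Pow)
    finally have "real (card G) \<le> real (2 ^ card F * nat \<lfloor>sqrt (real N)\<rfloor>)" by (rule of_nat_mono)
    then have "real (card G) \<le> 2 ^ card F * real (nat \<lfloor>sqrt (real N)\<rfloor>)" by simp
    also have "\<dots> \<le> 2 ^ card F * sqrt (real N)" by (intro mult_left_mono) auto
    finally show ?thesis using 2 by simp
  qed
  define C :: nat where "C = 2 * 2 ^ card F"
  have "C > 0" by (simp add: C_def)
  have "real ((2 * C) ^ 2) \<le> real C * sqrt (real ((2 * C) ^ 2))"
    using count[of "(2 * C) ^ 2"] \<open>C > 0\<close> by (simp add: C_def)
  also have "sqrt (real ((2 * C) ^ 2)) = 2 * real C" by (rule real_sqrt_unique) auto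
  finally show False using \<open>C > 0\<close> by (simp add: power2_eq_square)
qed

section \<open>Powers of a unimodular number that is not a root of unity\<close>

text \<open>The number of prime divisors from \<open>P\<close> has mean \<open>A\<close> and a variance of the same order, since
  divisibility by distinct primes is nearly independent. So most integers have about \<open>A\<close> such
  divisors.\<close>

lemma turan_kubilius:
  fixes P :: "nat set"
  assumes P: "finite P" "\<And>p. p \<in> P \<Longrightarrow> prime p"
  defines "A \<equiv> \<Sum>p\<in>P. 1 / real p"
  shows "(\<Sum>n=1..N. ((\<Sum>p\<in>P. of_bool (p dvd n)) - A)\<^sup>2) \<le> real N * A + 2 * A * real (card P)"
proof -
  let ?b = "\<lambda>p n. of_bool (p dvd n) :: real"
  have A0: "A \<ge> 0" unfolding A_def by (intro sum_nonneg) auto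
  have cnt: "(\<Sum>n=1..N. ?b d n) = real (N div d)" if "d > 0" for d
    using card_multiples[OF that, of N] by (simp add: Int_def)
  have "(\<Sum>n=1..N. (\<Sum>p\<in>P. ?b p n)\<^sup>2) = (\<Sum>n=1..N. \<Sum>p\<in>P. \<Sum>q\<in>P. ?b p n * ?b q n)"
    by (simp add: power2_eq_square sum_product)
  also have "\<dots> = (\<Sum>p\<in>P. \<Sum>q\<in>P. \<Sum>n=1..N. ?b p n * ?b q n)"
    by (subst sum.swap) (intro sum.cong refl sum.swap)
  also have "\<dots> \<le> (\<Sum>p\<in>P. \<Sum>q\<in>P. real N * (1 / real p * (1 / real q)) + (if p = q then real N / real p else 0))"
  proof (intro sum_mono)
    fix p q assume pq: "p \<in> P" "q \<in> P"
    then have pr: "prime p" "prime q" using P by auto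
    then have pos: "p > 0" "q > 0" by (auto simp: prime_gt_0_nat)
    show "(\<Sum>n=1..N. ?b p n * ?b q n) \<le> real N * (1 / real p * (1 / real q)) + (if p = q then real N / real p else 0)"
    proof (cases "p = q")
      case True
      have "(\<Sum>n=1..N. ?b p n * ?b q n) = (\<Sum>n=1..N. ?b p n)"
        unfolding True by (intro sum.cong refl) auto
      also have "\<dots> \<le> real N / real p" using cnt[OF pos(1)] of_nat_div_le_of_nat by metis
      finally show ?thesis using True by (simp add: add_increasing)
    next
      case False
      then have "coprime p q" using pr primes_coprime by blast
      then have "?b p n * ?b q n = ?b (p * q) n" for n
        by (auto simp: divides_mult dest: dvd_mult_left dvd_mult_right)
      then have "(\<Sum>n=1..N. ?b p n * ?b q n) = real (N div (p * q))"
        using cnt[of "p * q"] pos by simp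
      also have "\<dots> \<le> real N / real (p * q)" by (rule of_nat_div_le_of_nat)
      finally show ?thesis using False by simp
    qed
  qed
  also have "\<dots> = real N * A * A + real N * A"
    using P(1) by (simp add: sum.distrib A_def sum_distrib_left sum_distrib_right mult_ac)
  finally have 1: "(\<Sum>n=1..N. (\<Sum>p\<in>P. ?b p n)\<^sup>2) \<le> real N * A * A + real N * A" .
  have "real N * A - real (card P) = (\<Sum>p\<in>P. real N / real p - 1)"
    by (simp add: A_def sum_distrib_left sum_subtractf)
  also have "\<dots> \<le> (\<Sum>p\<in>P. real (N div p))"
  proof (intro sum_mono)
    fix p assume "p \<in> P"
    then have "p > 0" using P by (auto simp: prime_gt_0_nat)
    have "N = p * (N div p) + N mod p" by simp
    moreover have "N mod p < p" using \<open>p > 0\<close> by simp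
    ultimately have "N \<le> p * (N div p) + p" by linarith
    then have "real N \<le> real p * real (N div p) + real p" by (metis of_nat_add of_nat_le_iff of_nat_mult)
    then show "real N / real p - 1 \<le> real (N div p)" using \<open>p > 0\<close> by (simp add: field_simps)
  qed
  also have "\<dots> = (\<Sum>p\<in>P. \<Sum>n=1..N. ?b p n)"
    using P cnt by (intro sum.cong refl) (simp add: prime_gt_0_nat)
  also have "\<dots> = (\<Sum>n=1..N. \<Sum>p\<in>P. ?b p n)" by (rule sum.swap)
  finally have 2: "real N * A - real (card P) \<le> (\<Sum>n=1..N. \<Sum>p\<in>P. ?b p n)" .
  have "(\<Sum>n=1..N. ((\<Sum>p\<in>P. ?b p n) - A)\<^sup>2) =
      (\<Sum>n=1..N. (\<Sum>p\<in>P. ?b p n)\<^sup>2) - 2 * A * (\<Sum>n=1..N. \<Sum>p\<in>P. ?b p n) + real N * A\<^sup>2"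
    by (simp add: power2_diff sum.distrib sum_subtractf sum_distrib_left mult_ac)
  also have "\<dots> \<le> (real N * A * A + real N * A) - 2 * A * (real N * A - real (card P)) + real N * A\<^sup>2"
    using 1 2 A0 by (intro add_mono diff_mono mult_left_mono) auto
  also have "\<dots> = real N * A + 2 * A * real (card P)" by (simp add: power2_eq_square algebra_simps)
  finally show ?thesis .
qed

lemma norm_sum_le_sqrt:
  fixes f g :: "nat \<Rightarrow> complex"
  assumes "\<And>n. cmod (f n) \<le> 1"
  shows "cmod (\<Sum>n=1..N. f n * g n) \<le> sqrt (real N * (\<Sum>n=1..N. (cmod (g n))\<^sup>2))"
proof -
  have "cmod (\<Sum>n=1..N. f n * g n) \<le> (\<Sum>n=1..N. 1 * cmod (g n))"
    by (intro order.trans[OF norm_sum] sum_mono) (auto simp: norm_mult assms intro: mult_left_le_one_le)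
  also have "\<dots> \<le> sqrt ((\<Sum>n=1..N. 1\<^sup>2) * (\<Sum>n=1..N. (cmod (g n))\<^sup>2))"
    by (intro real_le_rsqrt) (rule Cauchy_Schwarz_ineq_sum)
  finally show ?thesis by simp
qed

lemma norm_geometric_sum_le:
  fixes z :: complex
  assumes "cmod z = 1" "z \<noteq> 1"
  shows "cmod (\<Sum>m=1..M. z ^ m) \<le> 2 / cmod (1 - z)"
proof -
  have "(1 - z) * (\<Sum>m=1..M. z ^ m) = z - z ^ Suc M"
  proof (induction M)
    case (Suc M)
    have "(1 - z) * (\<Sum>m=1..Suc M. z ^ m) = (1 - z) * (\<Sum>m=1..M. z ^ m) + (1 - z) * z ^ Suc M"
      by (simp add: distrib_left)
    also have "\<dots> = z - z ^ Suc (Suc M)" by (simp only: Suc.IH) (simp add: left_diff_distrib)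
    finally show ?case .
  qed simp
  then have "cmod (1 - z) * cmod (\<Sum>m=1..M. z ^ m) \<le> 2"
    using norm_triangle_ineq4[of z "z ^ Suc M"] assms(1)
    by (simp add: norm_power norm_mult del: power_Suc flip: norm_mult)
  then show ?thesis using assms(2) by (simp add: field_simps)
qed

text \<open>The argument of Daboussi and Katai. By \<open>turan_kubilius\<close> the factor \<open>A\<close> may be replaced by
  the number of primes \<open>p \<in> P\<close> dividing \<open>n\<close>. Writing \<open>n = p * m\<close> turns \<open>moebius_mu n\<close> into
  \<open>- moebius_mu m\<close>, except if \<open>p\<close> divides \<open>m\<close>, which accounts for \<open>Z\<close>. The Cauchy-Schwarz
  inequality in \<open>m\<close> then removes the Moebius function and leaves the correlations of
  \<open>l ^ (p * m)\<close> with \<open>l ^ (q * m)\<close>, which for \<open>p \<noteq> q\<close> are bounded geometric sums.\<close>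

lemma moebius_prime_weights_bound:
  fixes l :: complex
  assumes l: "cmod l = 1" "\<And>k. k > 0 \<Longrightarrow> l ^ k \<noteq> 1"
    and P: "finite P" "\<And>p. p \<in> P \<Longrightarrow> prime p"
  defines "A \<equiv> \<Sum>p\<in>P. 1 / real p"
  defines "Z \<equiv> suminf (\<lambda>n. 1 / (real n)\<^sup>2)"
  shows "\<exists>C. \<forall>N. A * cmod (\<Sum>n=1..N. of_int (moebius_mu n) * l ^ n)
           \<le> 2 * sqrt (real N * (real N * A + C)) + real N * Z"
proof -
  let ?b = "\<lambda>p n. of_bool (p dvd n) :: real"
  let ?a = "\<lambda>n. of_int (moebius_mu n) * l ^ n" and ?z = "\<lambda>p q. l ^ p * cnj (l ^ q)"
  define D where "D = (\<Sum>p\<in>P. \<Sum>q\<in>P. if p = q then 0 else 2 / cmod (1 - ?z p q))"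
  define C where "C = 2 * A * real (card P) + D"
  have A0: "A \<ge> 0" unfolding A_def by (intro sum_nonneg) auto
  have D0: "D \<ge> 0" unfolding D_def by (intro sum_nonneg) auto
  have mu2: "\<bar>real_of_int (moebius_mu n)\<bar> \<le> 1" for n using norm_moebius_mu_le_1[of n] by simp
  have lp: "cmod (l ^ n) = 1" for n using l by (simp add: norm_power)
  have main: "A * cmod (\<Sum>n=1..N. ?a n)
           \<le> 2 * sqrt (real N * (real N * A + C)) + real N * Z" for N
  proof -
    let ?R = "sqrt (real N * (real N * A + C))"
    let ?w = "\<lambda>n. \<Sum>p\<in>P. ?b p n"
    let ?S = "\<Sum>n=1..N. ?a n"
    define g where "g = (\<lambda>m. \<Sum>p\<in>P. of_bool (p * m \<le> N) * l ^ (p * m))"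
    have "cmod (\<Sum>n=1..N. ?a n * of_real (?w n - A))
        \<le> sqrt (real N * (\<Sum>n=1..N. (cmod (of_real (?w n - A)))\<^sup>2))"
      by (rule norm_sum_le_sqrt) (simp add: norm_mult lp mu2)
    also have "\<dots> \<le> ?R"
      unfolding norm_of_real power2_abs
      using turan_kubilius[OF P, of N, folded A_def] D0
      by (intro real_sqrt_le_mono mult_left_mono) (simp_all add: C_def)
    finally have 1: "cmod (\<Sum>n=1..N. ?a n * of_real (?w n - A))
        \<le> ?R" .

    have "(\<Sum>n=1..N. ?a n * of_real (?w n)) =
        (\<Sum>n=1..N. \<Sum>p\<in>P. if p dvd n then ?a n else 0)"
      by (intro sum.cong refl) (auto simp: sum_distrib_left intro!: sum.cong)
    also have "\<dots> = (\<Sum>p\<in>P. \<Sum>n=1..N. if p dvd n then ?a n else 0)"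
      by (rule sum.swap)
    also have "\<dots> = (\<Sum>p\<in>P. \<Sum>m=1..N div p. of_int (moebius_mu (p * m)) * l ^ (p * m))"
    proof (rule sum.cong[OF refl])
      fix p assume "p \<in> P"
      then have p: "p > 0" using P by (auto simp: prime_gt_0_nat)
      have "(\<Sum>n=1..N. if p dvd n then ?a n else 0) =
          (\<Sum>n | n \<in> {1..N} \<and> p dvd n. ?a n)"
        by (rule sum.inter_filter[symmetric]) simp
      also have "\<dots> = (\<Sum>m=1..N div p. of_int (moebius_mu (p * m)) * l ^ (p * m))"
        by (rule sum_multiples[OF p])
      finally show "(\<Sum>n=1..N. if p dvd n then ?a n else 0) = \<dots>" .
    qed
    also have "\<dots> = (\<Sum>p\<in>P. \<Sum>m=1..N div p. of_bool (p dvd m) * of_int (moebius_mu m) * l ^ (p * m))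
        - (\<Sum>p\<in>P. \<Sum>m=1..N div p. of_int (moebius_mu m) * l ^ (p * m))"
      (is "_ = ?E - ?G")
    proof -
      have "of_int (moebius_mu (p * m)) = (of_bool (p dvd m) * of_int (moebius_mu m) - of_int (moebius_mu m) :: complex)"
        if "p \<in> P" for p m
      proof (cases "p dvd m")
        case True
        then have "\<not> coprime p m" using P(2)[OF that]
          by (metis coprime_absorb_left not_prime_unit)
        then show ?thesis using True by (simp add: moebius_mu_mult_not_coprime)
      next
        case False
        then show ?thesis using P(2)[OF that] by (simp add: moebius_mu_prime_mult)
      qed
      then show ?thesis
        by (simp add: left_diff_distrib flip: sum_subtractf)
    qed
    finally have decomp: "(\<Sum>n=1..N. ?a n * of_real (?w n)) = ?E - ?G" .
    have "cmod ?E \<le> (\<Sum>p\<in>P. \<Sum>m=1..N div p. ?b p m)"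
      by (intro order.trans[OF norm_sum] sum_mono) (auto simp: norm_mult lp mu2)
    also have "\<dots> \<le> (\<Sum>p\<in>P. real N * (1 / (real p)\<^sup>2))"
    proof (intro sum_mono)
      fix p assume "p \<in> P"
      then have p: "p > 0" using P by (auto simp: prime_gt_0_nat)
      have "(\<Sum>m=1..N div p. ?b p m) = real (N div p div p)"
        using card_multiples[OF p, of "N div p"] by (simp add: Int_def)
      also have "\<dots> = real (N div (p * p))" by (simp add: div_mult2_eq)
      also have "\<dots> \<le> real N / real (p * p)" by (rule of_nat_div_le_of_nat)
      finally show "(\<Sum>m=1..N div p. ?b p m) \<le> real N * (1 / (real p)\<^sup>2)"
        by (simp add: power2_eq_square)
    qed
    also have "\<dots> = real N * (\<Sum>p\<in>P. 1 / (real p)\<^sup>2)" by (simp add: sum_distrib_left)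
    also have "\<dots> \<le> real N * Z"
      unfolding Z_def using inverse_power_summable[of 2, where 'a = real] P(1)
      by (intro mult_left_mono sum_le_suminf) (auto simp: inverse_eq_divide)
    finally have 2: "cmod ?E \<le> real N * Z" .

    \<comment> \<open>the range \<open>m \<le> N div p\<close> is moved into the summand, so that the sum over \<open>p\<close> can be taken first\<close>
    have "?G = (\<Sum>p\<in>P. \<Sum>m=1..N. of_int (moebius_mu m) * (of_bool (p * m \<le> N) * l ^ (p * m)))"
    proof (rule sum.cong[OF refl])
      fix p assume "p \<in> P"
      then have p: "p > 0" using P by (auto simp: prime_gt_0_nat)
      have "m \<le> N" if "p * m \<le> N" for m using that p by (metis dvd_triv_right dvd_imp_le le_trans mult_is_0 nat_0_less_mult_iff le0 not_gr_zero)
      then have "{1..N div p} = {m \<in> {1..N}. p * m \<le> N}"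
        using p by (auto simp: less_eq_div_iff_mult_less_eq mult.commute)
      then have "(\<Sum>m=1..N div p. of_int (moebius_mu m) * l ^ (p * m)) =
          (\<Sum>m\<in>{m \<in> {1..N}. p * m \<le> N}. of_int (moebius_mu m) * l ^ (p * m))" by simp
      also have "\<dots> = (\<Sum>m=1..N. if p * m \<le> N then of_int (moebius_mu m) * l ^ (p * m) else 0)"
        by (rule sum.inter_filter) simp
      also have "\<dots> = (\<Sum>m=1..N. of_int (moebius_mu m) * (of_bool (p * m \<le> N) * l ^ (p * m)))"
        by (intro sum.cong) auto
      finally show "(\<Sum>m=1..N div p. of_int (moebius_mu m) * l ^ (p * m)) = \<dots>" .
    qed
    also have "\<dots> = (\<Sum>m=1..N. of_int (moebius_mu m) * g m)"
      unfolding g_def sum_distrib_left by (rule sum.swap)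
    finally have G: "?G = (\<Sum>m=1..N. of_int (moebius_mu m) * g m)" .
    have "complex_of_real (\<Sum>m=1..N. (cmod (g m))\<^sup>2) =
        (\<Sum>m=1..N. \<Sum>p\<in>P. \<Sum>q\<in>P. of_bool (p * m \<le> N \<and> q * m \<le> N) * ?z p q ^ m)"
      unfolding of_real_sum complex_norm_square g_def
      by (intro sum.cong refl)
         (auto simp: sum_product power_mult power_mult_distrib intro!: sum.cong)
    also have "\<dots> = (\<Sum>p\<in>P. \<Sum>q\<in>P. \<Sum>m=1..N. of_bool (p * m \<le> N \<and> q * m \<le> N) * ?z p q ^ m)"
      by (subst sum.swap) (intro sum.cong refl sum.swap)
    also have "\<dots> = (\<Sum>p\<in>P. \<Sum>q\<in>P. \<Sum>m=1..min (N div p) (N div q). ?z p q ^ m)"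
    proof (rule sum.cong[OF refl], rule sum.cong[OF refl])
      fix p q assume "p \<in> P" "q \<in> P"
      then have p: "p > 0" "q > 0" using P by (auto simp: prime_gt_0_nat)
      have "m \<le> N" if "p * m \<le> N" for m using that p(1) by (metis dvd_triv_right dvd_imp_le le_trans mult_is_0 nat_0_less_mult_iff le0 not_gr_zero)
      then have "{1..min (N div p) (N div q)} = {m \<in> {1..N}. p * m \<le> N \<and> q * m \<le> N}"
        using p by (auto simp: less_eq_div_iff_mult_less_eq mult.commute)
      then have "(\<Sum>m=1..min (N div p) (N div q). ?z p q ^ m) =
          (\<Sum>m\<in>{m \<in> {1..N}. p * m \<le> N \<and> q * m \<le> N}. ?z p q ^ m)" by simp
      also have "\<dots> = (\<Sum>m=1..N. if p * m \<le> N \<and> q * m \<le> N then ?z p q ^ m else 0)"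
        by (rule sum.inter_filter) simp
      also have "\<dots> = (\<Sum>m=1..N. of_bool (p * m \<le> N \<and> q * m \<le> N) * ?z p q ^ m)"
        by (intro sum.cong) auto
      finally show "(\<Sum>m=1..N. of_bool (p * m \<le> N \<and> q * m \<le> N) * ?z p q ^ m) =
          (\<Sum>m=1..min (N div p) (N div q). ?z p q ^ m)" by simp
    qed
    finally have gsq: "complex_of_real (\<Sum>m=1..N. (cmod (g m))\<^sup>2) = \<dots>" .
    have "(\<Sum>m=1..N. (cmod (g m))\<^sup>2) = cmod (complex_of_real (\<Sum>m=1..N. (cmod (g m))\<^sup>2))"
      by (subst norm_of_real) (simp add: sum_nonneg)
    also have "\<dots> \<le> (\<Sum>p\<in>P. \<Sum>q\<in>P. (if p = q then real N / real p else 0) +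
        (if p = q then 0 else 2 / cmod (1 - ?z p q)))"
      unfolding gsq
    proof (rule order.trans[OF norm_sum], rule sum_mono, rule order.trans[OF norm_sum], rule sum_mono)
      fix p q assume pq: "p \<in> P" "q \<in> P"
      show "cmod (\<Sum>m=1..min (N div p) (N div q). ?z p q ^ m) \<le>
          (if p = q then real N / real p else 0) + (if p = q then 0 else 2 / cmod (1 - ?z p q))"
      proof (cases "p = q")
        case True
        have "l ^ q * cnj (l ^ q) = 1" using lp[of q] by (metis complex_norm_square of_real_1 one_power2)
        then show ?thesis using True by (simp add: of_nat_div_le_of_nat)
      next
        case False
        have "?z p q \<noteq> 1"
        proof
          assume eq: "?z p q = 1"
          have "l ^ q * cnj (l ^ q) = 1" using lp[of q] by (metis complex_norm_square of_real_1 one_power2)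
          with eq have "l ^ p = l ^ q" by (metis mult.commute mult.left_commute mult.right_neutral)
          moreover have "l \<noteq> 0" using l(1) by auto
          ultimately have "l ^ (max p q - min p q) = 1"
            by (cases "p \<le> q") (auto simp: power_diff max_def min_def)
          then show False using l(2)[of "max p q - min p q"] False by (simp add: max_def min_def split: if_splits)
        qed
        then show ?thesis using False norm_geometric_sum_le[of "?z p q"]
          by (simp add: norm_mult lp del: complex_cnj_power)
      qed
    qed
    also have "\<dots> = real N * A + D"
      using P(1) by (simp add: sum.distrib A_def D_def sum_distrib_left)
    also have "\<dots> \<le> real N * A + C" using A0 by (simp add: C_def)
    finally have "sqrt (real N * (\<Sum>m=1..N. (cmod (g m))\<^sup>2)) \<le> ?R"
      by (intro real_sqrt_le_mono mult_left_mono) auto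
    then have 3: "cmod ?G \<le> ?R"
      unfolding G by (intro order.trans[OF norm_sum_le_sqrt]) (use mu2 in simp)

    have "of_real A * ?S = ?E - ?G - (\<Sum>n=1..N. ?a n * of_real (?w n - A))"
      unfolding decomp[symmetric] by (simp add: sum_distrib_left sum_subtractf[symmetric] algebra_simps)
    then have "cmod (of_real A * ?S) \<le> cmod ?E + cmod ?G +
        cmod (\<Sum>n=1..N. ?a n * of_real (?w n - A))"
      by (simp only:) (rule order.trans[OF norm_triangle_ineq4 add_right_mono[OF norm_triangle_ineq4]])
    then show ?thesis using 1 2 3 A0 by (simp add: norm_mult)
  qed
  then show ?thesis by blast
qed

text \<open>Divided by \<open>A * N\<close>, the previous bound is about \<open>(2 * sqrt A + Z) / A\<close>, and \<open>A\<close> can be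
  made arbitrarily large.\<close>

lemma moebius_mean_not_root_of_unity:
  fixes l :: complex
  assumes l: "cmod l = 1" "\<And>k. k > 0 \<Longrightarrow> l ^ k \<noteq> 1"
  shows "(\<lambda>N. 1 / of_nat N * (\<Sum>n=1..N. of_int (moebius_mu n) * l ^ n)) \<longlonglongrightarrow> 0"
proof (rule LIMSEQ_I)
  fix e :: real assume e: "e > 0"
  define Z where "Z = suminf (\<lambda>n. 1 / (real n)\<^sup>2)"
  obtain P where P: "finite P" "\<And>p. p \<in> P \<Longrightarrow> prime p"
    and big: "(\<Sum>p\<in>P. 1 / real p) \<ge> max 1 (((2 + \<bar>Z\<bar>) / e + 1)\<^sup>2)"
    using prime_reciprocals_unbounded[of "max 1 (((2 + \<bar>Z\<bar>) / e + 1)\<^sup>2)"] by auto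
  define A where "A = (\<Sum>p\<in>P. 1 / real p)"
  have A1: "A \<ge> 1" using big A_def by simp
  have "sqrt A \<ge> (2 + \<bar>Z\<bar>) / e + 1" using big e A_def by (intro real_le_rsqrt) simp
  then have "sqrt A > (2 + \<bar>Z\<bar>) / e" by simp
  then have "2 + \<bar>Z\<bar> < e * sqrt A" using e by (simp add: field_simps)
  then have "(2 + \<bar>Z\<bar>) * sqrt A < e * sqrt A * sqrt A" using A1 by simp
  then have "2 * sqrt A + \<bar>Z\<bar> * sqrt A < e * A" using A1 by (simp add: algebra_simps)
  moreover have "\<bar>Z\<bar> * 1 \<le> \<bar>Z\<bar> * sqrt A" using A1 by (intro mult_left_mono) auto
  ultimately have lim: "2 * sqrt A + Z < e * A" by simp
  obtain C where C: "\<And>N. A * cmod (\<Sum>n=1..N. of_int (moebius_mu n) * l ^ n)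
           \<le> 2 * sqrt (real N * (real N * A + C)) + real N * Z"
    using moebius_prime_weights_bound[OF l P] unfolding A_def Z_def by blast
  have "(\<lambda>N. 2 * sqrt (A + C * (1 / real N)) + Z) \<longlonglongrightarrow> 2 * sqrt (A + C * 0) + Z"
    by (intro tendsto_intros lim_1_over_n)
  then have "\<forall>\<^sub>F N in sequentially. 2 * sqrt (A + C * (1 / real N)) + Z < e * A"
    using lim by (intro order_tendstoD(2)) auto
  then obtain N0 where N0: "\<And>N. N \<ge> N0 \<Longrightarrow> 2 * sqrt (A + C * (1 / real N)) + Z < e * A"
    by (auto simp: eventually_sequentially)
  show "\<exists>N0. \<forall>N\<ge>N0. cmod (1 / of_nat N * (\<Sum>n=1..N. of_int (moebius_mu n) * l ^ n) - 0) < e"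
  proof (intro exI[of _ "max N0 1"] allI impI)
    fix N assume "N \<ge> max N0 1"
    then have N: "N \<ge> N0" "real N > 0" by auto
    have "sqrt (real N * (real N * A + C)) = sqrt ((real N)\<^sup>2 * (A + C * (1 / real N)))"
      using N(2) by (simp add: power2_eq_square field_simps)
    also have "\<dots> = real N * sqrt (A + C * (1 / real N))" using N(2) by (simp add: real_sqrt_mult)
    finally have "A * cmod (\<Sum>n=1..N. of_int (moebius_mu n) * l ^ n)
        \<le> real N * (2 * sqrt (A + C * (1 / real N)) + Z)" using C[of N] by (simp add: algebra_simps)
    also have "\<dots> < real N * (e * A)" using N0[OF N(1)] N(2) by (intro mult_strict_left_mono)
    finally have "A * cmod (\<Sum>n=1..N. of_int (moebius_mu n) * l ^ n) < A * (real N * e)" by (simp add: mult_ac)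
    then have "cmod (\<Sum>n=1..N. of_int (moebius_mu n) * l ^ n) < real N * e" using A1 by simp
    then show "cmod (1 / of_nat N * (\<Sum>n=1..N. of_int (moebius_mu n) * l ^ n) - 0) < e"
      using N(2) by (simp add: norm_mult norm_divide field_simps)
  qed
qed

section \<open>A Tauberian theorem for Dirichlet series\<close>

subsection \<open>The Riemann-Lebesgue lemma and the Fejer kernel\<close>

text \<open>A shift of \<open>t\<close> by \<open>pi / v\<close> changes the sign of the oscillating factor. Hence twice the integral
  is bounded by the \<open>L\<^sup>1\<close> distance between \<open>g\<close> and its shift.\<close>

lemma riemann_lebesgue:
  fixes g :: "real \<Rightarrow> complex"
  assumes cont: "continuous_on UNIV g" and supp: "\<And>t. \<bar>t\<bar> \<ge> 1 \<Longrightarrow> g t = 0"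
  shows "((\<lambda>v. \<integral>t. g t * exp (\<i> * of_real (t * v)) \<partial>lborel) \<longlongrightarrow> 0) at_top"
proof -
  have meas [measurable]: "g \<in> borel_measurable borel"
    using cont by (rule borel_measurable_continuous_onI)
  have "bounded (g ` {-1..1})"
    by (intro compact_imp_bounded compact_continuous_image continuous_on_subset[OF cont]) auto
  then obtain B where B: "B > 0" "\<And>t. t \<in> {-1..1} \<Longrightarrow> cmod (g t) \<le> B"
    by (auto simp: bounded_pos)
  have gB: "cmod (g t) \<le> B * indicator {-1..1} t" for t
    using B(2)[of t] supp[of t] by (auto simp: indicator_def not_le abs_le_iff)
  have gB': "cmod (g t) \<le> B * indicator {-2..2} t" for t
    using order.trans[OF gB[of t]] B(1) by (auto simp: indicator_def)
  have gB'': "cmod (g (t + d)) \<le> B * indicator {-2..2} t" if "\<bar>d\<bar> \<le> 1" for t d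
  proof (cases "t \<in> {-2..2}")
    case True
    then show ?thesis using gB[of "t + d"] B(1) by (auto simp: indicator_def of_bool_def split: if_splits)
  next
    case False
    then have "g (t + d) = 0" using that by (intro supp) auto
    then show ?thesis using B(1) by simp
  qed
  have intB: "integrable lborel (\<lambda>t::real. B * indicator {-2..2} t)" by simp
  have int_e: "integrable lborel (\<lambda>t. g (t + d) * exp (\<i> * of_real (t * v)))" if "\<bar>d\<bar> \<le> 1" for v d
  proof (rule Bochner_Integration.integrable_bound[OF intB])
    show "AE t in lborel. norm (g (t + d) * exp (\<i> * of_real (t * v))) \<le> norm (B * indicator {-2..2} t)"
      using order.trans[OF gB''[OF that] abs_ge_self] by (intro AE_I2) (simp add: norm_mult)
  qed measurable
  define w where "w = (\<lambda>d. \<integral>t. cmod (g t - g (t + d)) \<partial>lborel)"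
  have bound: "cmod (\<integral>t. g t * exp (\<i> * of_real (t * v)) \<partial>lborel) \<le> w (pi / v)" if v: "v \<ge> pi" for v
  proof -
    define d where "d = pi / v"
    have v0: "v > 0" using v pi_gt_zero by linarith
    have d: "\<bar>d\<bar> \<le> 1" using v v0 by (simp add: d_def)
    let ?I = "\<integral>t. g t * exp (\<i> * of_real (t * v)) \<partial>lborel"
    have "?I = (\<integral>t. g (d + 1 * t) * exp (\<i> * of_real ((d + 1 * t) * v)) \<partial>lborel)"
      using lborel_integral_real_affine[of 1 "\<lambda>t. g t * exp (\<i> * of_real (t * v))" d] by simp
    also have "\<dots> = (\<integral>t. - (g (t + d) * exp (\<i> * of_real (t * v))) \<partial>lborel)"
    proof (intro Bochner_Integration.integral_cong refl)
      fix t
      have "\<i> * of_real ((d + 1 * t) * v) = \<i> * of_real (t * v) + \<i> * of_real pi"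
        using v0 by (simp add: d_def algebra_simps)
      then have "exp (\<i> * of_real ((d + 1 * t) * v)) = exp (\<i> * of_real (t * v)) * exp (\<i> * of_real pi)"
        by (simp only: exp_add)
      then show "g (d + 1 * t) * exp (\<i> * of_real ((d + 1 * t) * v)) = - (g (t + d) * exp (\<i> * of_real (t * v)))"
        by (simp add: exp_pi_i' add.commute)
    qed
    finally have "2 * ?I = (\<integral>t. g t * exp (\<i> * of_real (t * v)) \<partial>lborel) - (\<integral>t. g (t + d) * exp (\<i> * of_real (t * v)) \<partial>lborel)"
      by simp
    also have "\<dots> = (\<integral>t. (g t - g (t + d)) * exp (\<i> * of_real (t * v)) \<partial>lborel)"
      using int_e[of 0 v] int_e[OF d, of v] by (simp add: left_diff_distrib)
    also have "cmod \<dots> \<le> (\<integral>t. cmod ((g t - g (t + d)) * exp (\<i> * of_real (t * v))) \<partial>lborel)"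
      by (rule integral_norm_bound)
    also have "\<dots> = w d" by (simp add: w_def norm_mult)
    finally have "2 * cmod ?I \<le> w d" by (simp add: norm_mult)
    moreover have "0 \<le> cmod ?I" by simp
    ultimately show ?thesis unfolding d_def by linarith
  qed
  have "(w \<longlongrightarrow> integral\<^sup>L lborel (\<lambda>t::real. 0::real)) (at 0)"
    unfolding tendsto_at_iff_sequentially comp_def
  proof (intro allI impI)
    fix X :: "nat \<Rightarrow> real" assume X: "\<forall>i. X i \<in> UNIV - {0}" "X \<longlonglongrightarrow> 0"
    then have "\<forall>\<^sub>F i in sequentially. \<bar>X i\<bar> < 1" using tendstoD[OF X(2), of 1] by simp
    then obtain N where N: "\<And>i. i \<ge> N \<Longrightarrow> \<bar>X i\<bar> \<le> 1"
      by (auto simp: eventually_sequentially intro: less_imp_le)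
    have "(\<lambda>i. w (X (i + N))) \<longlonglongrightarrow> integral\<^sup>L lborel (\<lambda>t::real. 0::real)"
      unfolding w_def
    proof (rule integral_dominated_convergence)
      show "integrable lborel (\<lambda>t::real. 2 * (B * indicator {-2..2} t))" using intB by simp
      show "AE t in lborel. (\<lambda>i. cmod (g t - g (t + X (i + N)))) \<longlonglongrightarrow> 0"
      proof (rule AE_I2)
        fix t
        have "(\<lambda>i. t + X (i + N)) \<longlonglongrightarrow> t + 0"
          by (intro tendsto_intros LIMSEQ_ignore_initial_segment X)
        then have "(\<lambda>i. g (t + X (i + N))) \<longlonglongrightarrow> g t"
          using cont continuous_on_tendsto_compose[OF cont, of "\<lambda>i. t + X (i + N)"] by simp
        then have "(\<lambda>i. cmod (g t - g (t + X (i + N)))) \<longlonglongrightarrow> cmod (g t - g t)"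
          by (intro tendsto_intros)
        then show "(\<lambda>i. cmod (g t - g (t + X (i + N)))) \<longlonglongrightarrow> 0" by simp
      qed
      show "AE t in lborel. norm (cmod (g t - g (t + X (i + N)))) \<le> 2 * (B * indicator {-2..2} t)" for i
      proof (rule AE_I2)
        fix t
        have "cmod (g t - g (t + X (i + N))) \<le> cmod (g t) + cmod (g (t + X (i + N)))"
          by (rule norm_triangle_ineq4)
        also have "\<dots> \<le> 2 * (B * indicator {-2..2} t)" using gB'[of t] gB''[of "X (i + N)" t] N[of "i + N"] by simp
        finally show "norm (cmod (g t - g (t + X (i + N)))) \<le> 2 * (B * indicator {-2..2} t)" by simp
      qed
    qed auto
    then show "(\<lambda>i. w (X i)) \<longlonglongrightarrow> integral\<^sup>L lborel (\<lambda>t::real. 0::real)" by (rule LIMSEQ_offset)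
  qed
  then have w0: "(w \<longlongrightarrow> 0) (at 0)" by simp
  have "filterlim (\<lambda>v. pi / v) (at 0) at_top"
    unfolding filterlim_at
    by (auto intro!: real_tendsto_divide_at_top[OF tendsto_const filterlim_ident]
        eventually_mono[OF eventually_gt_at_top[of 0]])
  from filterlim_compose[OF w0 this] have "((\<lambda>v. w (pi / v)) \<longlongrightarrow> 0) at_top" .
  then show ?thesis
    by (rule Lim_null_comparison[rotated]) (rule eventually_mono[OF eventually_ge_at_top[of pi] bound])
qed

definition tent :: "real \<Rightarrow> real" where
  "tent t = max 0 (1 - \<bar>t\<bar>)"

text \<open>The Fourier transform of \<open>tent\<close>, as \<open>fourier_tent\<close> shows.\<close>

definition fejer :: "real \<Rightarrow> real" where
  "fejer y = (if y = 0 then 1 else 2 * (1 - cos y) / y\<^sup>2)"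

lemma continuous_tent: "continuous_on A tent"
  unfolding tent_def by (intro continuous_intros)

lemma tent_measurable [measurable]: "tent \<in> borel_measurable borel"
  by (rule borel_measurable_continuous_onI[OF continuous_tent])

lemma tent_nonneg: "0 \<le> tent t"
  by (simp add: tent_def)

lemma tent_eq_0: "\<bar>t\<bar> \<ge> 1 \<Longrightarrow> tent t = 0"
  by (auto simp: tent_def)

lemma integrable_tent: "integrable lborel tent"
proof (rule Bochner_Integration.integrable_bound)
  show "integrable lborel (indicat_real {-1..1::real})" by (intro integrable_real_indicator) auto
qed (auto simp: indicator_def tent_def)

text \<open>The two linear pieces of \<open>tent\<close> are integrated separately; the point \<open>0\<close>, which belongs to
  both pieces, is a null set.\<close>

lemma fourier_tent:
  assumes "y \<noteq> 0"
  shows "(\<integral>t. of_real (tent t) * exp (\<i> * of_real (t * y)) \<partial>lborel) = of_real (fejer y)"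
proof -
  define c where "c = \<i> * complex_of_real y"
  have c0: "c \<noteq> 0" using assms by (simp add: c_def)
  let ?f1 = "\<lambda>t. of_real (1 - t) * exp (of_real t * c)"
  let ?f2 = "\<lambda>t. of_real (1 + t) * exp (of_real t * c)"
  have i1: "(\<integral>t. indicator {0..1} t *\<^sub>R ?f1 t \<partial>lborel) =
      (of_real (1 - 1) / c + 1 / c\<^sup>2) * exp (of_real 1 * c) - (of_real (1 - 0) / c + 1 / c\<^sup>2) * exp (of_real 0 * c)"
  proof (rule integral_FTC_atLeastAtMost[where F = "\<lambda>t. (of_real (1 - t) / c + 1 / c\<^sup>2) * exp (of_real t * c)"])
    show "((\<lambda>t. (of_real (1 - t) / c + 1 / c\<^sup>2) * exp (of_real t * c)) has_vector_derivative ?f1 x) (at x within {0..1})"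
      for x
      using c0 by (auto intro!: derivative_eq_intros has_vector_derivative_real_field simp: field_simps power2_eq_square)
  qed (auto intro!: continuous_intros)
  have i2: "(\<integral>t. indicator {-1..0} t *\<^sub>R ?f2 t \<partial>lborel) =
      (of_real (1 + 0) / c - 1 / c\<^sup>2) * exp (of_real 0 * c) - (of_real (1 + -1) / c - 1 / c\<^sup>2) * exp (of_real (-1) * c)"
  proof (rule integral_FTC_atLeastAtMost[where F = "\<lambda>t. (of_real (1 + t) / c - 1 / c\<^sup>2) * exp (of_real t * c)"])
    show "((\<lambda>t. (of_real (1 + t) / c - 1 / c\<^sup>2) * exp (of_real t * c)) has_vector_derivative ?f2 x) (at x within {-1..0})"
      for x
      using c0 by (auto intro!: derivative_eq_intros has_vector_derivative_real_field simp: field_simps power2_eq_square)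
  qed (auto intro!: continuous_intros)
  have int1: "integrable lborel (\<lambda>t. indicator {0..1} t *\<^sub>R ?f1 t)"
    and int2: "integrable lborel (\<lambda>t. indicator {-1..0} t *\<^sub>R ?f2 t)"
    by (intro borel_integrable_compact continuous_intros compact_Icc)+
  have "(\<integral>t. of_real (tent t) * exp (\<i> * of_real (t * y)) \<partial>lborel) =
      (\<integral>t. indicator {0..1} t *\<^sub>R ?f1 t + indicator {-1..0} t *\<^sub>R ?f2 t \<partial>lborel)"
  proof (rule integral_cong_AE)
    have "AE t in lborel. t \<noteq> (0::real)" by (rule AE_lborel_singleton)
    then show "AE t in lborel. of_real (tent t) * exp (\<i> * of_real (t * y)) =
        indicator {0..1} t *\<^sub>R ?f1 t + indicator {-1..0} t *\<^sub>R ?f2 t"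
      by eventually_elim (auto simp: tent_def indicator_def c_def mult_ac)
    show "(\<lambda>t. of_real (tent t) * exp (\<i> * of_real (t * y))) \<in> borel_measurable lborel" by measurable
    show "(\<lambda>t. indicator {0..1} t *\<^sub>R ?f1 t + indicator {-1..0} t *\<^sub>R ?f2 t) \<in> borel_measurable lborel"
      using int1 int2 by (intro borel_measurable_add borel_measurable_integrable)
  qed
  also have "\<dots> = (\<integral>t. indicator {0..1} t *\<^sub>R ?f1 t \<partial>lborel) + (\<integral>t. indicator {-1..0} t *\<^sub>R ?f2 t \<partial>lborel)"
    by (rule Bochner_Integration.integral_add[OF int1 int2])
  also have "\<dots> = (exp c + exp (-c) - 2) / c\<^sup>2"
    unfolding i1 i2 using c0 by (simp add: field_simps power2_eq_square)
  also have "exp c + exp (-c) = 2 * of_real (cos y)"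
    by (simp add: c_def complex_eq_iff Re_exp Im_exp)
  also have "c\<^sup>2 = - of_real (y\<^sup>2)" by (simp add: c_def power_mult_distrib)
  also have "(2 * complex_of_real (cos y) - 2) / - of_real (y\<^sup>2) = of_real (fejer y)"
    using assms by (simp add: fejer_def field_simps)
  finally show ?thesis .
qed

lemma fejer_nonneg: "0 \<le> fejer y"
  by (auto simp: fejer_def)

lemma fejer_measurable [measurable]: "fejer \<in> borel_measurable borel"
  unfolding fejer_def by measurable

lemma fejer_le: "fejer y \<le> 8 * inverse (1 + y\<^sup>2)"
proof (cases "\<bar>y\<bar> \<le> 1")
  case True
  have "1 - cos y \<le> y\<^sup>2 / 2"
  proof -
    have "cos y = 1 - 2 * (sin (y / 2))\<^sup>2" using cos_double_sin[of "y / 2"] by simp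
    moreover have "(sin (y / 2))\<^sup>2 \<le> (y / 2)\<^sup>2" using abs_sin_x_le_abs_x[of "y / 2"] by (simp only: abs_le_square_iff)
    ultimately show ?thesis by (simp add: power_divide)
  qed
  then have "fejer y \<le> 1" by (auto simp: fejer_def field_simps)
  moreover have "y\<^sup>2 \<le> 1" using True by (simp add: abs_square_le_1)
  then have "1 \<le> 8 * inverse (1 + y\<^sup>2)" by (simp add: field_simps add_pos_nonneg)
  ultimately show ?thesis by simp
next
  case False
  then have "1\<^sup>2 < \<bar>y\<bar>\<^sup>2" by (intro power_strict_mono) auto
  then have y: "y\<^sup>2 > 1" by simp
  have "fejer y \<le> 4 / y\<^sup>2"
  proof -
    define c where "c = cos y"
    have "c \<ge> -1" by (simp add: c_def)
    then have "2 * (1 - c) \<le> 4" by simp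
    then have "2 * (1 - c) / y\<^sup>2 \<le> 4 / y\<^sup>2" by (intro divide_right_mono) auto
    moreover have "fejer y = 2 * (1 - c) / y\<^sup>2" using False by (auto simp: fejer_def c_def)
    ultimately show ?thesis by simp
  qed
  also have "4 / y\<^sup>2 = 8 * inverse (2 * y\<^sup>2)" by (simp add: field_simps)
  also have "\<dots> \<le> 8 * inverse (1 + y\<^sup>2)"
    using y by (intro mult_left_mono le_imp_inverse_le) auto
  finally show ?thesis .
qed

lemma integrable_fejer: "integrable lborel fejer"
proof (rule Bochner_Integration.integrable_bound)
  have "set_integrable lborel (einterval (-\<infinity>) \<infinity>) (\<lambda>x. inverse (1 + x\<^sup>2))"
    by (rule integrable_inverse_1_plus_square)
  then show "integrable lborel (\<lambda>y. 8 * inverse (1 + y\<^sup>2) :: real)"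
    by (simp add: set_integrable_def einterval_def)
qed (auto simp: fejer_nonneg abs_le_iff intro!: fejer_le order.trans[OF _ fejer_nonneg])

lemma integral_fejer_pos: "0 < (\<integral>y. fejer y \<partial>lborel)"
proof -
  have "(\<integral>y. fejer y \<partial>lborel) \<noteq> 0"
  proof
    assume "(\<integral>y. fejer y \<partial>lborel) = 0"
    then have "AE y in lborel. fejer y = 0"
      using integral_nonneg_eq_0_iff_AE[OF integrable_fejer] fejer_nonneg by auto
    then have "AE y in lborel. y \<notin> {1<..<2::real}"
    proof eventually_elim
      case (elim y)
      show ?case
      proof
        assume y: "y \<in> {1<..<2}"
        then have "cos y < cos 0" using pi_gt3 by (intro cos_monotone_0_pi) auto
        with y elim show False by (auto simp: fejer_def)
      qed
    qed
    then have "{1<..<2::real} \<in> null_sets lborel"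
      using AE_iff_null_sets[of "{1<..<2::real}" lborel] by simp
    then have "emeasure lborel {1<..<2::real} = 0" by (rule null_setsD1)
    then show False by simp
  qed
  moreover have "(\<integral>y. fejer y \<partial>lborel) \<ge> 0" by (intro Bochner_Integration.integral_nonneg fejer_nonneg)
  ultimately show ?thesis by simp
qed


subsection \<open>The theorem\<close>

lemma exp_halfline_integral:
  fixes w :: complex
  assumes "Re w > 0"
  shows "integrable lborel (\<lambda>u. indicator {c..} u *\<^sub>R exp (- w * of_real u))"
    and "(\<integral>u. indicator {c..} u *\<^sub>R exp (- w * of_real u) \<partial>lborel) = exp (- w * of_real c) / w"
    and "(\<integral>u. indicator {c..} u * exp (- Re w * u) \<partial>lborel) = exp (- Re w * c) / Re w"
proof -
  define r where "r = Re w"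
  have r: "r > 0" using assms by (simp add: r_def)
  have w0: "w \<noteq> 0" using assms by auto
  have lim: "((\<lambda>x. - exp (- r * x) / r) \<longlongrightarrow> 0) at_top" using r by real_asymp
  have nn: "(\<integral>\<^sup>+x. ennreal (exp (- r * x)) * indicator {c..} x \<partial>lborel) = ennreal (0 - (- exp (- r * c) / r))"
    by (rule nn_integral_FTC_atLeast[OF _ _ _ lim]) (use r in \<open>auto intro!: derivative_eq_intros\<close>)
  have nn': "(\<integral>\<^sup>+x. ennreal (indicator {c..} x * exp (- r * x)) \<partial>lborel) = ennreal (exp (- r * c) / r)"
    using nn by (simp add: ennreal_mult' ennreal_indicator mult.commute)
  have hb: "has_bochner_integral lborel (\<lambda>u. indicator {c..} u * exp (- r * u)) (exp (- r * c) / r)"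
    by (rule has_bochner_integral_nn_integral[OF _ _ _ nn']) (use r in auto)
  then show "(\<integral>u. indicator {c..} u * exp (- Re w * u) \<partial>lborel) = exp (- Re w * c) / Re w"
    by (simp add: has_bochner_integral_iff r_def)
  have intr: "integrable lborel (\<lambda>u. indicator {c..} u * exp (- r * u))"
    using hb by (simp add: has_bochner_integral_iff)
  show "integrable lborel (\<lambda>u. indicator {c..} u *\<^sub>R exp (- w * of_real u))"
    by (rule Bochner_Integration.integrable_bound[OF intr]) (auto simp: r_def indicator_def)
  have fin: "(\<integral>u. indicator {c..c + real k} u *\<^sub>R exp (- w * of_real u) \<partial>lborel) =
      - exp (- w * of_real (c + real k)) / w - - exp (- w * of_real c) / w" for k
    by (rule integral_FTC_atLeastAtMost)
       (use w0 in \<open>auto intro!: derivative_eq_intros has_vector_derivative_real_field continuous_intros\<close>)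
  have "(\<lambda>k. \<integral>u. indicator {c..c + real k} u *\<^sub>R exp (- w * of_real u) \<partial>lborel)
      \<longlonglongrightarrow> (\<integral>u. indicator {c..} u *\<^sub>R exp (- w * of_real u) \<partial>lborel)"
  proof (rule integral_dominated_convergence[OF _ _ intr])
    show "AE u in lborel. (\<lambda>k. indicator {c..c + real k} u *\<^sub>R exp (- w * of_real u))
        \<longlonglongrightarrow> indicator {c..} u *\<^sub>R exp (- w * of_real u)"
    proof (rule AE_I2)
      fix u :: real
      obtain N :: nat where "u - c \<le> real N" using real_arch_simple by blast
      then have "\<forall>\<^sub>F k in sequentially. indicator {c..c + real k} u *\<^sub>R exp (- w * of_real u) =
          indicator {c..} u *\<^sub>R exp (- w * of_real u)"
        by (intro eventually_sequentiallyI[of N]) (auto simp: indicator_def)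
      then show "(\<lambda>k. indicator {c..c + real k} u *\<^sub>R exp (- w * of_real u))
        \<longlonglongrightarrow> indicator {c..} u *\<^sub>R exp (- w * of_real u)" by (rule tendsto_eventually)
    qed
  qed (auto simp: r_def indicator_def)
  moreover have "(\<lambda>k. \<integral>u. indicator {c..c + real k} u *\<^sub>R exp (- w * of_real u) \<partial>lborel)
      \<longlonglongrightarrow> - 0 / w - - exp (- w * of_real c) / w"
    unfolding fin
  proof (intro tendsto_intros w0)
    have "(\<lambda>k. exp (- r * (c + real k))) \<longlonglongrightarrow> 0" using r by real_asymp
    then show "(\<lambda>k. exp (- w * of_real (c + real k))) \<longlonglongrightarrow> 0"
      by (subst tendsto_norm_zero_iff[symmetric]) (simp add: r_def)
  qed
  ultimately have "(\<integral>u. indicator {c..} u *\<^sub>R exp (- w * of_real u) \<partial>lborel) = - 0 / w - - exp (- w * of_real c) / w"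
    by (rule LIMSEQ_unique)
  then show "(\<integral>u. indicator {c..} u *\<^sub>R exp (- w * of_real u) \<partial>lborel) = exp (- w * of_real c) / w" by simp
qed

definition summatory :: "(nat \<Rightarrow> complex) \<Rightarrow> real \<Rightarrow> complex" where
  "summatory a x = (\<Sum>n=1..nat \<lfloor>x\<rfloor>. a n)"

text \<open>The mean of \<open>a\<close> over the integers up to \<open>x = exp u\<close>. On this logarithmic scale the Dirichlet
  series of \<open>a\<close> becomes a Laplace transform, and dilations of \<open>x\<close> become translations.\<close>

definition scaled_mean :: "(nat \<Rightarrow> complex) \<Rightarrow> real \<Rightarrow> complex" where
  "scaled_mean a u = of_real (exp (- u)) * summatory a (exp u)"

lemma scaled_mean_measurable [measurable]: "scaled_mean a \<in> borel_measurable borel"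
proof -
  have "(\<lambda>u. (\<lambda>k::nat. \<Sum>n=1..k. a n) (nat \<lfloor>exp u\<rfloor>)) \<in> borel_measurable (borel :: real measure)"
    by measurable
  then show ?thesis unfolding scaled_mean_def summatory_def by measurable
qed

lemma scaled_mean_neg: "u < 0 \<Longrightarrow> scaled_mean a u = 0"
proof -
  assume "u < 0"
  then have "exp u < 1" by simp
  then have "\<lfloor>exp u\<rfloor> < 1" by linarith
  then show ?thesis by (simp add: scaled_mean_def summatory_def)
qed

context
  fixes a :: "nat \<Rightarrow> complex"
  assumes a: "\<And>n. cmod (a n) \<le> 1"
begin

lemma norm_summatory_le: "x \<ge> 0 \<Longrightarrow> cmod (summatory a x) \<le> x"
proof -
  assume x: "x \<ge> 0"
  have "cmod (summatory a x) \<le> (\<Sum>n=1..nat \<lfloor>x\<rfloor>. 1)"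
    unfolding summatory_def by (intro order.trans[OF norm_sum] sum_mono a)
  also have "\<dots> \<le> x" using x by simp
  finally show ?thesis .
qed

lemma norm_summatory_diff: 
  assumes "x \<ge> 0" "y \<ge> 0"
  shows "cmod (summatory a x - summatory a y) \<le> \<bar>x - y\<bar> + 1"
proof -
  have *: "cmod (summatory a x - summatory a y) \<le> x - y + 1" if "y \<le> x" "y \<ge> 0" for x y
  proof -
    have le: "nat \<lfloor>y\<rfloor> \<le> nat \<lfloor>x\<rfloor>" using that by (intro nat_mono floor_mono)
    have "{1..nat \<lfloor>x\<rfloor>} = {1..nat \<lfloor>y\<rfloor>} \<union> {nat \<lfloor>y\<rfloor> + 1..nat \<lfloor>x\<rfloor>}" using le by auto
    then have "summatory a x = summatory a y + (\<Sum>n=nat \<lfloor>y\<rfloor> + 1..nat \<lfloor>x\<rfloor>. a n)"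
      unfolding summatory_def by (simp add: sum.union_disjoint)
    then have "summatory a x - summatory a y = (\<Sum>n=nat \<lfloor>y\<rfloor> + 1..nat \<lfloor>x\<rfloor>. a n)" by simp
    also have "cmod \<dots> \<le> (\<Sum>n=nat \<lfloor>y\<rfloor> + 1..nat \<lfloor>x\<rfloor>. 1)"
      by (intro order.trans[OF norm_sum] sum_mono a)
    also have "\<dots> = real (nat \<lfloor>x\<rfloor>) - real (nat \<lfloor>y\<rfloor>)" using le by (simp add: of_nat_diff)
    also have "\<dots> \<le> x - y + 1" using that by linarith
    finally show ?thesis .
  qed
  show ?thesis using *[of y x] *[of x y] assms by (cases "y \<le> x") (auto simp: norm_minus_commute)
qed

lemma norm_scaled_mean_le: "cmod (scaled_mean a u) \<le> 1"
proof -
  have "cmod (scaled_mean a u) \<le> exp (- u) * exp u"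
    unfolding scaled_mean_def using norm_summatory_le[of "exp u"] by (simp add: norm_mult)
  then show ?thesis by (simp add: exp_minus)
qed

text \<open>A translation by \<open>x\<close> changes the cutoff by the factor \<open>exp (- x)\<close>. The term \<open>exp (- v)\<close> is the
  rounding error in counting the integers between the two cutoffs.\<close>

lemma scaled_mean_slow:
  "cmod (scaled_mean a (v - x) - scaled_mean a v) \<le> min 2 (2 * \<bar>1 - exp (- x)\<bar>) + exp (- v)"
proof -
  have "scaled_mean a v - scaled_mean a (v - x) =
      of_real (exp (- v)) * (summatory a (exp v) - summatory a (exp (v - x))) +
      of_real (exp (- v) - exp (- (v - x))) * summatory a (exp (v - x))"
    by (simp add: scaled_mean_def algebra_simps)
  then have "cmod (scaled_mean a v - scaled_mean a (v - x)) \<le>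
      cmod (of_real (exp (- v)) * (summatory a (exp v) - summatory a (exp (v - x)))) +
      cmod (of_real (exp (- v) - exp (- (v - x))) * summatory a (exp (v - x)))"
    by (simp only: norm_triangle_ineq)
  also have "\<dots> = exp (- v) * cmod (summatory a (exp v) - summatory a (exp (v - x))) +
      \<bar>exp (- v) - exp (- (v - x))\<bar> * cmod (summatory a (exp (v - x)))"
    by (simp add: norm_mult del: of_real_diff)
  also have "\<dots> \<le> exp (- v) * (\<bar>exp v - exp (v - x)\<bar> + 1) + \<bar>exp (- v) - exp (- (v - x))\<bar> * exp (v - x)"
    by (intro add_mono mult_left_mono norm_summatory_diff norm_summatory_le) auto
  also have "\<dots> = exp (- v) * \<bar>exp v - exp (v - x)\<bar> + exp (- v) + \<bar>exp (- v) - exp (- (v - x))\<bar> * exp (v - x)"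
    by (simp add: algebra_simps)
  also have "exp (- v) * \<bar>exp v - exp (v - x)\<bar> = \<bar>exp (- v) * (exp v - exp (v - x))\<bar>" by (simp add: abs_mult)
  also have "exp (- v) * (exp v - exp (v - x)) = 1 - exp (- x)"
    by (simp add: right_diff_distrib exp_add[symmetric])
  also have "\<bar>exp (- v) - exp (- (v - x))\<bar> * exp (v - x) = \<bar>(exp (- v) - exp (- (v - x))) * exp (v - x)\<bar>"
    by (simp add: abs_mult)
  also have "(exp (- v) - exp (- (v - x))) * exp (v - x) = - (1 - exp (- x))"
    by (simp add: left_diff_distrib exp_add[symmetric])
  finally have "cmod (scaled_mean a v - scaled_mean a (v - x)) \<le> 2 * \<bar>1 - exp (- x)\<bar> + exp (- v)"
    using abs_minus_commute[of "exp (- x)" 1] by simp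
  moreover have "cmod (scaled_mean a v - scaled_mean a (v - x)) \<le> 2 + exp (- v)"
    using norm_triangle_ineq4[of "scaled_mean a v" "scaled_mean a (v - x)"]
      norm_scaled_mean_le[of v] norm_scaled_mean_le[of "v - x"] exp_gt_zero[of "- v"] by linarith
  ultimately show ?thesis by (simp add: norm_minus_commute min_def)
qed

text \<open>The coefficient \<open>a n\<close> enters the mean at \<open>u = ln n\<close> and contributes from there on the integral of
  an exponential function.\<close>

lemma laplace_scaled_mean:
  assumes z: "Re z > 0" and S: "(\<lambda>n. a n * of_nat n powr - (1 + z)) sums S"
  shows "(\<integral>u. scaled_mean a u * exp (- z * of_real u) \<partial>lborel) = S / (1 + z)"
proof -
  define f where "f = (\<lambda>n u. (if n = 0 then 0 else a n) * (indicator {ln (real n)..} u *\<^sub>R exp (- (1 + z) * of_real u)))"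
  have z1: "Re (1 + z) > 0" using z by simp
  have int: "integrable lborel (f n)" for n
    unfolding f_def by (intro integrable_mult_right exp_halfline_integral z1)
  have fint: "(\<integral>u. f n u \<partial>lborel) = a n * of_nat n powr - (1 + z) / (1 + z)" for n
  proof (cases "n = 0")
    case False
    then have "(\<integral>u. f n u \<partial>lborel) = (\<integral>u. a n * (indicator {ln (real n)..} u *\<^sub>R exp (- (1 + z) * of_real u)) \<partial>lborel)"
      by (simp only: f_def if_False)
    also have "\<dots> = a n * (\<integral>u. indicator {ln (real n)..} u *\<^sub>R exp (- (1 + z) * of_real u) \<partial>lborel)"
      by (rule integral_mult_right_zero)
    finally have "(\<integral>u. f n u \<partial>lborel) = a n * (exp (- (1 + z) * of_real (ln (real n))) / (1 + z))"
      by (simp only: exp_halfline_integral(2)[OF z1])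
    then show ?thesis using False by (simp add: powr_def Ln_of_nat mult.commute)
  qed (simp add: f_def)
  have finite_terms: "f n u = 0" if "n \<notin> {1..nat \<lfloor>exp u\<rfloor>}" for n u
  proof (cases "n = 0")
    case False
    then have "real n > exp u" using that by (auto simp: not_le) linarith
    then have "u < ln (real n)" using False by (metis exp_gt_zero exp_less_cancel_iff exp_ln order_less_trans)
    then show ?thesis by (simp add: f_def)
  qed (simp add: f_def)
  have fsum: "(\<lambda>n. f n u) sums (scaled_mean a u * exp (- z * of_real u))" for u
  proof -
    have "(\<lambda>n. f n u) sums (\<Sum>n\<in>{1..nat \<lfloor>exp u\<rfloor>}. f n u)"
      by (rule sums_finite) (auto intro: finite_terms)
    also have "(\<Sum>n\<in>{1..nat \<lfloor>exp u\<rfloor>}. f n u) = (\<Sum>n\<in>{1..nat \<lfloor>exp u\<rfloor>}. a n * exp (- (1 + z) * of_real u))"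
    proof (rule sum.cong[OF refl])
      fix n assume "n \<in> {1..nat \<lfloor>exp u\<rfloor>}"
      then have n: "n > 0" "real n \<le> exp u" by (auto simp: le_nat_iff le_floor_iff)
      then have "ln (real n) \<le> u" by (metis exp_gt_zero ln_exp ln_le_cancel_iff of_nat_0_less_iff)
      then show "f n u = a n * exp (- (1 + z) * of_real u)" using n by (simp add: f_def)
    qed
    also have "\<dots> = scaled_mean a u * exp (- z * of_real u)"
    proof -
      have "exp (- (1 + z) * of_real u) = of_real (exp (- u)) * exp (- z * of_real u)"
        by (simp add: exp_of_real[symmetric] exp_add[symmetric] algebra_simps)
      then show ?thesis by (simp add: scaled_mean_def summatory_def sum_distrib_left sum_distrib_right mult_ac)
    qed
    finally show ?thesis .
  qed
  have nrm: "(\<integral>u. cmod (f n u) \<partial>lborel) \<le> real n powr - (1 + Re z) / (1 + Re z)" for n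
  proof (cases "n = 0")
    case False
    have "(\<integral>u. cmod (f n u) \<partial>lborel) = (\<integral>u. cmod (a n) * (indicator {ln (real n)..} u * exp (- Re (1 + z) * u)) \<partial>lborel)"
      using False by (intro Bochner_Integration.integral_cong refl) (auto simp: f_def norm_mult indicator_def)
    also have "\<dots> = cmod (a n) * (exp (- Re (1 + z) * ln (real n)) / Re (1 + z))"
      using exp_halfline_integral(3)[OF z1, of "ln (real n)"] by simp
    also have "\<dots> \<le> 1 * (exp (- Re (1 + z) * ln (real n)) / Re (1 + z))"
      using z by (intro mult_right_mono a) auto
    also have "\<dots> = real n powr - (1 + Re z) / (1 + Re z)" using False by (simp add: powr_def mult.commute)
    finally show ?thesis .
  qed (simp add: f_def)
  have "(\<lambda>n. \<integral>u. f n u \<partial>lborel) sums (\<integral>u. suminf (\<lambda>n. f n u) \<partial>lborel)"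
  proof (rule sums_integral[OF int])
    show "AE u in lborel. summable (\<lambda>n. norm (f n u))"
    proof (rule AE_I2)
      fix u
      show "summable (\<lambda>n. norm (f n u))"
        by (rule summable_finite[of "{1..nat \<lfloor>exp u\<rfloor>}"]) (simp_all add: finite_terms)
    qed
    show "summable (\<lambda>n. \<integral>u. norm (f n u) \<partial>lborel)"
    proof (rule summable_comparison_test')
      show "summable (\<lambda>n. real n powr - (1 + Re z) / (1 + Re z))"
        using z by (intro summable_divide) (simp add: summable_real_powr_iff)
      show "norm (\<integral>u. norm (f n u) \<partial>lborel) \<le> real n powr - (1 + Re z) / (1 + Re z)" if "n \<ge> 0" for n
        using nrm[of n] by (simp add: abs_of_nonneg)
    qed
  qed
  also have "(\<lambda>u. suminf (\<lambda>n. f n u)) = (\<lambda>u. scaled_mean a u * exp (- z * of_real u))"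
    using fsum by (simp add: sums_iff)
  finally have "(\<lambda>n. a n * of_nat n powr - (1 + z) / (1 + z)) sums (\<integral>u. scaled_mean a u * exp (- z * of_real u) \<partial>lborel)"
    unfolding fint .
  moreover have "(\<lambda>n. a n * of_nat n powr - (1 + z) / (1 + z)) sums (S / (1 + z))"
    by (intro sums_divide S)
  ultimately show ?thesis by (rule sums_unique2)
qed


text \<open>With \<open>e + \<i> * t * T\<close> instead of \<open>\<i> * t * T\<close> the identity is an exchange of the integrations over
  \<open>u\<close> and \<open>t\<close>. Both sides are continuous as \<open>e\<close> decreases to \<open>0\<close>: the left one because the mean
  is bounded and vanishes for \<open>u < 0\<close>, the right one because only a compact part of the line
  \<open>Re s = 1\<close> matters.\<close>

lemma fejer_smoothing:
  assumes T: "T > 0"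
    and F: "continuous_on {s. Re s \<ge> 1} F"
    and sums: "\<And>s. Re s > 1 \<Longrightarrow> (\<lambda>n. a n * of_nat n powr - s) sums F s"
  shows "(\<integral>u. scaled_mean a u * of_real (fejer (T * (v - u))) \<partial>lborel) =
      (\<integral>t. of_real (tent t) * (F (1 + \<i> * of_real (t * T)) / (1 + \<i> * of_real (t * T))) *
        exp (\<i> * of_real (t * (T * v))) \<partial>lborel)"
proof -
  let ?m = "scaled_mean a" and ?K = "\<lambda>u. complex_of_real (fejer (T * (v - u)))"
    and ?E = "\<lambda>t. exp (\<i> * complex_of_real (t * (T * v)))"
    and ?s = "\<lambda>x t. complex_of_real x + \<i> * complex_of_real (t * T)"
  define H where "H = (\<lambda>z. F (1 + z) / (1 + z))"
  have Hc: "continuous_on {z. Re z \<ge> 0} H"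
    unfolding H_def
    by (intro continuous_intros continuous_on_compose2[OF F]) (auto simp: complex_eq_iff)
  define e where "e = (\<lambda>k. inverse (real (Suc k)))"
  have e: "e k > 0" "e k \<le> 1" for k by (auto simp: e_def field_simps)
  have e0: "e \<longlonglongrightarrow> 0" unfolding e_def by (rule LIMSEQ_inverse_real_of_nat)
  have fT: "integrable lborel (\<lambda>u. fejer (T * (v - u)))"
    using lborel_integrable_real_affine[OF integrable_fejer, of "- T" "T * v"] T by (simp add: algebra_simps)
  have step: "(\<integral>u. ?m u * of_real (exp (- e k * u)) * ?K u \<partial>lborel) =
      (\<integral>t. of_real (tent t) * H (?s (e k) t) * ?E t \<partial>lborel)" for k
  proof -
    let ?h = "\<lambda>u. ?m u * of_real (exp (- e k * u))"
    have hint: "integrable lborel ?h"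
    proof (rule Bochner_Integration.integrable_bound)
      show "integrable lborel (\<lambda>u. indicator {0..} u *\<^sub>R exp (- of_real (e k) * of_real u :: complex))"
        by (rule exp_halfline_integral) (simp add: e)
      show "AE u in lborel. norm (?h u) \<le> norm (indicator {0..} u *\<^sub>R exp (- of_real (e k) * of_real u :: complex))"
        using norm_scaled_mean_le scaled_mean_neg[of _ a]
        by (intro AE_I2) (auto simp: norm_mult indicator_def intro!: mult_left_le_one_le)
    qed measurable
    define f where "f = (\<lambda>(t, u). of_real (tent t) * ?h u * exp (\<i> * of_real (t * (T * (v - u)))))"
    have fm: "f \<in> borel_measurable (lborel \<Otimes>\<^sub>M lborel)" unfolding f_def by measurable
    have fn: "cmod (f (t, u)) = tent t * cmod (?h u)" for t u
      by (simp add: f_def norm_mult tent_nonneg)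
    have fi: "integrable (lborel \<Otimes>\<^sub>M lborel) f"
    proof (rule lborel_pair.Fubini_integrable[OF fm])
      show "integrable lborel (\<lambda>t. \<integral>u. norm (f (t, u)) \<partial>lborel)"
        unfolding fn using integrable_tent by simp
      show "AE t in lborel. integrable lborel (\<lambda>u. f (t, u))"
      proof (rule AE_I2)
        fix t
        have "integrable lborel (\<lambda>u. tent t * cmod (?h u))" using hint by (intro integrable_mult_right integrable_norm)
        then show "integrable lborel (\<lambda>u. f (t, u))"
          by (rule Bochner_Integration.integrable_bound) (auto simp: fn tent_nonneg, simp add: f_def)
      qed
    qed
    have "(\<integral>u. ?h u * ?K u \<partial>lborel) = (\<integral>u. \<integral>t. f (t, u) \<partial>lborel \<partial>lborel)"
    proof (rule integral_cong_AE)
      show "(\<lambda>u. \<integral>t. f (t, u) \<partial>lborel) \<in> borel_measurable lborel"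
        using lborel_pair.integrable_snd[of "\<lambda>t u. f (t, u)"] fi by (intro borel_measurable_integrable) simp
      have "AE u in lborel. u \<noteq> v" by (rule AE_lborel_singleton)
      then show "AE u in lborel. ?h u * ?K u = (\<integral>t. f (t, u) \<partial>lborel)"
      proof eventually_elim
        case (elim u)
        have "(\<integral>t. f (t, u) \<partial>lborel) = (\<integral>t. ?h u * (of_real (tent t) * exp (\<i> * of_real (t * (T * (v - u))))) \<partial>lborel)"
          by (simp add: f_def mult_ac)
        also have "\<dots> = ?h u * ?K u"
          using elim T by (subst integral_mult_right_zero, subst fourier_tent) auto
        finally show ?case ..
      qed
    qed measurable
    also have "\<dots> = (\<integral>t. \<integral>u. f (t, u) \<partial>lborel \<partial>lborel)"
      by (rule lborel_pair.Fubini_integral[of "\<lambda>t u. f (t, u)"]) (use fi in simp)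
    also have "\<dots> = (\<integral>t. of_real (tent t) * H (?s (e k) t) * ?E t \<partial>lborel)"
    proof (rule Bochner_Integration.integral_cong[OF refl])
      fix t
      let ?z = "?s (e k) t"
      have "(\<integral>u. f (t, u) \<partial>lborel) =
          (\<integral>u. (of_real (tent t) * ?E t) * (?m u * exp (- ?z * of_real u)) \<partial>lborel)"
      proof (rule Bochner_Integration.integral_cong[OF refl])
        fix u
        have eq: "of_real (exp (- e k * u)) * exp (\<i> * of_real (t * (T * (v - u)))) =
            ?E t * exp (- ?z * of_real u)"
          by (simp add: exp_of_real[symmetric] exp_add[symmetric] algebra_simps)
        have "f (t, u) = of_real (tent t) * (?m u *
            (of_real (exp (- e k * u)) * exp (\<i> * of_real (t * (T * (v - u))))))"
          by (simp only: f_def prod.case mult.assoc)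
        also have "\<dots> = (of_real (tent t) * ?E t) * (?m u * exp (- ?z * of_real u))"
          unfolding eq by (simp only: mult_ac)
        finally show "f (t, u) = \<dots>" .
      qed
      also have "\<dots> = (of_real (tent t) * ?E t) * (F (1 + ?z) / (1 + ?z))"
        unfolding integral_mult_right_zero
        by (subst laplace_scaled_mean[OF _ sums]) (auto simp: e)
      finally show "(\<integral>u. f (t, u) \<partial>lborel) = of_real (tent t) * H ?z * ?E t"
        by (simp add: H_def mult_ac)
    qed
    finally show ?thesis .
  qed
  have lhs: "(\<lambda>k. \<integral>u. ?m u * of_real (exp (- e k * u)) * ?K u \<partial>lborel)
      \<longlonglongrightarrow> (\<integral>u. ?m u * ?K u \<partial>lborel)"
  proof (rule integral_dominated_convergence[OF _ _ fT])
    show "AE u in lborel. (\<lambda>k. ?m u * of_real (exp (- e k * u)) * ?K u)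
        \<longlonglongrightarrow> ?m u * ?K u"
    proof (rule AE_I2)
      fix u
      have "(\<lambda>k. ?m u * of_real (exp (- e k * u)) * ?K u)
        \<longlonglongrightarrow> ?m u * of_real (exp (- 0 * u)) * ?K u"
        by (intro tendsto_intros e0)
      then show "(\<lambda>k. ?m u * of_real (exp (- e k * u)) * ?K u)
        \<longlonglongrightarrow> ?m u * ?K u" by simp
    qed
    show "AE u in lborel. norm (?m u * of_real (exp (- e k * u)) * ?K u)
        \<le> fejer (T * (v - u))" for k
    proof (rule AE_I2)
      fix u
      have "cmod (?m u) * exp (- e k * u) \<le> 1"
      proof (cases "u < 0")
        case False
        then have "exp (- e k * u) \<le> 1" using e[of k] by simp
        then show ?thesis using norm_scaled_mean_le[of u] by (simp add: mult_le_one)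
      qed (simp add: scaled_mean_neg)
      then have "cmod (?m u) * exp (- e k * u) * fejer (T * (v - u)) \<le> 1 * fejer (T * (v - u))"
        by (intro mult_right_mono fejer_nonneg)
      then show "norm (?m u * of_real (exp (- e k * u)) * ?K u)
        \<le> fejer (T * (v - u))" by (simp add: norm_mult fejer_nonneg)
    qed
  qed measurable
  have cpt: "compact {z. 0 \<le> Re z \<and> Re z \<le> 1 \<and> \<bar>Im z\<bar> \<le> T}"
  proof -
    have "{z. 0 \<le> Re z \<and> Re z \<le> 1 \<and> \<bar>Im z\<bar> \<le> T} = cbox (Complex 0 (- T)) (Complex 1 T)"
      by (auto simp: in_cbox_complex_iff)
    then show ?thesis by (simp only: compact_cbox)
  qed
  have "bounded (H ` {z. 0 \<le> Re z \<and> Re z \<le> 1 \<and> \<bar>Im z\<bar> \<le> T})"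
    by (intro compact_imp_bounded compact_continuous_image cpt continuous_on_subset[OF Hc]) auto
  then obtain B where B: "B > 0" "\<And>z. 0 \<le> Re z \<Longrightarrow> Re z \<le> 1 \<Longrightarrow> \<bar>Im z\<bar> \<le> T \<Longrightarrow> cmod (H z) \<le> B"
    unfolding bounded_pos by auto
  have gmeas: "(\<lambda>t. of_real (tent t) * H (?s c t) * ?E t) \<in> borel_measurable lborel"
    if "c \<ge> 0" for c
  proof -
    have "continuous_on UNIV (\<lambda>t. of_real (tent t) * H (?s c t) * ?E t)"
      using that by (intro continuous_intros continuous_tent continuous_on_compose2[OF Hc]) auto
    then show ?thesis using borel_measurable_continuous_onI by simp
  qed
  have rhs: "(\<lambda>k. \<integral>t. of_real (tent t) * H (?s (e k) t) * ?E t \<partial>lborel)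
      \<longlonglongrightarrow> (\<integral>t. of_real (tent t) * H (?s 0 t) * ?E t \<partial>lborel)"
  proof (rule integral_dominated_convergence)
    show "integrable lborel (\<lambda>t. tent t * B)" using integrable_tent by simp
    show "AE t in lborel. (\<lambda>k. of_real (tent t) * H (?s (e k) t) * ?E t)
      \<longlonglongrightarrow> of_real (tent t) * H (?s 0 t) * ?E t"
    proof (intro AE_I2 tendsto_intros)
      fix t
      have "(\<lambda>k. ?s (e k) t) \<longlonglongrightarrow> ?s 0 t"
        by (intro tendsto_intros e0)
      then show "(\<lambda>k. H (?s (e k) t)) \<longlonglongrightarrow> H (?s 0 t)"
        by (rule continuous_on_tendsto_compose[OF Hc]) (use e in \<open>auto intro!: always_eventually less_imp_le\<close>)
    qed
    show "AE t in lborel. norm (of_real (tent t) * H (?s (e k) t) * ?E t) \<le> tent t * B" for k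
    proof (rule AE_I2)
      fix t
      show "norm (of_real (tent t) * H (?s (e k) t) * ?E t) \<le> tent t * B"
      proof (cases "\<bar>t\<bar> \<ge> 1")
        case False
        then have "\<bar>t * T\<bar> \<le> T" using T by (simp add: abs_mult)
        then have "cmod (H (?s (e k) t)) \<le> B"
          using e[of k] by (intro B(2)) auto
        then show ?thesis by (simp add: norm_mult tent_nonneg mult_left_mono)
      qed (simp add: tent_eq_0)
    qed
  qed (intro gmeas; simp add: e less_imp_le)+
  show ?thesis using LIMSEQ_unique[OF lhs[unfolded step] rhs] by (simp add: H_def)
qed

text \<open>A bounded sequence whose Dirichlet series extends continuously to the line \<open>Re s = 1\<close> has
  mean zero. The normalized summatory function \<open>h u = exp (- u) * M (exp u)\<close> has the Laplace
  transform \<open>F (1 + z) / (1 + z)\<close>; convolving \<open>h\<close> with a Fejer kernel truncates this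
  transform to a compact part of the boundary line, so the convolution vanishes at infinity by the
  Riemann-Lebesgue lemma; and \<open>h\<close> oscillates too slowly to differ much from the convolution
  with a narrow kernel.\<close>

theorem mean_zero_of_continuous_dirichlet_series:
  assumes F: "continuous_on {s. Re s \<ge> 1} F"
    and sums: "\<And>s. Re s > 1 \<Longrightarrow> (\<lambda>n. a n * of_nat n powr - s) sums F s"
  shows "(\<lambda>N. 1 / of_nat N * (\<Sum>n=1..N. a n)) \<longlonglongrightarrow> 0"
proof -
  define K where "K = (\<integral>y. fejer y \<partial>lborel)"
  have K: "K > 0" unfolding K_def by (rule integral_fejer_pos)
  define J where "J = (\<lambda>T v. \<integral>u. scaled_mean a u * of_real (fejer (T * (v - u))) \<partial>lborel)"
  define w where "w = (\<lambda>x::real. min 2 (2 * \<bar>1 - exp (- x)\<bar>))"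
  have wm [measurable]: "w \<in> borel_measurable borel" unfolding w_def by measurable
  have w0: "0 \<le> w x" "w x \<le> 2" for x by (auto simp: w_def)
  have J0: "((\<lambda>v. J T v) \<longlongrightarrow> 0) at_top" if T: "T > 0" for T
  proof -
    let ?g = "\<lambda>t. of_real (tent t) * (F (1 + \<i> * of_real (t * T)) / (1 + \<i> * of_real (t * T)))"
    have "continuous_on UNIV ?g"
      by (intro continuous_intros continuous_tent continuous_on_compose2[OF F]) (auto simp: complex_eq_iff)
    then have "((\<lambda>v. \<integral>t. ?g t * exp (\<i> * of_real (t * v)) \<partial>lborel) \<longlongrightarrow> 0) at_top"
      by (rule riemann_lebesgue) (simp add: tent_eq_0)
    moreover have "filterlim (\<lambda>v. T * v) at_top at_top"
      using T by (intro filterlim_tendsto_pos_mult_at_top[OF tendsto_const _ filterlim_ident])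
    ultimately have "((\<lambda>v. \<integral>t. ?g t * exp (\<i> * of_real (t * (T * v))) \<partial>lborel) \<longlongrightarrow> 0) at_top"
      by (rule filterlim_compose)
    moreover have "J T v = (\<integral>t. ?g t * exp (\<i> * of_real (t * (T * v))) \<partial>lborel)" for v
      unfolding J_def by (rule fejer_smoothing[OF T F sums])
    ultimately show ?thesis by simp
  qed
  have scale: "of_real T * J T v = (\<integral>y. scaled_mean a (v - y / T) * of_real (fejer y) \<partial>lborel)" if T: "T > 0" for T v
  proof -
    have "J T v = \<bar>- 1 / T\<bar> *\<^sub>R (\<integral>y. scaled_mean a (v + (- 1 / T) * y) * of_real (fejer (T * (v - (v + (- 1 / T) * y)))) \<partial>lborel)"
      unfolding J_def by (rule lborel_integral_real_affine) (use T in simp)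
    also have "(\<integral>y. scaled_mean a (v + (- 1 / T) * y) * of_real (fejer (T * (v - (v + (- 1 / T) * y)))) \<partial>lborel) =
        (\<integral>y. scaled_mean a (v - y / T) * of_real (fejer y) \<partial>lborel)"
      using T by (intro Bochner_Integration.integral_cong refl) (simp add: field_simps)
    finally show ?thesis using T by (simp add: scaleR_conv_of_real)
  qed
  have bound: "K * cmod (scaled_mean a v) \<le> T * cmod (J T v) + (\<integral>y. w (y / T) * fejer y \<partial>lborel) + exp (- v) * K"
    if T: "T > 0" for T v
  proof -
    have i1: "integrable lborel (\<lambda>y. scaled_mean a (v - y / T) * of_real (fejer y))"
      by (rule Bochner_Integration.integrable_bound[OF integrable_fejer])
         (auto simp: norm_mult fejer_nonneg abs_of_nonneg intro!: mult_left_le_one_le norm_scaled_mean_le)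
    have i2: "integrable lborel (\<lambda>y. scaled_mean a v * of_real (fejer y))"
      using integrable_fejer by simp
    have i3: "integrable lborel (\<lambda>y. w (y / T) * fejer y)"
      by (rule Bochner_Integration.integrable_bound[of _ "\<lambda>y. 2 * fejer y"])
         (auto simp: integrable_fejer fejer_nonneg w0 abs_mult intro!: mult_right_mono)
    have "scaled_mean a v * of_real K = (\<integral>y. scaled_mean a v * of_real (fejer y) \<partial>lborel)"
      by (simp add: K_def)
    then have "scaled_mean a v * of_real K = of_real T * J T v -
        (\<integral>y. (scaled_mean a (v - y / T) - scaled_mean a v) * of_real (fejer y) \<partial>lborel)"
      using i1 i2 by (simp add: scale[OF T] left_diff_distrib)
    then have "cmod (scaled_mean a v * of_real K) \<le> cmod (of_real T * J T v) +
        cmod (\<integral>y. (scaled_mean a (v - y / T) - scaled_mean a v) * of_real (fejer y) \<partial>lborel)"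
      by (simp only: norm_triangle_ineq4)
    also have "cmod (\<integral>y. (scaled_mean a (v - y / T) - scaled_mean a v) * of_real (fejer y) \<partial>lborel) \<le>
        (\<integral>y. w (y / T) * fejer y + exp (- v) * fejer y \<partial>lborel)"
    proof (rule order.trans[OF integral_norm_bound integral_mono_AE])
      show "integrable lborel (\<lambda>y. norm ((scaled_mean a (v - y / T) - scaled_mean a v) * of_real (fejer y)))"
        using i1 i2 by (intro integrable_norm) (simp add: left_diff_distrib)
      show "integrable lborel (\<lambda>y. w (y / T) * fejer y + exp (- v) * fejer y)"
        using i3 integrable_fejer by simp
      show "AE y in lborel. norm ((scaled_mean a (v - y / T) - scaled_mean a v) * of_real (fejer y)) \<le>
          w (y / T) * fejer y + exp (- v) * fejer y"
      proof (rule AE_I2)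
        fix y
        have "cmod (scaled_mean a (v - y / T) - scaled_mean a v) * fejer y \<le> (w (y / T) + exp (- v)) * fejer y"
          using scaled_mean_slow[of v "y / T"] unfolding w_def by (intro mult_right_mono fejer_nonneg)
        then show "norm ((scaled_mean a (v - y / T) - scaled_mean a v) * of_real (fejer y)) \<le>
          w (y / T) * fejer y + exp (- v) * fejer y" by (simp add: norm_mult fejer_nonneg distrib_right)
      qed
    qed
    also have "\<dots> = (\<integral>y. w (y / T) * fejer y \<partial>lborel) + exp (- v) * K"
      using i3 integrable_fejer by (simp add: K_def)
    finally show ?thesis using K T by (simp add: norm_mult mult.commute)
  qed
  have wlim: "(\<lambda>k. \<integral>y. w (y / real (Suc k)) * fejer y \<partial>lborel) \<longlonglongrightarrow> integral\<^sup>L lborel (\<lambda>y::real. 0::real)"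
  proof (rule integral_dominated_convergence)
    show "integrable lborel (\<lambda>y. 2 * fejer y)" using integrable_fejer by simp
    show "AE y in lborel. (\<lambda>k. w (y / real (Suc k)) * fejer y) \<longlonglongrightarrow> 0"
    proof (rule AE_I2)
      fix y
      have "(\<lambda>k. min 2 (2 * \<bar>1 - exp (- (y * inverse (real (Suc k))))\<bar>) * fejer y) \<longlonglongrightarrow>
          min 2 (2 * \<bar>1 - exp (- (y * 0))\<bar>) * fejer y"
        by (intro tendsto_intros LIMSEQ_inverse_real_of_nat)
      then show "(\<lambda>k. w (y / real (Suc k)) * fejer y) \<longlonglongrightarrow> 0" by (simp add: w_def divide_inverse)
    qed
    show "AE y in lborel. norm (w (y / real (Suc k)) * fejer y) \<le> 2 * fejer y" for k
      using w0 by (intro AE_I2) (auto simp: abs_mult fejer_nonneg intro!: mult_right_mono)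
  qed auto
  have "(scaled_mean a \<longlongrightarrow> 0) at_top"
  proof (rule tendstoI)
    fix d :: real assume d: "d > 0"
    have "\<forall>\<^sub>F k in sequentially. (\<integral>y. w (y / real (Suc k)) * fejer y \<partial>lborel) < d * K / 3"
      using wlim d K by (intro order_tendstoD(2)) auto
    then obtain k where k: "(\<integral>y. w (y / real (Suc k)) * fejer y \<partial>lborel) < d * K / 3"
      by (auto simp: eventually_sequentially)
    define T where "T = real (Suc k)"
    have T: "T > 0" by (simp add: T_def)
    have "((\<lambda>v. T * cmod (J T v)) \<longlongrightarrow> T * cmod 0) at_top" by (intro tendsto_intros J0 T)
    then have 1: "\<forall>\<^sub>F v in at_top. T * cmod (J T v) < d * K / 3"
      using d K by (intro order_tendstoD(2)) auto
    have "((\<lambda>v::real. exp (- v) * K) \<longlongrightarrow> 0) at_top" by real_asymp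
    then have 2: "\<forall>\<^sub>F v in at_top. exp (- v) * K < d * K / 3"
      using d K by (intro order_tendstoD(2)) auto
    from 1 2 show "\<forall>\<^sub>F v in at_top. dist (scaled_mean a v) 0 < d"
    proof eventually_elim
      case (elim v)
      then have "K * cmod (scaled_mean a v) < K * d" using bound[OF T, of v] k unfolding T_def[symmetric] by (simp add: mult.commute)
      then show ?case using K by simp
    qed
  qed
  moreover have "filterlim (\<lambda>N. ln (real N)) at_top sequentially" by real_asymp
  ultimately have "(\<lambda>N. scaled_mean a (ln (real N))) \<longlonglongrightarrow> 0" by (rule filterlim_compose)
  moreover have "\<forall>\<^sub>F N in sequentially. scaled_mean a (ln (real N)) = 1 / of_nat N * (\<Sum>n=1..N. a n)"
    by (rule eventually_mono[OF eventually_gt_at_top[of 0]])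
       (simp add: scaled_mean_def summatory_def exp_minus field_simps)
  ultimately show ?thesis by (rule Lim_transform_eventually)
qed

end

section \<open>Dirichlet series\<close>

text \<open>The summation may start at \<open>0\<close> because \<open>0 powr - s = 0\<close>.\<close>

definition dseries :: "(nat \<Rightarrow> complex) \<Rightarrow> complex \<Rightarrow> complex" where
  "dseries a s = suminf (\<lambda>n. a n * of_nat n powr - s)"

lemma norm_of_nat_powr: "n > 0 \<Longrightarrow> cmod (of_nat n powr s) = real n powr Re s"
  by (subst norm_powr_real_powr) auto

lemma norm_dirichlet_term: "cmod (a n * of_nat n powr - s) = cmod (a n) * real n powr - Re s"
  by (cases "n = 0") (auto simp: norm_mult norm_of_nat_powr)

lemma summable_norm_dseries:
  assumes "\<And>n. cmod (a n) \<le> C" "Re s > 1"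
  shows "summable (\<lambda>n. norm (a n * of_nat n powr - s))"
proof (rule summable_comparison_test')
  show "summable (\<lambda>n. C * real n powr - Re s)"
    using assms by (intro summable_mult) (simp add: summable_real_powr_iff)
  show "norm (norm (a n * of_nat n powr - s)) \<le> C * real n powr - Re s" if "n \<ge> 0" for n
    unfolding norm_dirichlet_term real_norm_def abs_norm_cancel using assms
    by (simp add: norm_dirichlet_term mult_right_mono abs_mult)
qed

lemma dseries_sums:
  assumes "summable (\<lambda>n. norm (a n * of_nat n powr - s))"
  shows "(\<lambda>n. a n * of_nat n powr - s) sums dseries a s"
  unfolding dseries_def using summable_norm_cancel[OF assms] by (rule summable_sums)

lemma dseries_has_sum:
  assumes "summable (\<lambda>n. norm (a n * of_nat n powr - s))"
  shows "((\<lambda>n. a n * of_nat n powr - s) has_sum dseries a s) {1..}"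
proof -
  have "((\<lambda>n. a n * of_nat n powr - s) has_sum dseries a s) UNIV"
    using norm_summable_imp_has_sum[OF assms dseries_sums[OF assms]] .
  also have "?this \<longleftrightarrow> ?thesis"
    by (rule has_sum_cong_neutral) (auto simp: not_le)
  finally show ?thesis .
qed

lemma has_sum_product:
  fixes f g :: "nat \<Rightarrow> complex"
  assumes f: "(f has_sum F) A" "(\<lambda>x. norm (f x)) summable_on A"
    and g: "(g has_sum G) B" "(\<lambda>x. norm (g x)) summable_on B"
  shows "((\<lambda>(x, y). f x * g y) has_sum (F * G)) (A \<times> B)"
proof (rule has_sum_SigmaI)
  show "((\<lambda>y. case (x, y) of (x, y) \<Rightarrow> f x * g y) has_sum (f x * G)) B" for x
    using has_sum_cmult_right[OF g(1), of "f x"] by simp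
  show "((\<lambda>x. f x * G) has_sum (F * G)) A" by (rule has_sum_cmult_left[OF f(1)])
  have "(\<lambda>p. norm (f (fst p)) * norm (g (snd p))) summable_on A \<times> B"
  proof (rule summable_on_SigmaI)
    show "((\<lambda>y. norm (f (fst (x, y))) * norm (g (snd (x, y)))) has_sum (norm (f x) * infsum (\<lambda>y. norm (g y)) B)) B" for x
      using has_sum_cmult_right[OF has_sum_infsum[OF g(2)], of "norm (f x)"] by simp
    show "(\<lambda>x. norm (f x) * infsum (\<lambda>y. norm (g y)) B) summable_on A"
      by (rule summable_on_cmult_left[OF f(2)])
  qed auto
  also have "(\<lambda>p. norm (f (fst p)) * norm (g (snd p))) = (\<lambda>p. norm (case p of (x, y) \<Rightarrow> f x * g y))"
    by (auto simp: fun_eq_iff norm_mult)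
  finally show "(\<lambda>(x, y). f x * g y) summable_on A \<times> B"
    by (rule abs_summable_summable)
qed

lemma dseries_mult:
  assumes a: "summable (\<lambda>n. norm (a n * of_nat n powr - s))"
    and b: "summable (\<lambda>n. norm (b n * of_nat n powr - s))"
    and c: "\<And>n. n > 0 \<Longrightarrow> c n = (\<Sum>d | d dvd n. a d * b (n div d))"
  shows "dseries c s = dseries a s * dseries b s"
proof -
  let ?f = "\<lambda>n. a n * of_nat n powr - s" and ?g = "\<lambda>n. b n * of_nat n powr - s"
  have "((\<lambda>(x, y). ?f x * ?g y) has_sum (dseries a s * dseries b s)) ({1..} \<times> {1..})"
  proof (rule has_sum_product[OF dseries_has_sum[OF a] _ dseries_has_sum[OF b]])
    show "(\<lambda>x. norm (?f x)) summable_on {1..}" "(\<lambda>x. norm (?g x)) summable_on {1..}"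
      using a b by (auto intro!: summable_on_subset[OF norm_summable_imp_summable_on])
  qed
  then have "((\<lambda>n. \<Sum>d | d dvd n. case (d, n div d) of (x, y) \<Rightarrow> ?f x * ?g y) has_sum (dseries a s * dseries b s)) {1..}"
    by (rule has_sum_divisor_pairs)
  also have "?this \<longleftrightarrow> ((\<lambda>n. c n * of_nat n powr - s) has_sum (dseries a s * dseries b s)) {1..}"
  proof (rule has_sum_cong)
    fix n :: nat assume "n \<in> {1..}"
    then have n: "n > 0" by simp
    have "?f d * ?g (n div d) = a d * b (n div d) * of_nat n powr - s" if "d dvd n" for d
    proof -
      from that obtain m where m: "n = d * m" by blast
      with n have "d > 0" "m > 0" by auto
      then have "of_nat (d * m) powr - s = of_nat d powr - s * (of_nat m powr - s :: complex)"
        by (simp add: powr_times_real)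
      then show ?thesis using m \<open>d > 0\<close> by simp
    qed
    then have "(\<Sum>d | d dvd n. ?f d * ?g (n div d)) = (\<Sum>d | d dvd n. a d * b (n div d) * of_nat n powr - s)"
      by (intro sum.cong) auto
    then show "(\<Sum>d | d dvd n. case (d, n div d) of (x, y) \<Rightarrow> ?f x * ?g y) = c n * of_nat n powr - s"
      unfolding c[OF n] sum_distrib_right by (simp only: prod.case)
  qed
  also have "\<dots> \<longleftrightarrow> ((\<lambda>n. c n * of_nat n powr - s) has_sum (dseries a s * dseries b s)) UNIV"
    by (rule has_sum_cong_neutral) (auto simp: not_le)
  finally have "(\<lambda>n. c n * of_nat n powr - s) sums (dseries a s * dseries b s)"
    by (rule has_sum_imp_sums)
  then show ?thesis unfolding dseries_def by (simp add: sums_iff)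
qed

lemma summable_norm_dseries_ln:
  assumes "\<And>n. cmod (a n) \<le> C * ln (real n)" "Re s > 1"
  shows "summable (\<lambda>n. norm (a n * of_nat n powr - s))"
proof (rule summable_comparison_test_bigo)
  define e where "e = (Re s - 1) / 2"
  have e: "e > 0" "- Re s + e < - 1" using assms(2) by (auto simp: e_def field_simps)
  show "summable (\<lambda>n. norm (real n powr (- Re s + e)))"
    using e by (simp add: summable_real_powr_iff)
  have "(\<lambda>n. norm (a n * of_nat n powr - s)) \<in> O(\<lambda>n. C * ln (real n) * real n powr - Re s)"
  proof (rule landau_o.big_mono, intro always_eventually allI)
    fix n
    have "cmod (a n) * real n powr - Re s \<le> C * ln (real n) * real n powr - Re s"
      using assms(1) by (intro mult_right_mono) auto
    also have "\<dots> \<le> norm \<dots>" by simp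
    finally show "norm (norm (a n * of_nat n powr - s)) \<le> norm (C * ln (real n) * real n powr - Re s)"
      by (simp add: norm_dirichlet_term abs_mult)
  qed
  also have "(\<lambda>n. C * ln (real n) * real n powr - Re s) \<in> O(\<lambda>n. real n powr (- Re s + e))"
    using e by real_asymp
  finally show "(\<lambda>n. norm (a n * of_nat n powr - s)) \<in> O(\<lambda>n. real n powr (- Re s + e))" .
qed

lemma dseries_derivative:
  assumes a: "\<And>n. cmod (a n) \<le> C" and s: "Re s > 1"
  shows "(dseries a has_field_derivative - dseries (\<lambda>n. a n * of_real (ln (real n))) s) (at s)"
proof -
  let ?S = "{s. Re s > 1}"
  have C0: "C \<ge> 0" using a[of 0] norm_ge_zero order_trans by blast
  have der: "((\<lambda>s. a n * of_nat n powr - s) has_field_derivative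
      - (a n * of_real (ln (real n)) * of_nat n powr - x)) (at x)" for n x
  proof (cases "n = 0")
    case False
    have "((\<lambda>s. a n * exp (- s * of_real (ln (real n)))) has_field_derivative
      - (a n * of_real (ln (real n)) * exp (- x * of_real (ln (real n))))) (at x)"
      by (auto intro!: derivative_eq_intros)
    then show ?thesis using False by (simp add: powr_def Ln_of_nat)
  qed simp
  have "\<exists>g g'. \<forall>x\<in>?S. ((\<lambda>n. a n * of_nat n powr - x) sums g x) \<and>
      ((\<lambda>n. - (a n * of_real (ln (real n)) * of_nat n powr - x)) sums g' x) \<and> (g has_field_derivative g' x) (at x)"
  proof (rule series_and_derivative_comparison_complex)
    show "open ?S" by (rule open_halfspace_Re_gt)
    show "((\<lambda>s. a n * of_nat n powr - s) has_field_derivative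
      - (a n * of_real (ln (real n)) * of_nat n powr - x)) (at x)" for n x by (rule der)
    fix x assume x: "x \<in> ?S"
    define d where "d = (Re x - 1) / 2"
    have d: "d > 0" using x by (simp add: d_def)
    show "\<exists>d h. 0 < d \<and> summable h \<and> range h \<subseteq> \<real>\<^sub>\<ge>\<^sub>0 \<and>
        (\<forall>\<^sub>F n in sequentially. \<forall>y\<in>ball x d \<inter> ?S. cmod (a n * of_nat n powr - y) \<le> cmod (h n))"
    proof (intro exI[of _ d] exI[of _ "\<lambda>n. complex_of_real (C * real n powr - (1 + d))"] conjI always_eventually allI ballI)
      show "summable (\<lambda>n. complex_of_real (C * real n powr - (1 + d)))"
        using d by (intro summable_of_real summable_mult) (simp add: summable_real_powr_iff)
      show "range (\<lambda>n. complex_of_real (C * real n powr - (1 + d))) \<subseteq> \<real>\<^sub>\<ge>\<^sub>0"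
        using C0 by (auto simp: nonneg_Reals_of_real_iff)
      fix n y assume y: "y \<in> ball x d \<inter> ?S"
      have "\<bar>Re (x - y)\<bar> < d" using y abs_Re_le_cmod[of "x - y"] by (auto simp: dist_norm)
      then have "Re y \<ge> 1 + d" by (simp add: d_def field_simps abs_if split: if_splits)
      then have "real n powr - Re y \<le> real n powr - (1 + d)"
        by (cases "n = 0") (auto intro!: powr_mono)
      then show "cmod (a n * of_nat n powr - y) \<le> cmod (complex_of_real (C * real n powr - (1 + d)))"
        unfolding norm_dirichlet_term norm_of_real using a[of n] C0
        by (intro order.trans[OF mult_mono abs_ge_self]) auto
    qed (rule d)
  qed
  then obtain g g' where g: "\<And>x. x \<in> ?S \<Longrightarrow> (\<lambda>n. a n * of_nat n powr - x) sums g x"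
    "\<And>x. x \<in> ?S \<Longrightarrow> (\<lambda>n. - (a n * of_real (ln (real n)) * of_nat n powr - x)) sums g' x"
    "\<And>x. x \<in> ?S \<Longrightarrow> (g has_field_derivative g' x) (at x)" by blast
  have gd: "g x = dseries a x" if "x \<in> ?S" for x
    using g(1)[OF that] by (simp add: dseries_def sums_iff)
  have "(\<lambda>n. - (- (a n * of_real (ln (real n)) * of_nat n powr - s))) sums - g' s"
    using s by (intro sums_minus g) simp
  then have "g' s = - dseries (\<lambda>n. a n * of_real (ln (real n))) s"
    unfolding dseries_def by (simp add: sums_iff)
  moreover have "(dseries a has_field_derivative g' s) (at s)"
    by (rule has_field_derivative_transform_within_open[of g "g' s" s ?S])
       (use g(3)[of s] s gd in \<open>auto simp: open_halfspace_Re_gt\<close>)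
  ultimately show ?thesis by simp
qed

subsection \<open>Analytic continuation for periodic coefficients\<close>

text \<open>The two mean value estimates that make the continuations below absolutely convergent.\<close>

lemma norm_powr_diff_le:
  assumes n: "n > 0" and w: "Re w \<le> 1" and x: "real n \<le> x" "x \<le> real n + 1"
  shows "cmod (of_real x powr w - of_nat n powr w) \<le> cmod w * real n powr (Re w - 1)"
proof -
  let ?S = "cbox (Complex (real n) 0) (Complex (real n + 1) 0)"
  have S: "z = of_real (Re z) \<and> real n \<le> Re z" if "z \<in> ?S" for z
    using that by (intro conjI complex_eqI) (auto simp: in_cbox_complex_iff)
  have "cmod (of_real x powr w - of_real (real n) powr w) \<le> (cmod w * real n powr (Re w - 1)) * cmod (of_real x - of_real (real n))"
  proof (rule field_differentiable_bound[of ?S])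
    fix z assume "z \<in> ?S"
    then obtain y where y: "z = of_real y" "real n \<le> y" using S by blast
    then have y0: "y > 0" using n by linarith
    show "((\<lambda>z. z powr w) has_field_derivative w * z powr (w - 1)) (at z within ?S)"
      by (rule has_field_derivative_at_within, rule has_field_derivative_powr)
         (use y y0 in \<open>simp add: complex_nonpos_Reals_iff\<close>)
    have "y powr (Re w - 1) \<le> real n powr (Re w - 1)"
      using y(2) w n by (intro powr_mono2') auto
    then show "cmod (w * z powr (w - 1)) \<le> cmod w * real n powr (Re w - 1)"
      using y y0 by (simp add: norm_mult norm_powr_real_powr mult_left_mono)
  next
    show "complex_of_real x \<in> ?S" "complex_of_real (real n) \<in> ?S" using x by (auto simp: in_cbox_complex_iff)
  qed (rule convex_box)
  also have "cmod (of_real x - of_real (real n)) = \<bar>x - real n\<bar>"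
    by (metis norm_of_real of_real_diff)
  also have "(cmod w * real n powr (Re w - 1)) * \<bar>x - real n\<bar> \<le> (cmod w * real n powr (Re w - 1)) * 1"
    using x by (intro mult_left_mono) auto
  finally show ?thesis by simp
qed

lemma norm_powr_taylor_le:
  assumes n: "n > 0" and s: "Re s > 0"
  shows "cmod ((s - 1) * of_nat n powr - s - of_nat n powr (1 - s) + of_nat (n + 1) powr (1 - s))
    \<le> cmod (1 - s) * cmod s * real n powr (- Re s - 1)"
proof -
  let ?S = "cbox (Complex (real n) 0) (Complex (real n + 1) 0)"
  let ?g = "\<lambda>z. z powr (1 - s) - (1 - s) * of_nat n powr - s * z"
  have "cmod (?g (complex_of_real (real n + 1)) - ?g (of_nat n)) \<le>
      (cmod (1 - s) * cmod s * real n powr (- Re s - 1)) * cmod (complex_of_real (real n + 1) - of_nat n)"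
  proof (rule field_differentiable_bound[of ?S])
    fix z assume "z \<in> ?S"
    then have "z = of_real (Re z)" "real n \<le> Re z" "Re z \<le> real n + 1"
      by (auto simp: in_cbox_complex_iff intro!: complex_eqI)
    then obtain y where y: "z = of_real y" "real n \<le> y" "y \<le> real n + 1" by blast
    then have y0: "y > 0" using n by linarith
    have zn: "z \<notin> \<real>\<^sub>\<le>\<^sub>0" using y y0 by (simp add: complex_nonpos_Reals_iff)
    have "((\<lambda>z. z powr (1 - s)) has_field_derivative (1 - s) * z powr (1 - s - 1)) (at z)"
      by (rule has_field_derivative_powr) (use y y0 in \<open>simp add: complex_nonpos_Reals_iff\<close>)
    then have "((\<lambda>z. z powr (1 - s)) has_field_derivative (1 - s) * z powr - s) (at z)" by simp
    then have "(?g has_field_derivative (1 - s) * z powr - s - (1 - s) * of_nat n powr - s) (at z)"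
      by (auto intro!: derivative_eq_intros simp: zn)
    then show "(?g has_field_derivative (1 - s) * (z powr - s - of_nat n powr - s)) (at z within ?S)"
      by (subst right_diff_distrib, rule has_field_derivative_at_within)
    have "cmod (of_real y powr - s - of_nat n powr - s) \<le> cmod (- s) * real n powr (Re (- s) - 1)"
      using n s y by (intro norm_powr_diff_le) auto
    then show "cmod ((1 - s) * (z powr - s - of_nat n powr - s)) \<le> cmod (1 - s) * cmod s * real n powr (- Re s - 1)"
      using y by (simp add: norm_mult mult_left_mono mult.assoc)
  qed (auto simp: in_cbox_complex_iff convex_box)
  moreover have "?g (complex_of_real (real n + 1)) - ?g (of_nat n) =
      (s - 1) * of_nat n powr - s - of_nat n powr (1 - s) + of_nat (n + 1) powr (1 - s)"
    by (simp add: algebra_simps)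
  moreover have "complex_of_real (real n + 1) - of_nat n = 1" by simp
  ultimately show ?thesis by (simp only: norm_one mult_1_right)
qed

text \<open>The bound is summable, and near each point of the half-plane it is uniform.\<close>

lemma holomorphic_series_halfplane:
  fixes t :: "nat \<Rightarrow> complex \<Rightarrow> complex"
  assumes hol: "\<And>n. t n holomorphic_on {s. Re s > 0}"
    and bd: "\<And>n s. Re s > 0 \<Longrightarrow> cmod (t n s) \<le> C * (cmod s + 1)\<^sup>2 * real (Suc n) powr (- Re s - 1)"
  obtains g where "g holomorphic_on {s. Re s > 0}" "\<And>s. Re s > 0 \<Longrightarrow> (\<lambda>n. t n s) sums g s"
proof -
  let ?S = "{s. Re s > 0}"
  have C0: "C \<ge> 0"
  proof -
    have "0 \<le> cmod (t 0 1)" by simp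
    also have "\<dots> \<le> C * (cmod 1 + 1)\<^sup>2 * real (Suc 0) powr (- Re 1 - 1)" by (rule bd) simp
    finally show ?thesis by simp
  qed
  have "\<exists>g g'. \<forall>x\<in>?S. ((\<lambda>n. t n x) sums g x) \<and> ((\<lambda>n. deriv (t n) x) sums g' x) \<and>
      (g has_field_derivative g' x) (at x)"
  proof (rule series_and_derivative_comparison_complex)
    show op: "open ?S" by (rule open_halfspace_Re_gt)
    show "(t n has_field_derivative deriv (t n) x) (at x)" if "x \<in> ?S" for n x
      using holomorphic_derivI[OF hol op that] .
    fix x assume x: "x \<in> ?S"
    define d where "d = Re x / 2"
    have d: "d > 0" using x by (simp add: d_def)
    define D where "D = C * (cmod x + d + 1)\<^sup>2"
    have D0: "D \<ge> 0" unfolding D_def using C0 by simp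
    show "\<exists>d h. 0 < d \<and> summable h \<and> range h \<subseteq> \<real>\<^sub>\<ge>\<^sub>0 \<and>
        (\<forall>\<^sub>F n in sequentially. \<forall>y\<in>ball x d \<inter> ?S. cmod (t n y) \<le> cmod (h n))"
    proof (intro exI[of _ d] exI[of _ "\<lambda>n. complex_of_real (D * real (Suc n) powr (- d - 1))"] conjI always_eventually allI ballI)
      have "summable (\<lambda>n. real (Suc n) powr (- d - 1))"
        using d by (subst summable_Suc_iff) (simp add: summable_real_powr_iff)
      then show "summable (\<lambda>n. complex_of_real (D * real (Suc n) powr (- d - 1)))"
        by (intro summable_of_real summable_mult)
      show "range (\<lambda>n. complex_of_real (D * real (Suc n) powr (- d - 1))) \<subseteq> \<real>\<^sub>\<ge>\<^sub>0"
        using D0 by (auto simp: nonneg_Reals_of_real_iff)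
      fix n y assume y: "y \<in> ball x d \<inter> ?S"
      have "\<bar>Re (x - y)\<bar> < d" using y abs_Re_le_cmod[of "x - y"] by (auto simp: dist_norm)
      then have "Re y \<ge> d" by (simp add: d_def field_simps abs_if split: if_splits)
      then have 1: "real (Suc n) powr (- Re y - 1) \<le> real (Suc n) powr (- d - 1)"
        by (intro powr_mono) auto
      have "cmod y \<le> cmod x + d" using y norm_triangle_ineq2[of y x] by (auto simp: dist_norm norm_minus_commute)
      then have 2: "(cmod y + 1)\<^sup>2 \<le> (cmod x + d + 1)\<^sup>2" by (intro power_mono) auto
      have "cmod (t n y) \<le> C * (cmod y + 1)\<^sup>2 * real (Suc n) powr (- Re y - 1)" using y by (intro bd) auto
      also have "\<dots> \<le> C * (cmod x + d + 1)\<^sup>2 * real (Suc n) powr (- d - 1)"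
        using 1 2 C0 by (intro mult_mono mult_nonneg_nonneg) auto
      finally show "cmod (t n y) \<le> cmod (complex_of_real (D * real (Suc n) powr (- d - 1)))"
        unfolding norm_of_real D_def[symmetric] by (rule order.trans[OF _ abs_ge_self])
    qed (rule d)
  qed
  then obtain g g' where g: "\<And>x. x \<in> ?S \<Longrightarrow> (\<lambda>n. t n x) sums g x" "\<And>x. x \<in> ?S \<Longrightarrow> (g has_field_derivative g' x) (at x)"
    by blast
  then have "g holomorphic_on ?S"
    by (auto simp: holomorphic_on_def field_differentiable_def intro: has_field_derivative_at_within)
  with g(1) show ?thesis using that by blast
qed

lemma abel_summation:
  fixes a u :: "nat \<Rightarrow> complex"
  assumes bd: "\<And>n. cmod (\<Sum>k=1..n. a k) \<le> C" and u: "u \<longlonglongrightarrow> 0"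
    and T: "(\<lambda>n. (\<Sum>k=1..Suc n. a k) * (u (Suc n) - u (Suc (Suc n)))) sums T"
  shows "(\<lambda>n. a (Suc n) * u (Suc n)) sums T"
proof -
  let ?S = "\<lambda>n. \<Sum>k=1..n. a k"
  have eq: "(\<Sum>n<N. a (Suc n) * u (Suc n)) = (\<Sum>n<N. ?S (Suc n) * (u (Suc n) - u (Suc (Suc n)))) + ?S N * u (Suc N)" for N
    by (induction N) (simp_all add: algebra_simps)
  have "(\<lambda>N. ?S N * u (Suc N)) \<longlonglongrightarrow> 0"
  proof (rule Lim_null_comparison)
    show "\<forall>\<^sub>F N in sequentially. norm (?S N * u (Suc N)) \<le> C * norm (u (Suc N))"
      using bd by (intro always_eventually allI) (auto simp: norm_mult intro!: mult_right_mono)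
    have "(\<lambda>N. C * norm (u (Suc N))) \<longlonglongrightarrow> C * norm (0::complex)"
      by (intro tendsto_intros LIMSEQ_Suc u)
    then show "(\<lambda>N. C * norm (u (Suc N))) \<longlonglongrightarrow> 0" by simp
  qed
  then have "(\<lambda>N. (\<Sum>n<N. ?S (Suc n) * (u (Suc n) - u (Suc (Suc n)))) + ?S N * u (Suc N)) \<longlonglongrightarrow> T + 0"
    using T unfolding sums_def by (intro tendsto_add)
  then show ?thesis unfolding sums_def eq by simp
qed

lemma periodic_sum_shift:
  fixes a :: "nat \<Rightarrow> complex"
  assumes "\<And>n. a (n + q) = a n"
  shows "(\<Sum>k\<in>{n..<n+q}. a k) = (\<Sum>k<q. a k)"
proof (induction n)
  case (Suc n)
  have "(\<Sum>k\<in>{Suc n..<Suc n + q}. a k) + a n = (\<Sum>k\<in>{n..<n+q}. a k) + a (n + q)"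
    by (cases "q = 0") (simp_all add: sum.atLeast_Suc_lessThan[of n "n + q"] add.commute)
  then show ?case using Suc.IH assms by simp
qed (simp add: atLeast0LessThan)

lemma periodic_mod:
  fixes a :: "nat \<Rightarrow> 'a"
  assumes "\<And>n. a (n + q) = a n"
  shows "a (n mod q) = a n"
proof -
  have "a (m + k * q) = a m" for m k
    by (induction k) (simp_all add: assms add.assoc[symmetric] add.commute[of q] )
  from this[of "n mod q" "n div q"] show ?thesis by simp
qed

lemma periodic_partial_sums_bounded:
  fixes a :: "nat \<Rightarrow> complex"
  assumes per: "\<And>n. a (n + q) = a n" and q: "q > 0" and z: "(\<Sum>k<q. a k) = 0"
  obtains C where "\<And>n. cmod (\<Sum>k=1..n. a k) \<le> C"
proof -
  let ?S = "\<lambda>n. \<Sum>k=1..n. a k"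
  have "?S (n + q) = ?S n" for n
  proof -
    have "{1..n + q} = {1..n} \<union> {Suc n..<Suc n + q}" by auto
    then have "?S (n + q) = sum a ({1..n} \<union> {Suc n..<Suc n + q})" by (simp only:)
    also have "\<dots> = ?S n + (\<Sum>k\<in>{Suc n..<Suc n + q}. a k)" by (rule sum.union_disjoint) auto
    finally have "?S (n + q) = ?S n + (\<Sum>k\<in>{Suc n..<Suc n + q}. a k)" .
    then show ?thesis using periodic_sum_shift[of a q "Suc n", OF per] z by simp
  qed
  then have "?S (n mod q) = ?S n" for n by (rule periodic_mod)
  moreover have "cmod (?S (n mod q)) \<le> Max ((\<lambda>m. cmod (?S m)) ` {..<q})" for n
    using q by (intro Max_ge) auto
  ultimately have "cmod (?S n) \<le> Max ((\<lambda>m. cmod (?S m)) ` {..<q})" for n by metis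
  then show ?thesis by (rule that)
qed

lemma of_nat_powr_tendsto_0:
  assumes "Re w < 0"
  shows "(\<lambda>n. (of_nat n :: complex) powr w) \<longlonglongrightarrow> 0"
proof (rule Lim_null_comparison)
  show "\<forall>\<^sub>F n in sequentially. norm ((of_nat n :: complex) powr w) \<le> real n powr Re w"
    by (rule eventually_mono[OF eventually_gt_at_top[of 0]]) (simp add: norm_of_nat_powr)
  show "(\<lambda>n. real n powr Re w) \<longlonglongrightarrow> 0" using assms by real_asymp
qed

text \<open>The partial sums of the coefficients are bounded. Summation by parts therefore replaces \<open>n powr - s\<close>
  by the differences of consecutive powers, which are summable for \<open>Re s > 0\<close>. The series
  representation at \<open>s = 1\<close> is kept for the treatment of real characters.\<close>

lemma dseries_continuation_mean_zero:
  fixes a :: "nat \<Rightarrow> complex"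
  assumes per: "\<And>n. a (n + q) = a n" and q: "q > 0" and z: "(\<Sum>k<q. a k) = 0"
  obtains H where "H holomorphic_on {s. Re s > 0}"
    "\<And>s. Re s > 1 \<Longrightarrow> H s = dseries a s"
    "(\<lambda>n. (\<Sum>k=1..Suc n. a k) * (1 / of_nat (Suc n) - 1 / of_nat (Suc (Suc n)))) sums H 1"
proof -
  obtain C where C: "\<And>n. cmod (\<Sum>k=1..n. a k) \<le> C"
    using periodic_partial_sums_bounded[OF per q z] by blast
  have C0: "C \<ge> 0" using C[of 0] by simp
  define t where "t = (\<lambda>n s. (\<Sum>k=1..Suc n. a k) * (of_nat (Suc n) powr - s - of_nat (Suc (Suc n)) powr - s))"
  obtain H where H: "H holomorphic_on {s. Re s > 0}" "\<And>s. Re s > 0 \<Longrightarrow> (\<lambda>n. t n s) sums H s"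
  proof (rule holomorphic_series_halfplane[of t C])
    show "t n holomorphic_on {s. Re s > 0}" for n
      unfolding t_def by (intro holomorphic_intros)
    fix n s assume s: "Re s > 0"
    have "cmod (of_real (real (Suc (Suc n))) powr - s - of_nat (Suc n) powr - s) \<le> cmod (- s) * real (Suc n) powr (Re (- s) - 1)"
      using s by (intro norm_powr_diff_le) auto
    then have "cmod (of_nat (Suc n) powr - s - of_nat (Suc (Suc n)) powr - s) \<le> cmod s * real (Suc n) powr (- Re s - 1)"
      by (simp add: norm_minus_commute del: of_nat_Suc)
    also have "cmod s \<le> (cmod s + 1)\<^sup>2" by (simp add: power2_eq_square algebra_simps)
    finally have "cmod (of_nat (Suc n) powr - s - of_nat (Suc (Suc n)) powr - s) \<le> (cmod s + 1)\<^sup>2 * real (Suc n) powr (- Re s - 1)"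
      by (simp add: mult_right_mono del: of_nat_Suc)
    then show "cmod (t n s) \<le> C * (cmod s + 1)\<^sup>2 * real (Suc n) powr (- Re s - 1)"
      unfolding t_def norm_mult mult.assoc by (intro mult_mono C) (simp_all add: C0)
  qed blast
  have "H s = dseries a s" if s: "Re s > 1" for s
  proof -
    have "(\<lambda>n. a (Suc n) * of_nat (Suc n) powr - s) sums H s"
      using H(2)[of s] s unfolding t_def
      by (intro abel_summation[OF C, where u = "\<lambda>n. of_nat n powr - s"] of_nat_powr_tendsto_0) auto
    then have "(\<lambda>n. a n * of_nat n powr - s) sums H s"
      by (subst (asm) sums_Suc_iff) simp
    then show ?thesis by (simp add: dseries_def sums_iff)
  qed
  moreover have "(\<lambda>n. (\<Sum>k=1..Suc n. a k) * (1 / of_nat (Suc n) - 1 / of_nat (Suc (Suc n)))) sums H 1"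
    using H(2)[of 1] by (simp add: t_def powr_minus field_simps del: of_nat_Suc sum.cl_ivl_Suc)
  ultimately show ?thesis using that H(1) by blast
qed

text \<open>Each term \<open>(s - 1) * n powr - s\<close> is compared with the integral of \<open>(s - 1) * x powr - s\<close> over
  \<open>{n..n + 1}\<close>. The integrals telescope.\<close>

lemma zeta_continuation:
  obtains Z where "Z holomorphic_on {s. Re s > 0}" "Z 1 = 1"
    "\<And>s. Re s > 1 \<Longrightarrow> Z s = (s - 1) * dseries (\<lambda>_. 1) s"
proof -
  define t where "t = (\<lambda>n s. (s - 1) * of_nat (Suc n) powr - s - of_nat (Suc n) powr (1 - s) + (of_nat (Suc (Suc n)) :: complex) powr (1 - s))"
  obtain g where g: "g holomorphic_on {s. Re s > 0}" "\<And>s. Re s > 0 \<Longrightarrow> (\<lambda>n. t n s) sums g s"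
  proof (rule holomorphic_series_halfplane[of t 1])
    show "t n holomorphic_on {s. Re s > 0}" for n
      unfolding t_def by (intro holomorphic_intros)
    fix n s assume s: "Re s > 0"
    have "cmod (t n s) \<le> cmod (1 - s) * cmod s * real (Suc n) powr (- Re s - 1)"
      using norm_powr_taylor_le[of "Suc n" s] s by (simp add: t_def del: of_nat_Suc)
    also have "cmod (1 - s) * cmod s \<le> (cmod s + 1) * (cmod s + 1)"
      using norm_triangle_ineq4[of 1 s] by (intro mult_mono) auto
    finally show "cmod (t n s) \<le> 1 * (cmod s + 1)\<^sup>2 * real (Suc n) powr (- Re s - 1)"
      by (simp add: power2_eq_square mult_right_mono del: of_nat_Suc)
  qed blast
  have "1 + g s = (s - 1) * dseries (\<lambda>_. 1) s" if s: "Re s > 1" for s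
  proof -
    have "(\<lambda>n. 1 * of_nat n powr - s) sums dseries (\<lambda>_. 1) s"
      using s by (intro dseries_sums summable_norm_dseries[of _ 1]) auto
    then have "(\<lambda>n. of_nat (Suc n) powr - s) sums dseries (\<lambda>_. 1) s"
      by (subst sums_Suc_iff) simp
    then have 1: "(\<lambda>n. (s - 1) * of_nat (Suc n) powr - s) sums ((s - 1) * dseries (\<lambda>_. 1) s)"
      by (rule sums_mult)
    have "(\<lambda>n. of_nat (Suc n) powr (1 - s)) \<longlonglongrightarrow> (0::complex)"
      using s by (intro LIMSEQ_Suc of_nat_powr_tendsto_0) auto
    from telescope_sums[OF this]
    have "(\<lambda>n. (of_nat (Suc (Suc n)) :: complex) powr (1 - s) - of_nat (Suc n) powr (1 - s)) sums (0 - of_nat (Suc 0) powr (1 - s))" .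
    also have "(of_nat (Suc 0) :: complex) powr (1 - s) = 1" by simp
    finally have "(\<lambda>n. (of_nat (Suc (Suc n)) :: complex) powr (1 - s) - of_nat (Suc n) powr (1 - s)) sums (0 - 1)" .
    from sums_add[OF 1 this] have "(\<lambda>n. t n s) sums ((s - 1) * dseries (\<lambda>_. 1) s - 1)"
      by (simp add: t_def algebra_simps del: of_nat_Suc)
    with g(2)[of s] s show ?thesis using sums_unique2 by fastforce
  qed
  moreover have "g 1 = 0"
    using g(2)[of 1] sums_unique2[OF _ sums_zero] by (simp add: t_def del: of_nat_Suc)
  then have "1 + g 1 = 1" by simp
  moreover have "(\<lambda>s. 1 + g s) holomorphic_on {s. Re s > 0}" by (intro holomorphic_intros g)
  ultimately show ?thesis using that[of "\<lambda>s. 1 + g s"] by blast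
qed

text \<open>The mean of the coefficients, subtracted from them, becomes the residue at \<open>s = 1\<close>.\<close>

lemma dseries_continuation:
  fixes a :: "nat \<Rightarrow> complex"
  assumes per: "\<And>n. a (n + q) = a n" and q: "q > 0"
  obtains W where "W holomorphic_on {s. Re s > 0}" "W 1 = (\<Sum>k<q. a k) / of_nat q"
    "\<And>s. Re s > 1 \<Longrightarrow> W s = (s - 1) * dseries a s"
proof -
  define c where "c = (\<Sum>k<q. a k) / of_nat q"
  define b where "b = (\<lambda>n. a n - c)"
  have bper: "b (n + q) = b n" for n by (simp add: b_def per)
  have bz: "(\<Sum>k<q. b k) = 0" using q by (simp add: b_def sum_subtractf c_def)
  obtain H where H: "H holomorphic_on {s. Re s > 0}" "\<And>s. Re s > 1 \<Longrightarrow> H s = dseries b s"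
    using dseries_continuation_mean_zero[OF bper q bz] by metis
  obtain Z where Z: "Z holomorphic_on {s. Re s > 0}" "Z 1 = 1"
    "\<And>s. Re s > 1 \<Longrightarrow> Z s = (s - 1) * dseries (\<lambda>_. 1) s" using zeta_continuation by metis
  have bC: "cmod (b n) \<le> Max ((\<lambda>m. cmod (b m)) ` {..<q})" for n
  proof -
    have "cmod (b (n mod q)) \<le> Max ((\<lambda>m. cmod (b m)) ` {..<q})" using q by (intro Max_ge) auto
    then show ?thesis by (simp add: periodic_mod[of b q, OF bper])
  qed
  have "c * Z s + (s - 1) * H s = (s - 1) * dseries a s" if s: "Re s > 1" for s
  proof -
    have "(\<lambda>n. 1 * of_nat n powr - s) sums dseries (\<lambda>_. 1) s"
      using s by (intro dseries_sums summable_norm_dseries[of _ 1]) auto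
    moreover have "(\<lambda>n. b n * of_nat n powr - s) sums dseries b s"
      using s by (intro dseries_sums summable_norm_dseries[OF bC])
    ultimately have "(\<lambda>n. c * (1 * of_nat n powr - s) + b n * of_nat n powr - s) sums (c * dseries (\<lambda>_. 1) s + dseries b s)"
      by (intro sums_add sums_mult)
    then have "dseries a s = c * dseries (\<lambda>_. 1) s + dseries b s"
      unfolding dseries_def[of a] by (simp add: b_def sums_iff algebra_simps)
    then show ?thesis unfolding Z(3)[OF s] H(2)[OF s] by (simp add: algebra_simps)
  qed
  moreover have "(\<lambda>s. c * Z s + (s - 1) * H s) holomorphic_on {s. Re s > 0}"
    by (intro holomorphic_intros Z H)
  moreover have "c * Z 1 + (1 - 1) * H 1 = (\<Sum>k<q. a k) / of_nat q" by (simp add: Z c_def)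
  ultimately show ?thesis using that[of "\<lambda>s. c * Z s + (s - 1) * H s"] by blast
qed

section \<open>Dirichlet characters and non-vanishing on the line Re s = 1\<close>

locale dirichlet_char =
  fixes ch :: "nat \<Rightarrow> complex" and q :: nat
  assumes modulus_pos: "q > 0"
    and periodic: "ch (n + q) = ch n"
    and mult: "ch (m * n) = ch m * ch n"
    and eq_0_iff: "ch n = 0 \<longleftrightarrow> \<not> coprime n q"
begin

lemma chi_1: "ch (Suc 0) = 1"
  using mult[of 1 1] eq_0_iff[of 1] by simp

lemma power: "ch (n ^ k) = ch n ^ k"
  by (induction k) (simp_all add: mult chi_1)

lemma norm_eq_1:
  assumes "coprime n q"
  shows "cmod (ch n) = 1"
proof -
  have "[n ^ totient q = 1] (mod q)" using assms by (rule euler_theorem)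
  then have "ch (n ^ totient q) = ch 1"
    using periodic_mod[of ch q, OF periodic] by (metis unique_euclidean_semiring_class.cong_def)
  then have "ch n ^ totient q = 1" by (simp add: power chi_1)
  then have "cmod (ch n) ^ totient q = 1" by (metis norm_one norm_power)
  moreover have "totient q > 0" using modulus_pos by simp
  ultimately show ?thesis by (intro power_eq_imp_eq_base[where b = 1 and n = "totient q"]) simp_all
qed

lemma norm_le_1: "cmod (ch n) \<le> 1"
  using norm_eq_1[of n] eq_0_iff[of n] by (cases "coprime n q") auto

lemma square: "dirichlet_char (\<lambda>n. ch n ^ 2) q"
  by unfold_locales (auto simp: modulus_pos periodic mult power_mult_distrib eq_0_iff)

lemma sum_shift:
  assumes "coprime g q"
  shows "ch g * (\<Sum>k<q. ch k) = (\<Sum>k<q. ch k)"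
proof -
  have inj: "inj_on (\<lambda>k. g * k mod q) {..<q}"
  proof (rule inj_onI)
    fix x y assume xy: "x \<in> {..<q}" "y \<in> {..<q}" "g * x mod q = g * y mod q"
    then have "[g * x = g * y] (mod q)" by (simp add: unique_euclidean_semiring_class.cong_def)
    then have "[x = y] (mod q)" using assms cong_mult_lcancel_nat by blast
    then show "x = y" using xy by (simp add: unique_euclidean_semiring_class.cong_def)
  qed
  moreover have sub: "(\<lambda>k. g * k mod q) ` {..<q} \<subseteq> {..<q}" using modulus_pos by auto
  ultimately have bij: "bij_betw (\<lambda>k. g * k mod q) {..<q} {..<q}"
    by (metis bij_betw_imageI card_image card_subset_eq finite_lessThan)
  have "ch g * (\<Sum>k<q. ch k) = (\<Sum>k<q. ch (g * k mod q))"
    by (simp add: sum_distrib_left mult periodic_mod[of ch q, OF periodic])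
  also have "\<dots> = (\<Sum>k<q. ch k)" by (rule sum.reindex_bij_betw[OF bij])
  finally show ?thesis .
qed

lemma principal:
  assumes "(\<Sum>k<q. ch k) \<noteq> 0" "coprime g q"
  shows "ch g = 1"
  using sum_shift[OF assms(2)] assms(1) by simp

lemma convolution_inverse: "n > 0 \<Longrightarrow>
    (\<Sum>d | d dvd n. ch d * (of_int (moebius_mu (n div d)) * ch (n div d))) = (if n = 1 then 1 else 0)"
proof -
  assume n: "n > 0"
  have "(\<Sum>d | d dvd n. ch d * (of_int (moebius_mu (n div d)) * ch (n div d))) =
      (\<Sum>d | d dvd n. ch n * of_int (moebius_mu (n div d)))"
    using n by (intro sum.cong refl) (auto simp: mult elim!: dvdE)
  also have "\<dots> = (\<Sum>d | d dvd n. ch n * of_int (moebius_mu d))"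
    by (rule sum.reindex_bij_witness[of _ "\<lambda>d. n div d" "\<lambda>d. n div d"]) (use n in auto)
  also have "\<dots> = ch n * of_int (\<Sum>d | d dvd n. moebius_mu d)" by (simp add: sum_distrib_left)
  also have "\<dots> = (if n = 1 then 1 else 0)" using n by (simp add: sum_moebius_mu chi_1)
  finally show ?thesis .
qed

lemma convolution_ln: "n > 0 \<Longrightarrow>
    ch n * of_real (ln (real n)) = (\<Sum>d | d dvd n. mangoldt d * ch d * ch (n div d))"
proof -
  assume n: "n > 0"
  have "(\<Sum>d | d dvd n. mangoldt d * ch d * ch (n div d)) = (\<Sum>d | d dvd n. ch n * mangoldt d)"
    using n by (intro sum.cong refl) (auto simp: mult elim!: dvdE)
  also have "\<dots> = ch n * of_real (ln (real n))"
    using mangoldt_sum[of n, where 'a = complex] n by (simp add: sum_distrib_left[symmetric])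
  finally show ?thesis ..
qed

abbreviation "L \<equiv> dseries ch"

abbreviation "mu_series \<equiv> dseries (\<lambda>n. of_int (moebius_mu n) * ch n)"

abbreviation "mangoldt_series \<equiv> dseries (\<lambda>n. mangoldt n * ch n)"

lemma norm_mu_chi_le_1: "cmod (of_int (moebius_mu n) * ch n) \<le> 1"
proof -
  show ?thesis
    using norm_le_1[of n] norm_moebius_mu_le_1[of n] by (simp add: norm_mult mult_le_one)
qed

lemma norm_mangoldt_chi_le: "cmod (mangoldt n * ch n) \<le> 1 * ln (real n)"
proof (cases "n = 0")
  case False
  then have "cmod (mangoldt n * ch n) \<le> ln (real n) * 1"
    unfolding norm_mult norm_mangoldt using norm_le_1[of n] mangoldt_le[of n] mangoldt_nonneg
    by (intro mult_mono) (auto intro: order.trans[OF mangoldt_nonneg])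
  then show ?thesis by simp
qed simp

lemma L_mu_series:
  assumes s: "Re s > 1"
  shows "L s * mu_series s = 1"
proof -
  let ?c = "\<lambda>n. if n = 1 then 1 else (0::complex)"
  have "dseries ?c s = L s * mu_series s"
    using s convolution_inverse norm_le_1 norm_mu_chi_le_1
    by (intro dseries_mult summable_norm_dseries[where C = 1]) auto
  moreover have "dseries ?c s = 1"
  proof -
    have "(\<lambda>n. ?c n * of_nat n powr - s) sums (\<Sum>n\<in>{1}. ?c n * of_nat n powr - s)"
      by (rule sums_finite) auto
    then show ?thesis by (simp add: dseries_def sums_iff)
  qed
  ultimately show ?thesis by simp
qed

lemma L_nonzero: "Re s > 1 \<Longrightarrow> L s \<noteq> 0"
  using L_mu_series by fastforce

lemma L_derivative:
  assumes s: "Re s > 1"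
  shows "(L has_field_derivative - (mangoldt_series s * L s)) (at s)"
proof -
  have "dseries (\<lambda>n. ch n * of_real (ln (real n))) s = mangoldt_series s * L s"
    using s convolution_ln norm_le_1 norm_mangoldt_chi_le
    by (intro dseries_mult summable_norm_dseries[where C = 1] summable_norm_dseries_ln[where C = 1]) auto
  with dseries_derivative[where a = ch, OF norm_le_1 s] show ?thesis by simp
qed

end

subsection \<open>The order of vanishing from the logarithmic derivative\<close>

text \<open>Near \<open>s0\<close> the function \<open>h\<close> is \<open>(s - s0) ^ k\<close> times a function without zeros, so that its
  logarithmic derivative is \<open>k / (s - s0)\<close> up to a holomorphic function.\<close>

lemma log_derivative_limit:
  fixes h :: "complex \<Rightarrow> complex"
  assumes h: "h holomorphic_on U" "open U" "connected U" and s0: "s0 \<in> U"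
    and nz: "z \<in> U" "h z \<noteq> 0"
  obtains k :: nat where "k = 0 \<longleftrightarrow> h s0 \<noteq> 0"
    "((\<lambda>x. of_real x * deriv h (s0 + of_real x) / h (s0 + of_real x)) \<longlongrightarrow> of_nat k) (at_right 0)"
proof -
  have lim0: "((\<lambda>x. s0 + of_real x) \<longlongrightarrow> s0) (at_right 0)"
    by (auto intro!: tendsto_eq_intros)
  have quot: "((\<lambda>x. of_real x * deriv g (s0 + of_real x) / g (s0 + of_real x)) \<longlongrightarrow> 0) (at_right 0)"
    if g: "g holomorphic_on V" "open V" "s0 \<in> V" "g s0 \<noteq> 0" for g :: "complex \<Rightarrow> complex" and V
  proof -
    have "isCont (deriv g) s0" "isCont g s0"
      using g holomorphic_deriv[OF g(1,2)] holomorphic_on_imp_continuous_on continuous_on_eq_continuous_at by blast+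
    then have "((\<lambda>x. deriv g (s0 + of_real x)) \<longlongrightarrow> deriv g s0) (at_right 0)"
      "((\<lambda>x. g (s0 + of_real x)) \<longlongrightarrow> g s0) (at_right 0)"
      using lim0 by (auto intro: isCont_tendsto_compose)
    then have "((\<lambda>x. of_real x * deriv g (s0 + of_real x) / g (s0 + of_real x)) \<longlongrightarrow> of_real 0 * deriv g s0 / g s0) (at_right 0)"
      using g(4) by (intro tendsto_intros)
    then show ?thesis by simp
  qed
  show ?thesis
  proof (cases "h s0 = 0")
    case False
    then show ?thesis using quot[OF h(1,2) s0] by (intro that[of 0]) auto
  next
    case True
    have nc: "\<not> h constant_on U" using True s0 nz by (metis constant_on_def)
    obtain g r k where grk: "0 < k" "0 < r" "ball s0 r \<subseteq> U" "g holomorphic_on ball s0 r"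
      "\<And>w. w \<in> ball s0 r \<Longrightarrow> h w = (w - s0) ^ k * g w" "\<And>w. w \<in> ball s0 r \<Longrightarrow> g w \<noteq> 0"
      using holomorphic_factor_zero_nonconstant[OF h s0 True nc] by metis
    have ev: "\<forall>\<^sub>F x in at_right 0. of_real x * deriv h (s0 + of_real x) / h (s0 + of_real x) =
        of_nat k + of_real x * deriv g (s0 + of_real x) / g (s0 + of_real x)"
    proof (rule eventually_at_rightI[of 0 r])
      fix x :: real assume x: "x \<in> {0<..<r}"
      let ?w = "s0 + of_real x"
      have w: "?w \<in> ball s0 r" using x by (simp add: dist_norm)
      have "(g has_field_derivative deriv g ?w) (at ?w)"
        using holomorphic_derivI[OF grk(4) open_ball w] .
      then have "((\<lambda>w. (w - s0) ^ k * g w) has_field_derivative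
          of_nat k * (?w - s0) ^ (k - 1) * g ?w + (?w - s0) ^ k * deriv g ?w) (at ?w)"
        by (auto intro!: derivative_eq_intros)
      then have "(h has_field_derivative
          of_nat k * (?w - s0) ^ (k - 1) * g ?w + (?w - s0) ^ k * deriv g ?w) (at ?w)"
        by (rule has_field_derivative_transform_within_open[OF _ open_ball w]) (simp add: grk(5))
      then have "deriv h ?w = of_nat k * of_real x ^ (k - 1) * g ?w + of_real x ^ k * deriv g ?w"
        by (simp add: DERIV_imp_deriv)
      moreover have "h ?w = of_real x ^ k * g ?w" using grk(5)[OF w] by simp
      moreover have "of_real x * of_real x ^ (k - 1) = (of_real x ^ k :: complex)"
        using grk(1) by (simp add: power_eq_if)
      ultimately show "of_real x * deriv h ?w / h ?w = of_nat k + of_real x * deriv g ?w / g ?w"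
        using x grk(6)[OF w] by (simp add: field_simps)
    qed (use grk in auto)
    have "((\<lambda>x. of_nat k + of_real x * deriv g (s0 + of_real x) / g (s0 + of_real x)) \<longlongrightarrow> of_nat k + 0) (at_right 0)"
      using grk by (intro tendsto_intros quot[of g "ball s0 r"]) auto
    then have "((\<lambda>x. of_real x * deriv h (s0 + of_real x) / h (s0 + of_real x)) \<longlongrightarrow> of_nat k) (at_right 0)"
      by (subst tendsto_cong[OF ev]) simp
    with True grk(1) show ?thesis by (intro that[of k]) auto
  qed
qed

context dirichlet_char
begin

text \<open>The series of \<open>mangoldt n * ch n\<close> is \<open>- L' / L\<close>, which is \<open>j / (s - 1) - V' / V\<close>. It thus detects
  the pole of \<open>L\<close> at \<open>1\<close> and the zeros of \<open>V\<close>. The exponent \<open>j\<close> is \<open>1\<close> for a continuation that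
  removes a possible pole, and \<open>0\<close> for a continuation of \<open>L\<close> itself.\<close>

lemma mangoldt_series_limit:
  assumes V: "V holomorphic_on {s. Re s > 0}" "\<And>s. Re s > 1 \<Longrightarrow> V s = (s - 1) ^ j * L s"
  obtains k :: nat where "k = 0 \<longleftrightarrow> V (1 + \<i> * of_real t) \<noteq> 0"
    "((\<lambda>x. of_real x * mangoldt_series (1 + \<i> * of_real t + of_real x)) \<longlongrightarrow>
       of_nat (if t = 0 then j else 0) - of_nat k) (at_right 0)"
proof -
  let ?s0 = "1 + \<i> * complex_of_real t"
  have nz: "V 2 \<noteq> 0" using V(2)[of 2] L_nonzero[of 2] by simp
  obtain k :: nat where k: "k = 0 \<longleftrightarrow> V ?s0 \<noteq> 0"
    "((\<lambda>x. of_real x * deriv V (?s0 + of_real x) / V (?s0 + of_real x)) \<longlongrightarrow> of_nat k) (at_right 0)"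
    by (rule log_derivative_limit[OF V(1), of ?s0 2])
       (use nz in \<open>auto simp: open_halfspace_Re_gt intro!: convex_connected convex_halfspace_Re_gt\<close>)
  have eq: "of_real x * mangoldt_series (?s0 + of_real x) =
      of_nat j * (of_real x / (\<i> * of_real t + of_real x)) - of_real x * deriv V (?s0 + of_real x) / V (?s0 + of_real x)"
    if x: "x > 0" for x
  proof -
    let ?s = "?s0 + of_real x"
    have s: "Re ?s > 1" using x by simp
    have s1: "?s - 1 \<noteq> 0" using s by (auto simp: complex_eq_iff)
    have "((\<lambda>s. (s - 1) ^ j * L s) has_field_derivative
        of_nat j * (?s - 1) ^ (j - 1) * L ?s + (?s - 1) ^ j * (- (mangoldt_series ?s * L ?s))) (at ?s)"
      by (rule derivative_eq_intros L_derivative[OF s] refl)+ simp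
    then have "(V has_field_derivative
        of_nat j * (?s - 1) ^ (j - 1) * L ?s + (?s - 1) ^ j * (- (mangoldt_series ?s * L ?s))) (at ?s)"
      by (rule has_field_derivative_transform_within_open[of _ _ _ "{s. Re s > 1}"])
         (use s in \<open>auto simp: open_halfspace_Re_gt V(2)\<close>)
    then have dV: "deriv V ?s = of_nat j * (?s - 1) ^ (j - 1) * L ?s + (?s - 1) ^ j * (- (mangoldt_series ?s * L ?s))"
      by (rule DERIV_imp_deriv)
    have alg: "of_nat j * d ^ (j - 1) * l + d ^ j * (- (B * l)) = (d ^ j * l) * (of_nat j / d - B)"
      if "d \<noteq> 0" for d l B :: complex
      using that by (cases j) (simp_all add: field_simps)
    have "deriv V ?s = V ?s * (of_nat j / (?s - 1) - mangoldt_series ?s)"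
      unfolding dV V(2)[OF s] by (rule alg[OF s1])
    moreover have "V ?s \<noteq> 0" using V(2)[OF s] s1 L_nonzero[OF s] by simp
    ultimately have "deriv V ?s / V ?s = of_nat j / (?s - 1) - mangoldt_series ?s" by simp
    then have "mangoldt_series ?s = of_nat j / (?s - 1) - deriv V ?s / V ?s" by simp
    then have "of_real x * mangoldt_series ?s = of_real x * (of_nat j / (?s - 1)) - of_real x * (deriv V ?s / V ?s)"
      by (simp add: right_diff_distrib)
    then show ?thesis by (simp add: mult.commute)
  qed
  have "((\<lambda>x. of_real x / (\<i> * of_real t + of_real x)) \<longlongrightarrow> (if t = 0 then 1 else 0 :: complex)) (at_right 0)"
  proof (cases "t = 0")
    case True
    have "\<forall>\<^sub>F x in at_right 0. (1::complex) = of_real x / (\<i> * of_real t + of_real x)"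
      by (rule eventually_at_rightI[of 0 1]) (auto simp: True)
    then have "((\<lambda>x. of_real x / (\<i> * of_real t + of_real x)) \<longlongrightarrow> (1::complex)) (at_right 0)"
      by (rule Lim_transform_eventually[OF tendsto_const])
    then show ?thesis using True by simp
  next
    case False
    have "((\<lambda>x. of_real x / (\<i> * of_real t + of_real x)) \<longlongrightarrow> of_real 0 / (\<i> * of_real t + of_real 0)) (at_right 0)"
      using False by (intro tendsto_intros) auto
    then show ?thesis using False by simp
  qed
  then have "((\<lambda>x. of_nat j * (of_real x / (\<i> * of_real t + of_real x)) -
      of_real x * deriv V (?s0 + of_real x) / V (?s0 + of_real x)) \<longlongrightarrow> of_nat j * (if t = 0 then 1 else 0) - of_nat k) (at_right 0)"
    by (intro tendsto_intros k(2))
  moreover have "\<forall>\<^sub>F x in at_right 0. of_nat j * (of_real x / (\<i> * of_real t + of_real x)) -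
      of_real x * deriv V (?s0 + of_real x) / V (?s0 + of_real x) = of_real x * mangoldt_series (?s0 + of_real x)"
    by (rule eventually_at_rightI[of 0 1]) (auto simp: eq)
  ultimately have "((\<lambda>x. of_real x * mangoldt_series (?s0 + of_real x)) \<longlongrightarrow>
      of_nat j * (if t = 0 then 1 else 0) - of_nat k) (at_right 0)"
    by (rule Lim_transform_eventually)
  then show ?thesis using that[OF k(1)] by (simp split: if_splits)
qed

end

lemma trivial_char: "dirichlet_char (\<lambda>_. 1) 1"
  by unfold_locales auto

context dirichlet_char
begin

text \<open>For \<open>w\<close> on the unit circle the real part of \<open>3 + 4 * w + w\<^sup>2\<close> is \<open>2 * (1 + Re w)\<^sup>2\<close>, and
  \<open>w = ch n * n powr - (\<i> * t)\<close> lies on this circle unless it is zero.\<close>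

lemma three_four_one:
  assumes x: "x > 0"
  shows "0 \<le> Re (3 * dseries (\<lambda>n. mangoldt n * 1) (1 + of_real x) + 4 * mangoldt_series (1 + \<i> * of_real t + of_real x) +
    dseries (\<lambda>n. mangoldt n * ch n ^ 2) (1 + \<i> * of_real (2 * t) + of_real x))"
proof -
  interpret triv: dirichlet_char "\<lambda>_. 1" 1 by (rule trivial_char)
  interpret sq: dirichlet_char "\<lambda>n. ch n ^ 2" q by (rule square)
  let ?s0 = "1 + complex_of_real x" and ?s1 = "1 + \<i> * of_real t + complex_of_real x"
    and ?s2 = "1 + \<i> * of_real (2 * t) + complex_of_real x"
  have s: "Re ?s0 > 1" "Re ?s1 > 1" "Re ?s2 > 1" using x by auto
  have "(\<lambda>n. 3 * (mangoldt n * 1 * of_nat n powr - ?s0) + 4 * (mangoldt n * ch n * of_nat n powr - ?s1) +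
      mangoldt n * ch n ^ 2 * of_nat n powr - ?s2) sums
      (3 * dseries (\<lambda>n. mangoldt n * 1) ?s0 + 4 * mangoldt_series ?s1 + dseries (\<lambda>n. mangoldt n * ch n ^ 2) ?s2)"
    using s triv.norm_mangoldt_chi_le norm_mangoldt_chi_le sq.norm_mangoldt_chi_le
    by (intro sums_add sums_mult dseries_sums summable_norm_dseries_ln[where C = 1])
  then have "(\<lambda>n. Re (3 * (mangoldt n * 1 * of_nat n powr - ?s0) + 4 * (mangoldt n * ch n * of_nat n powr - ?s1) +
      mangoldt n * ch n ^ 2 * of_nat n powr - ?s2)) sums
      Re (3 * dseries (\<lambda>n. mangoldt n * 1) ?s0 + 4 * mangoldt_series ?s1 + dseries (\<lambda>n. mangoldt n * ch n ^ 2) ?s2)"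
    by (rule sums_Re)
  moreover have "0 \<le> Re (3 * (mangoldt n * 1 * of_nat n powr - ?s0) + 4 * (mangoldt n * ch n * of_nat n powr - ?s1) +
      mangoldt n * ch n ^ 2 * of_nat n powr - ?s2)" for n
  proof (cases "n = 0")
    case False
    define w where "w = ch n * of_nat n powr - (\<i> * of_real t)"
    have p0: "(of_nat n :: complex) powr - ?s0 = of_real (real n powr - (1 + x))"
      using powr_of_real[of "real n" "- (1 + x)"] by simp
    have "(of_nat n :: complex) powr - ?s1 = of_nat n powr - ?s0 * of_nat n powr - (\<i> * of_real t)"
      by (simp add: powr_add[symmetric] algebra_simps)
    then have 1: "ch n * of_nat n powr - ?s1 = of_real (real n powr - (1 + x)) * w"
      unfolding p0 w_def by simp
    have "(of_nat n :: complex) powr - ?s2 = of_nat n powr - ?s0 * (of_nat n powr - (\<i> * of_real t) * of_nat n powr - (\<i> * of_real t))"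
      by (simp add: powr_add[symmetric] algebra_simps)
    then have 2: "ch n ^ 2 * of_nat n powr - ?s2 = of_real (real n powr - (1 + x)) * w ^ 2"
      unfolding p0 w_def by (simp add: power2_eq_square)
    have m: "mangoldt n = complex_of_real (mangoldt n)" by simp
    have "3 * (mangoldt n * 1 * of_nat n powr - ?s0) + 4 * (mangoldt n * ch n * of_nat n powr - ?s1) +
      mangoldt n * ch n ^ 2 * of_nat n powr - ?s2 = of_real (mangoldt n * real n powr - (1 + x)) * (3 + 4 * w + w ^ 2)"
      unfolding mult.assoc 1 2 p0 by (subst (1 2 3) m) (simp add: algebra_simps del: of_real_mangoldt)
    moreover have "0 \<le> Re (3 + 4 * w + w ^ 2)"
    proof -
      have nw: "cmod w = cmod (ch n)" using False by (simp add: w_def norm_mult norm_of_nat_powr)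
      show ?thesis
      proof (cases "coprime n q")
        case True
        then have "(Re w)\<^sup>2 + (Im w)\<^sup>2 = 1" using nw norm_eq_1 by (metis cmod_power2 one_power2)
        then have "Re (3 + 4 * w + w ^ 2) = 2 * (1 + Re w)\<^sup>2"
          by (simp add: power2_eq_square algebra_simps)
        then show ?thesis by simp
      next
        case False
        then have "w = 0" using eq_0_iff by (simp add: w_def)
        then show ?thesis by simp
      qed
    qed
    moreover have "0 \<le> mangoldt n * real n powr - (1 + x)" by (intro mult_nonneg_nonneg mangoldt_nonneg) auto
    ultimately show ?thesis by simp
  qed simp
  ultimately show ?thesis using sums_le[OF _ sums_zero] by (metis (no_types, lifting))
qed

text \<open>If \<open>L\<close> vanished at \<open>1 + i t\<close>, then the logarithmic derivatives of
  the zeta function, of \<open>L\<close> and of the L-function of \<open>ch\<^sup>2\<close> at the points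
  \<open>1 + x\<close>, \<open>1 + x + i t\<close> and \<open>1 + x + 2 i t\<close> would violate \<open>three_four_one\<close>
  as \<open>x\<close> tends to \<open>0\<close>, unless the third function has a pole there.\<close>

lemma nonvanishing_no_pole:
  assumes V: "V holomorphic_on {s. Re s > 0}" "\<And>s. Re s > 1 \<Longrightarrow> V s = (s - 1) ^ j * L s"
    and t: "t \<noteq> 0 \<or> (j = 0 \<and> (\<Sum>k<q. ch k ^ 2) = 0)"
  shows "V (1 + \<i> * of_real t) \<noteq> 0"
proof -
  interpret triv: dirichlet_char "\<lambda>_. 1" 1 by (rule trivial_char)
  interpret sq: dirichlet_char "\<lambda>n. ch n ^ 2" q by (rule square)
  obtain Z where Z: "Z holomorphic_on {s. Re s > 0}" "Z 1 = 1"
    "\<And>s. Re s > 1 \<Longrightarrow> Z s = (s - 1) * dseries (\<lambda>_. 1) s" using zeta_continuation by metis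
  obtain k0 :: nat where k0: "k0 = 0 \<longleftrightarrow> Z (1 + \<i> * of_real 0) \<noteq> 0"
    "((\<lambda>x. of_real x * triv.mangoldt_series (1 + \<i> * of_real 0 + of_real x)) \<longlongrightarrow>
       of_nat (if (0::real) = 0 then 1 else 0) - of_nat k0) (at_right 0)"
    by (rule triv.mangoldt_series_limit[of Z 1 0]) (auto simp: Z)
  have l0: "((\<lambda>x. of_real x * triv.mangoldt_series (1 + of_real x)) \<longlongrightarrow> 1) (at_right 0)"
    using k0 Z(2) by simp
  obtain k1 :: nat where k1: "k1 = 0 \<longleftrightarrow> V (1 + \<i> * of_real t) \<noteq> 0"
    "((\<lambda>x. of_real x * mangoldt_series (1 + \<i> * of_real t + of_real x)) \<longlongrightarrow>
       of_nat (if t = 0 then j else 0) - of_nat k1) (at_right 0)"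
    by (rule mangoldt_series_limit[OF V]) auto
  have l1: "((\<lambda>x. of_real x * mangoldt_series (1 + \<i> * of_real t + of_real x)) \<longlongrightarrow> - of_nat k1) (at_right 0)"
    using k1(2) t by (auto split: if_splits)
  obtain k2 :: nat where l2: "((\<lambda>x. of_real x * sq.mangoldt_series (1 + \<i> * of_real (2 * t) + of_real x)) \<longlongrightarrow>
      - of_nat k2) (at_right 0)"
  proof (cases "t = 0")
    case True
    then have z: "(\<Sum>k<q. ch k ^ 2) = 0" using t by simp
    obtain H where H: "H holomorphic_on {s. Re s > 0}" "\<And>s. Re s > 1 \<Longrightarrow> H s = sq.L s"
      using dseries_continuation_mean_zero[of "\<lambda>n. ch n ^ 2" q, OF sq.periodic modulus_pos z] by metis
    show ?thesis
      by (rule sq.mangoldt_series_limit[of H 0 "2 * t"]) (use H that in auto)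
  next
    case False
    obtain W where W: "W holomorphic_on {s. Re s > 0}" "\<And>s. Re s > 1 \<Longrightarrow> W s = (s - 1) * sq.L s"
      using dseries_continuation[of "\<lambda>n. ch n ^ 2" q, OF sq.periodic modulus_pos] by metis
    show ?thesis
      by (rule sq.mangoldt_series_limit[of W 1 "2 * t"]) (use W that False in auto)
  qed
  have "((\<lambda>x. Re (3 * (of_real x * triv.mangoldt_series (1 + of_real x)) +
      4 * (of_real x * mangoldt_series (1 + \<i> * of_real t + of_real x)) +
      of_real x * sq.mangoldt_series (1 + \<i> * of_real (2 * t) + of_real x)))
      \<longlongrightarrow> Re (3 * 1 + 4 * (- of_nat k1) + - of_nat k2)) (at_right 0)"
    by (intro tendsto_intros l0 l1 l2)
  moreover have "\<forall>\<^sub>F x in at_right 0. 0 \<le> Re (3 * (of_real x * triv.mangoldt_series (1 + of_real x)) +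
      4 * (of_real x * mangoldt_series (1 + \<i> * of_real t + of_real x)) +
      of_real x * sq.mangoldt_series (1 + \<i> * of_real (2 * t) + of_real x))"
  proof (rule eventually_at_rightI[of 0 1])
    fix x :: real assume "x \<in> {0<..<1}"
    then have x: "x > 0" by simp
    let ?A = "3 * triv.mangoldt_series (1 + of_real x) + 4 * mangoldt_series (1 + \<i> * of_real t + of_real x) +
      sq.mangoldt_series (1 + \<i> * of_real (2 * t) + of_real x)"
    have "0 \<le> x * Re ?A" using three_four_one[OF x, of t] x by (intro mult_nonneg_nonneg) auto
    also have "\<dots> = Re (of_real x * ?A)" by (simp del: plus_complex.sel)
    also have "of_real x * ?A = 3 * (of_real x * triv.mangoldt_series (1 + of_real x)) +
      4 * (of_real x * mangoldt_series (1 + \<i> * of_real t + of_real x)) +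
      of_real x * sq.mangoldt_series (1 + \<i> * of_real (2 * t) + of_real x)" by (simp add: algebra_simps)
    finally show "0 \<le> Re (3 * (of_real x * triv.mangoldt_series (1 + of_real x)) +
      4 * (of_real x * mangoldt_series (1 + \<i> * of_real t + of_real x)) +
      of_real x * sq.mangoldt_series (1 + \<i> * of_real (2 * t) + of_real x))" .
  qed simp
  ultimately have "0 \<le> Re (3 * 1 + 4 * (- of_nat k1) + - of_nat k2 :: complex)"
    by (intro tendsto_lowerbound) auto
  then have "4 * real k1 + real k2 \<le> 3" by simp
  then have "k1 = 0" by (cases k1) auto
  then show ?thesis using k1(1) by simp
qed

end

subsection \<open>Real characters at s = 1\<close>

text \<open>The arithmetic-geometric mean inequality for the terms \<open>i\<close> and \<open>n - 1 - i\<close>.\<close>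

lemma geometric_sum_ge:
  fixes x :: real
  assumes "0 < x"
  shows "real n * sqrt (x ^ (n - 1)) \<le> (\<Sum>i<n. x ^ i)"
proof -
  have "2 * (\<Sum>i<n. x ^ i) = (\<Sum>i<n. x ^ i) + (\<Sum>i<n. x ^ (n - Suc i))"
    by (subst sum.nat_diff_reindex) simp
  also have "\<dots> = (\<Sum>i<n. x ^ i + x ^ (n - Suc i))" by (simp add: sum.distrib)
  also have "\<dots> \<ge> (\<Sum>i<n. 2 * sqrt (x ^ (n - 1)))"
  proof (rule sum_mono)
    fix i assume "i \<in> {..<n}"
    then have "x ^ i * x ^ (n - Suc i) = x ^ (n - 1)" by (simp add: power_add[symmetric])
    then show "2 * sqrt (x ^ (n - 1)) \<le> x ^ i + x ^ (n - Suc i)"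
      using arith_geo_mean_sqrt[of "x ^ i" "x ^ (n - Suc i)"] assms by simp
  qed
  finally show ?thesis by simp
qed

text \<open>In terms of the geometric sums \<open>G\<close> the claim is \<open>n * (n + 1) * x ^ n \<le> G n * G (n + 1)\<close>, the
  product of two instances of \<open>geometric_sum_ge\<close>.\<close>

lemma lambert_difference_decreasing:
  fixes x :: real
  assumes x: "0 < x" "x < 1" and n: "n > 0"
  defines "b \<equiv> \<lambda>n. 1 / (real n * (1 - x)) - x ^ n / (1 - x ^ n)"
  shows "b (Suc n) \<le> b n"
proof -
  define G where "G = (\<lambda>n. \<Sum>i<n. x ^ i)"
  have xp: "0 < 1 - x" using x by simp
  have G: "1 - x ^ k = (1 - x) * G k" for k
    unfolding G_def by (rule one_diff_power_eq)
  have Gpos: "G k > 0" if "k > 0" for k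
    unfolding G_def using that x by (intro sum_pos) auto
  have "real n * real (Suc n) * x ^ n = real n * real (Suc n) * (sqrt (x ^ n) * sqrt (x ^ n))" using x by simp
  also have "\<dots> \<le> real n * real (Suc n) * (sqrt (x ^ (n - 1)) * sqrt (x ^ n))"
    using x by (intro mult_left_mono mult_right_mono real_sqrt_le_mono power_decreasing) auto
  also have "\<dots> = (real n * sqrt (x ^ (n - 1))) * (real (Suc n) * sqrt (x ^ (Suc n - 1)))" by simp
  also have "\<dots> \<le> G n * G (Suc n)"
    unfolding G_def using x by (intro mult_mono geometric_sum_ge sum_nonneg) auto
  finally have key: "real n * real (Suc n) * x ^ n \<le> G n * G (Suc n)" .
  have "x ^ n / (1 - x ^ n) - x ^ Suc n / (1 - x ^ Suc n) = x ^ n / ((1 - x) * (G n * G (Suc n)))"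
  proof -
    have 1: "x ^ n * (1 - x ^ Suc n) - x ^ Suc n * (1 - x ^ n) = x ^ n * (1 - x)" by (simp add: algebra_simps)
    have "1 - x ^ n \<noteq> 0" "1 - x ^ Suc n \<noteq> 0" unfolding G using Gpos[of n] Gpos[of "Suc n"] n xp by auto
    then have "x ^ n / (1 - x ^ n) - x ^ Suc n / (1 - x ^ Suc n) =
        (x ^ n * (1 - x ^ Suc n) - x ^ Suc n * (1 - x ^ n)) / ((1 - x ^ n) * (1 - x ^ Suc n))"
      by (rule diff_frac_eq)
    then show ?thesis unfolding 1 unfolding G using xp by simp
  qed
  also have "\<dots> \<le> 1 / (real n * (1 - x)) - 1 / (real (Suc n) * (1 - x))"
  proof -
    have "x ^ n / (G n * G (Suc n)) \<le> 1 / (real n * real (Suc n))"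
      using key Gpos[of n] Gpos[of "Suc n"] n by (simp add: divide_simps mult_ac del: of_nat_Suc)
    then have "x ^ n / (G n * G (Suc n)) / (1 - x) \<le> 1 / (real n * real (Suc n)) / (1 - x)"
      using xp by (intro divide_right_mono) auto
    also have "1 / (real n * real (Suc n)) = 1 / real n - 1 / real (Suc n)"
      using n by (simp add: field_simps)
    finally show ?thesis by (simp add: diff_divide_distrib mult.commute)
  qed
  finally show ?thesis unfolding b_def by simp
qed

context dirichlet_char
begin

text \<open>By multiplicativity the divisor sum is a product over prime powers \<open>p ^ k\<close>, with factor \<open>1\<close>,
  \<open>k + 1\<close>, or alternately \<open>1\<close> and \<open>0\<close> according to the value at \<open>p\<close>. At a square all exponents are
  even.\<close>

lemma real_divisor_sum_nonneg:
  fixes c :: "nat \<Rightarrow> real"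
  assumes c: "\<And>n. c n \<in> {-1, 0, 1}" "\<And>m n. c (m * n) = c m * c n" "c 1 = 1"
  shows "n > 0 \<Longrightarrow> 0 \<le> (\<Sum>d | d dvd n. c d) \<and> ((\<exists>s. n = s ^ 2) \<longrightarrow> 1 \<le> (\<Sum>d | d dvd n. c d))"
proof (induction n rule: less_induct)
  case (less n)
  show ?case
  proof (cases "n = 1")
    case True
    then show ?thesis using c by simp
  next
    case False
    with less.prems have "n > 1" by simp
    then obtain p k m where pkm: "prime p" "k > 0" "\<not> p dvd m" "m > 0" "m < n" "n = p ^ k * m"
      by (rule prime_power_split)
    have cp: "c (p ^ i) = c p ^ i" for i by (induction i) (use c in auto)
    have r: "(\<Sum>d | d dvd n. c d) = (\<Sum>i\<le>k. c p ^ i) * (\<Sum>d | d dvd m. c d)"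
      unfolding pkm(6) sum_divisors_prime_power_mult[OF pkm(1,3,4)] c(2) cp by (rule sum_product[symmetric])
    have geo: "0 \<le> (\<Sum>i\<le>j. (-1::real) ^ i) \<and> (even j \<longrightarrow> (\<Sum>i\<le>j. (-1::real) ^ i) = 1) \<and> (odd j \<longrightarrow> (\<Sum>i\<le>j. (-1::real) ^ i) = 0)" for j
      by (induction j) auto
    have s: "0 \<le> (\<Sum>i\<le>k. c p ^ i) \<and> (even k \<longrightarrow> 1 \<le> (\<Sum>i\<le>k. c p ^ i))"
    proof -
      consider "c p = 0" | "c p = 1" | "c p = -1" using c(1)[of p] by auto
      then show ?thesis
      proof cases
        case 1
        have "(\<Sum>i\<le>k. (0::real) ^ i) = (\<Sum>i\<in>{0}. 0 ^ i)" by (rule sum.mono_neutral_right) auto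
        then show ?thesis using 1 by simp
      next
        case 2
        then show ?thesis by simp
      next
        case 3
        then show ?thesis using geo[of k] by simp
      qed
    qed
    have IH: "0 \<le> (\<Sum>d | d dvd m. c d)" "(\<exists>s. m = s ^ 2) \<Longrightarrow> 1 \<le> (\<Sum>d | d dvd m. c d)"
      using less.IH[OF pkm(5,4)] by auto
    show ?thesis
    proof (intro conjI impI)
      show "0 \<le> (\<Sum>d | d dvd n. c d)" unfolding r using s IH by simp
      assume "\<exists>s. n = s ^ 2"
      then obtain t where t: "n = t ^ 2" by blast
      have t0: "t \<noteq> 0" using t less.prems by (auto intro: Nat.gr0I)
      have "\<not> is_unit p" using pkm(1) by auto
      then obtain u where u: "t = p ^ multiplicity p t * u" "\<not> p dvd u"
        using multiplicity_decompose'[OF t0] by blast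
      define j where "j = multiplicity p t"
      have eq: "p ^ k * m = p ^ (2 * j) * u ^ 2"
        using t u(1) pkm(6) by (metis j_def power_mult power_mult_distrib mult.commute)
      have "\<not> p dvd u ^ 2" using u(2) pkm(1) prime_dvd_power by blast
      then have "multiplicity p (p ^ k * m) = k" "multiplicity p (p ^ (2 * j) * u ^ 2) = 2 * j"
        using pkm multiplicity_prime_power_mult by blast+
      then have "k = 2 * j" using eq by simp
      moreover from this have "m = u ^ 2" using eq pkm(1) by auto
      ultimately show "1 \<le> (\<Sum>d | d dvd n. c d)"
        unfolding r using s IH by (auto intro: order.trans[OF _ mult_mono[of 1 _ 1]])
    qed
  qed
qed

text \<open>For a real character the divisor sums \<open>r n\<close> of \<open>ch\<close> are non-negative and at least one at
  squares, so that the Lambert series \<open>\<Sum> ch n * x ^ n / (1 - x ^ n) = \<Sum> r n * x ^ n\<close> is unbounded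
  as \<open>x\<close> tends to one. If \<open>L 1\<close> were zero, then \<open>ch n / (n * (1 - x))\<close> could be subtracted from its
  terms, and summation by parts against the monotone differences would bound it.\<close>

lemma real_nonvanishing:
  assumes z: "(\<Sum>k<q. ch k) = 0" and sq: "(\<Sum>k<q. ch k ^ 2) \<noteq> 0"
    and H: "(\<lambda>n. (\<Sum>k=1..Suc n. ch k) * (1 / of_nat (Suc n) - 1 / of_nat (Suc (Suc n)))) sums H1"
  shows "H1 \<noteq> 0"
proof
  assume H1: "H1 = 0"
  interpret sq: dirichlet_char "\<lambda>n. ch n ^ 2" q by (rule square)
  obtain C where C: "\<And>n. cmod (\<Sum>k=1..n. ch k) \<le> C"
    using periodic_partial_sums_bounded[of ch q, OF periodic modulus_pos z] by blast
  have C0: "C \<ge> 0" using C[of 0] by simp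
  define c where "c = (\<lambda>n. Re (ch n))"
  have chv: "ch n \<in> {-1, 0, 1}" for n
  proof (cases "coprime n q")
    case True
    then have "ch n ^ 2 = 1" by (rule sq.principal[OF sq])
    then show ?thesis by (auto simp: power2_eq_1_iff)
  next
    case False
    then show ?thesis using eq_0_iff by simp
  qed
  have ch: "ch n = of_real (c n)" for n using chv[of n] by (auto simp: c_def)
  have im0: "Im (ch n) = 0" for n using chv[of n] by auto
  have c: "c n \<in> {-1, 0, 1}" "c (m * n) = c m * c n" "c 1 = 1" for m n
    using chv[of n] by (auto simp: c_def im0 mult chi_1)
  define r where "r = (\<lambda>n. \<Sum>d | d dvd n. c d)"
  have r0: "r n \<ge> 0" if "n > 0" for n using real_divisor_sum_nonneg[of c n] c that unfolding r_def by blast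
  have r1: "r (n ^ 2) \<ge> 1" if "n > 0" for n using real_divisor_sum_nonneg[of c "n ^ 2"] c that unfolding r_def by force
  have bound: "(\<Sum>m=1..M. x ^ (m ^ 2)) \<le> C" if x: "0 < x" "x < 1" for x M
  proof -
    define U where "U = (\<lambda>n. x ^ n / (1 - x ^ n))"
    define g where "g = (\<lambda>(d, m). ch d * of_real (x ^ (d * m)))"
    have geo: "summable (\<lambda>n. norm (complex_of_real x ^ n))"
      using x by (simp add: norm_power summable_geometric)
    have geo1: "((\<lambda>n. complex_of_real x ^ n) has_sum (suminf (\<lambda>n. complex_of_real x ^ n))) UNIV"
      using norm_summable_imp_has_sum[OF geo summable_sums[OF summable_norm_cancel[OF geo]]] .
    have geo2: "(\<lambda>n. norm (complex_of_real x ^ n)) summable_on UNIV"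
      using geo by (intro norm_summable_imp_summable_on) simp
    have "(\<lambda>(d, m). complex_of_real x ^ d * complex_of_real x ^ m) summable_on UNIV \<times> UNIV"
      using has_sum_product[OF geo1 geo2 geo1 geo2] by (rule has_sum_imp_summable)
    then have "(\<lambda>p. norm (complex_of_real x ^ fst p * complex_of_real x ^ snd p) * (1 / x)) summable_on UNIV \<times> UNIV"
      by (intro summable_on_cmult_left) (simp add: summable_on_iff_abs_summable_on_complex case_prod_unfold)
    then have maj: "(\<lambda>p. norm (complex_of_real x ^ fst p * complex_of_real x ^ snd p) * (1 / x)) summable_on {1..} \<times> {1..}"
      by (rule summable_on_subset) auto
    have gs: "g summable_on {1..} \<times> {1..}"
    proof (rule abs_summable_summable, rule Infinite_Sum.abs_summable_on_comparison_test'[OF maj])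
      fix p :: "nat \<times> nat" assume "p \<in> {1..} \<times> {1..}"
      then obtain d m where p: "p = (d, m)" "d \<ge> 1" "m \<ge> 1" by auto
      \<comment> \<open>\<open>x ^ (d * m)\<close> is majorized by the product \<open>x ^ d * x ^ m / x\<close>, whose double series converges\<close>
      have "d + m \<le> d * m + 1"
      proof -
        obtain d' m' where "d = Suc d'" "m = Suc m'" using p by (metis Suc_le_D One_nat_def)
        then show ?thesis by simp
      qed
      then have "x ^ (d * m + 1) \<le> x ^ (d + m)" using x by (intro power_decreasing) auto
      then have "x ^ (d * m) \<le> x ^ d * x ^ m * (1 / x)" using x by (simp add: power_add field_simps)
      moreover have "cmod (ch d) * x ^ (d * m) \<le> 1 * x ^ (d * m)" using norm_le_1 x by (intro mult_right_mono) auto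
      ultimately have "cmod (ch d) * x ^ (d * m) \<le> x ^ d * x ^ m * (1 / x)" by linarith
      then show "norm (g p) \<le> norm (complex_of_real x ^ fst p * complex_of_real x ^ snd p) * (1 / x)"
        using x p(1) by (simp add: g_def norm_mult norm_power)
    qed
    then obtain S where S: "(g has_sum S) ({1..} \<times> {1..})" by (auto simp: summable_on_def)
    have "((\<lambda>n. \<Sum>d | d dvd n. g (d, n div d)) has_sum S) {1..}" by (rule has_sum_divisor_pairs[OF S])
    also have "?this \<longleftrightarrow> ((\<lambda>n. complex_of_real (r n * x ^ n)) has_sum S) {1..}"
    proof (rule has_sum_cong)
      fix n :: nat assume "n \<in> {1..}"
      have "(\<Sum>d | d dvd n. g (d, n div d)) = (\<Sum>d | d dvd n. of_real (c d * x ^ n))"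
        by (intro sum.cong refl) (simp add: g_def ch)
      then show "(\<Sum>d | d dvd n. g (d, n div d)) = complex_of_real (r n * x ^ n)"
        by (simp add: r_def sum_distrib_right)
    qed
    finally have "((\<lambda>n. Re (complex_of_real (r n * x ^ n))) has_sum Re S) {1..}" by (rule has_sum_Re)
    then have rs: "((\<lambda>n. r n * x ^ n) has_sum Re S) {1..}" by simp
    have "(\<Sum>m=1..M. x ^ (m ^ 2)) \<le> (\<Sum>m=1..M. r (m ^ 2) * x ^ (m ^ 2))"
    proof (rule sum_mono)
      fix m assume "m \<in> {1..M}"
      then have "1 * x ^ (m ^ 2) \<le> r (m ^ 2) * x ^ (m ^ 2)" using x by (intro mult_right_mono r1) auto
      then show "x ^ (m ^ 2) \<le> r (m ^ 2) * x ^ (m ^ 2)" by simp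
    qed
    also have "\<dots> = (\<Sum>n\<in>(\<lambda>m. m ^ 2) ` {1..M}. r n * x ^ n)"
      by (subst sum.reindex) (auto intro!: inj_onI simp: power2_eq_iff_nonneg)
    also have "\<dots> \<le> Re S"
      using x r0 by (intro finite_sum_le_has_sum[OF rs]) auto
    also have "\<dots> \<le> cmod S" by (rule complex_Re_le_cmod)
    finally have lower: "(\<Sum>m=1..M. x ^ (m ^ 2)) \<le> cmod S" .

    have "((\<lambda>d. ch d * of_real (U d)) has_sum S) {1..}"
    proof (rule has_sum_SigmaD[OF S])
      fix d :: nat assume "d \<in> {1..}"
      then have d: "d > 0" by simp
      have xd: "norm (complex_of_real x ^ d) < 1" using x d by (simp add: norm_power power_less_one_iff)
      have "((\<lambda>m. (complex_of_real x ^ d) ^ m) has_sum (suminf (\<lambda>m. (complex_of_real x ^ d) ^ m))) UNIV"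
        using xd by (intro norm_summable_imp_has_sum summable_sums summable_geometric) (auto simp: norm_power intro!: summable_geometric)
      then have "((\<lambda>m. (complex_of_real x ^ d) ^ m) has_sum (1 / (1 - of_real x ^ d))) UNIV"
        using suminf_geometric[OF xd] by simp
      then have "((\<lambda>m. ch d * of_real x ^ d * (of_real x ^ d) ^ m) has_sum (ch d * of_real x ^ d * (1 / (1 - of_real x ^ d)))) UNIV"
        by (rule has_sum_cmult_right)
      also have "?this \<longleftrightarrow> ((\<lambda>m. g (d, m)) has_sum (ch d * of_real x ^ d * (1 / (1 - of_real x ^ d)))) {1..}"
        by (rule has_sum_reindex_bij_witness[of _ "\<lambda>m. m - 1" Suc]) (auto simp: g_def power_mult)
      finally show "((\<lambda>m. g (d, m)) has_sum (ch d * of_real (U d))) {1..}" by (simp add: U_def)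
    qed
    also have "?this \<longleftrightarrow> ((\<lambda>d. ch d * of_real (U d)) has_sum S) UNIV"
      by (rule has_sum_cong_neutral) (auto simp: U_def not_le)
    finally have "(\<lambda>d. ch d * of_real (U d)) sums S" by (rule has_sum_imp_sums)
    then have chU: "(\<lambda>n. ch (Suc n) * of_real (U (Suc n))) sums S"
      by (subst sums_Suc_iff) (simp add: U_def)

    define b where "b = (\<lambda>n. 1 / (real n * (1 - x)) - x ^ n / (1 - x ^ n))"
    have bdec: "b (Suc (Suc n)) \<le> b (Suc n)" for n
      unfolding b_def by (rule lambert_difference_decreasing[OF x]) simp
    have b1: "b (Suc 0) = 1" using x by (simp add: b_def diff_divide_distrib[symmetric])
    have b0: "b \<longlonglongrightarrow> 0"
    proof -
      have "(\<lambda>n. 1 / (1 - x) * (1 / real n) - x ^ n / (1 - x ^ n)) \<longlonglongrightarrow> 1 / (1 - x) * 0 - 0 / (1 - 0)"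
        using x by (intro tendsto_intros lim_1_over_n LIMSEQ_realpow_zero) auto
      then show ?thesis by (simp add: b_def mult.commute)
    qed
    have tele: "(\<lambda>n. b (Suc n) - b (Suc (Suc n))) sums 1"
      using telescope_sums'[OF LIMSEQ_Suc[OF b0]] b1 by simp
    define v where "v = (\<lambda>n. (\<Sum>k=1..Suc n. ch k) * (complex_of_real (b (Suc n)) - of_real (b (Suc (Suc n)))))"
    have vle: "norm (v n) \<le> C * (b (Suc n) - b (Suc (Suc n)))" for n
    proof -
      have "norm (v n) = cmod (\<Sum>k=1..Suc n. ch k) * \<bar>b (Suc n) - b (Suc (Suc n))\<bar>"
        by (simp only: v_def norm_mult of_real_diff[symmetric] norm_of_real)
      also have "\<dots> \<le> C * \<bar>b (Suc n) - b (Suc (Suc n))\<bar>" by (intro mult_right_mono C) auto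
      finally show ?thesis using bdec[of n] by simp
    qed
    have Ctele: "(\<lambda>n. C * (b (Suc n) - b (Suc (Suc n)))) sums (C * 1)" by (rule sums_mult[OF tele])
    have vs: "summable v" by (rule summable_comparison_test'[OF sums_summable[OF Ctele]]) (rule vle)
    have "norm (suminf v) \<le> suminf (\<lambda>n. C * (b (Suc n) - b (Suc (Suc n))))"
      by (rule norm_suminf_le[OF vle sums_summable[OF Ctele]])
    also have "\<dots> = C" using Ctele by (simp add: sums_iff)
    finally have vb: "norm (suminf v) \<le> C" .
    have "(\<lambda>n. complex_of_real (b n)) \<longlonglongrightarrow> of_real 0" by (intro tendsto_intros b0)
    then have "(\<lambda>n. ch (Suc n) * of_real (b (Suc n))) sums suminf v"
      using summable_sums[OF vs] unfolding v_def
      by (intro abel_summation[OF C, where u = "\<lambda>n. complex_of_real (b n)"]) simp_all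
    moreover have "(\<lambda>n. ch (Suc n) * (1 / of_nat (Suc n))) sums H1"
      using H by (intro abel_summation[OF C, where u = "\<lambda>n. 1 / of_nat n"] lim_1_over_n)
    then have "(\<lambda>n. ch (Suc n) * (1 / of_nat (Suc n)) / of_real (1 - x)) sums (0 / of_real (1 - x))"
      unfolding H1 by (rule sums_divide)
    ultimately have "(\<lambda>n. ch (Suc n) * (1 / of_nat (Suc n)) / of_real (1 - x) - ch (Suc n) * of_real (b (Suc n)))
        sums (0 / of_real (1 - x) - suminf v)" by (intro sums_diff)
    also have "(\<lambda>n. ch (Suc n) * (1 / of_nat (Suc n)) / of_real (1 - x) - ch (Suc n) * of_real (b (Suc n))) =
        (\<lambda>n. ch (Suc n) * of_real (U (Suc n)))"
      by (simp add: fun_eq_iff b_def U_def right_diff_distrib del: of_nat_Suc)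
    finally have "S = - suminf v" using chU sums_unique2 by fastforce
    then show ?thesis using lower vb by simp
  qed
  obtain M :: nat where M: "real M > C" using reals_Archimedean2 by blast
  have "((\<lambda>x::real. \<Sum>m=1..M. x ^ (m ^ 2)) \<longlongrightarrow> (\<Sum>m=1..M. 1 ^ (m ^ 2))) (at_left 1)"
    by (intro tendsto_intros)
  then have "((\<lambda>x::real. \<Sum>m=1..M. x ^ (m ^ 2)) \<longlongrightarrow> real M) (at_left 1)" by simp
  moreover have "\<forall>\<^sub>F x in at_left (1::real). (\<Sum>m=1..M. x ^ (m ^ 2)) \<le> C"
    by (rule eventually_at_leftI[of 0], rule bound) auto
  ultimately have "real M \<le> C" by (intro tendsto_upperbound) auto
  with M show False by simp
qed

text \<open>The reciprocal of \<open>L\<close> is the series of \<open>moebius_mu n * ch n\<close>, and by the non-vanishing results it is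
  continuous up to the line \<open>Re s = 1\<close>.\<close>

lemma moebius_char_mean:
  "(\<lambda>N. 1 / of_nat N * (\<Sum>n=1..N. of_int (moebius_mu n) * ch n)) \<longlonglongrightarrow> 0"
proof -
  have "\<exists>F. continuous_on {s. Re s \<ge> 1} F \<and> (\<forall>s. Re s > 1 \<longrightarrow> F s = mu_series s)"
  proof (cases "(\<Sum>k<q. ch k) = 0")
    case True
    obtain H where H: "H holomorphic_on {s. Re s > 0}" "\<And>s. Re s > 1 \<Longrightarrow> H s = L s"
      "(\<lambda>n. (\<Sum>k=1..Suc n. ch k) * (1 / of_nat (Suc n) - 1 / of_nat (Suc (Suc n)))) sums H 1"
      by (rule dseries_continuation_mean_zero[of ch q, OF periodic modulus_pos True]) blast
    have nz: "H s \<noteq> 0" if "Re s \<ge> 1" for s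
    proof (cases "Re s > 1")
      case True
      then show ?thesis using H(2) L_nonzero by simp
    next
      case False
      then have s: "s = 1 + \<i> * of_real (Im s)" using that by (simp add: complex_eq_iff)
      show ?thesis
      proof (cases "Im s \<noteq> 0 \<or> (\<Sum>k<q. ch k ^ 2) = 0")
        case True
        have "H (1 + \<i> * of_real (Im s)) \<noteq> 0"
          by (rule nonvanishing_no_pole[of H 0]) (use H True in auto)
        then show ?thesis using s by simp
      next
        case False
        then have "H 1 \<noteq> 0" using real_nonvanishing[OF \<open>(\<Sum>k<q. ch k) = 0\<close> _ H(3)] by blast
        then show ?thesis using s False by simp
      qed
    qed
    have "continuous_on {s. Re s \<ge> 1} H"
      using holomorphic_on_imp_continuous_on[OF H(1)] by (rule continuous_on_subset) auto
    then have "continuous_on {s. Re s \<ge> 1} (\<lambda>s. 1 / H s)"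
      using nz by (intro continuous_intros) auto
    moreover have "1 / H s = mu_series s" if "Re s > 1" for s
      using L_mu_series[OF that] L_nonzero[OF that] H(2)[OF that] by (simp add: field_simps)
    ultimately show ?thesis by blast
  next
    case False
    obtain W where W: "W holomorphic_on {s. Re s > 0}" "W 1 = (\<Sum>k<q. ch k) / of_nat q"
      "\<And>s. Re s > 1 \<Longrightarrow> W s = (s - 1) * L s"
      by (rule dseries_continuation[of ch q, OF periodic modulus_pos]) blast
    have nz: "W s \<noteq> 0" if "Re s \<ge> 1" for s
    proof (cases "Re s > 1")
      case True
      then show ?thesis using W(3) L_nonzero by auto
    next
      case False
      then have s: "s = 1 + \<i> * of_real (Im s)" using that by (simp add: complex_eq_iff)
      show ?thesis
      proof (cases "Im s = 0")
        case True
        then have "s = 1" using s by simp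
        then show ?thesis using W(2) \<open>(\<Sum>k<q. ch k) \<noteq> 0\<close> modulus_pos by simp
      next
        case False
        have "W (1 + \<i> * of_real (Im s)) \<noteq> 0"
          by (rule nonvanishing_no_pole[of W 1]) (use W False in auto)
        then show ?thesis using s by simp
      qed
    qed
    have "continuous_on {s. Re s \<ge> 1} W"
      using holomorphic_on_imp_continuous_on[OF W(1)] by (rule continuous_on_subset) auto
    then have "continuous_on {s. Re s \<ge> 1} (\<lambda>s. (s - 1) / W s)"
      using nz by (intro continuous_intros) auto
    moreover have "(s - 1) / W s = mu_series s" if "Re s > 1" for s
    proof -
      have "s \<noteq> 1" using that by auto
      moreover have "mu_series s = 1 / L s"
        using L_mu_series[OF that] L_nonzero[OF that] by (simp add: field_simps)
      ultimately show ?thesis by (simp add: W(3)[OF that])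
    qed
    ultimately show ?thesis by blast
  qed
  then obtain F where F: "continuous_on {s. Re s \<ge> 1} F" "\<And>s. Re s > 1 \<Longrightarrow> F s = mu_series s" by blast
  show ?thesis
  proof (rule mean_zero_of_continuous_dirichlet_series[OF norm_mu_chi_le_1 F(1)])
    show "(\<lambda>n. of_int (moebius_mu n) * ch n * of_nat n powr - s) sums F s" if "Re s > 1" for s
      unfolding F(2)[OF that]
      by (intro dseries_sums summable_norm_dseries[OF norm_mu_chi_le_1 that])
  qed
qed

end


section \<open>Roots of unity\<close>

definition moebius_mean_zero :: "(nat \<Rightarrow> complex) \<Rightarrow> bool" where
  "moebius_mean_zero f \<longleftrightarrow>
     (\<lambda>N. 1 / of_nat N * (\<Sum>n=1..N. of_int (moebius_mu n) * f n)) \<longlonglongrightarrow> 0"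

lemma moebius_mean_zero_cmult:
  assumes "moebius_mean_zero f"
  shows "moebius_mean_zero (\<lambda>n. c * f n)"
proof -
  have "(\<lambda>N. c * (1 / of_nat N * (\<Sum>n=1..N. of_int (moebius_mu n) * f n))) \<longlonglongrightarrow> c * 0"
    using assms unfolding moebius_mean_zero_def by (rule tendsto_mult_left)
  then show ?thesis by (simp add: moebius_mean_zero_def sum_distrib_left mult_ac)
qed

lemma moebius_mean_zero_sum:
  assumes "\<And>j. j \<in> J \<Longrightarrow> moebius_mean_zero (f j)"
  shows "moebius_mean_zero (\<lambda>n. \<Sum>j\<in>J. f j n)"
proof -
  have "(\<lambda>N. \<Sum>j\<in>J. 1 / of_nat N * (\<Sum>n=1..N. of_int (moebius_mu n) * f j n)) \<longlonglongrightarrow> (\<Sum>j\<in>J. 0)"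
    using assms unfolding moebius_mean_zero_def by (intro tendsto_sum)
  also have "(\<lambda>N. \<Sum>j\<in>J. 1 / of_nat N * (\<Sum>n=1..N. of_int (moebius_mu n) * f j n)) =
      (\<lambda>N. 1 / of_nat N * (\<Sum>n=1..N. of_int (moebius_mu n) * (\<Sum>j\<in>J. f j n)))"
    unfolding sum_distrib_left by (subst sum.swap) simp
  finally show ?thesis by (simp add: moebius_mean_zero_def)
qed

lemma periodic_cong:
  fixes \<psi> :: "nat \<Rightarrow> complex"
  assumes "\<And>n. \<psi> (n + q) = \<psi> n" "[m = n] (mod q)"
  shows "\<psi> m = \<psi> n"
  using periodic_mod[of \<psi> q, OF assms(1)] assms(2) by (metis unique_euclidean_semiring_class.cong_def)

text \<open>A joint eigenfunction of the dilations by units is \<open>\<psi> 1\<close> times a Dirichlet character, the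
  character being the eigenvalue.\<close>

lemma moebius_mean_zero_eigenfunction:
  fixes \<psi> :: "nat \<Rightarrow> complex"
  assumes q: "q > 0" and per: "\<And>n. \<psi> (n + q) = \<psi> n"
    and supp: "\<And>n. \<not> coprime n q \<Longrightarrow> \<psi> n = 0"
    and eig: "\<And>g. g < q \<Longrightarrow> coprime g q \<Longrightarrow> \<exists>w. \<forall>n. \<psi> (g * n) = w * \<psi> n"
  shows "moebius_mean_zero \<psi>"
proof -
  have eig': "\<psi> (g * n) * \<psi> 1 = \<psi> g * \<psi> n" if g: "coprime g q" for g n
  proof -
    have "coprime (g mod q) q" using g q by simp
    then obtain w where w: "\<And>n. \<psi> (g mod q * n) = w * \<psi> n" using eig[of "g mod q"] q by auto
    have "\<psi> (g * n) = \<psi> (g mod q * n)"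
      by (rule periodic_cong[of \<psi> q, OF per]) (simp add: unique_euclidean_semiring_class.cong_def mod_mult_left_eq)
    moreover have "\<psi> g = w * \<psi> 1" using w[of 1] periodic_mod[of \<psi> q, OF per] by simp
    ultimately show ?thesis using w[of n] by simp
  qed
  show ?thesis
  proof (cases "\<psi> 1 = 0")
    case True
    have "\<psi> n = 0" for n
    proof (cases "coprime n q")
      case c: True
      then have "\<psi> n * \<psi> n = 0" using eig'[OF c, of n] True by simp
      then show ?thesis by simp
    qed (rule supp)
    then show ?thesis by (simp add: moebius_mean_zero_def)
  next
    case False
    interpret dirichlet_char "\<lambda>n. \<psi> n / \<psi> 1" q
    proof
      show "\<psi> (m * n) / \<psi> 1 = \<psi> m / \<psi> 1 * (\<psi> n / \<psi> 1)" for m n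
      proof (cases "coprime m q")
        case True
        then show ?thesis using eig'[OF True, of n] False by (simp add: field_simps)
      next
        case m: False
        then have "\<not> coprime (m * n) q" by simp
        then show ?thesis using supp m by simp
      qed
      show "\<psi> n / \<psi> 1 = 0 \<longleftrightarrow> \<not> coprime n q" for n
      proof (cases "coprime n q")
        case True
        have "totient q > 0" using q by simp
        then have "n * n ^ (totient q - 1) = n ^ totient q" by (simp add: power_eq_if)
        then have "[n * n ^ (totient q - 1) = 1] (mod q)" using euler_theorem[OF True] by simp
        then have "\<psi> (n * n ^ (totient q - 1)) = \<psi> 1" by (rule periodic_cong[of \<psi> q, OF per])
        then have "\<psi> n \<noteq> 0" using eig'[OF True, of "n ^ (totient q - 1)"] False by auto
        then show ?thesis using True False by simp
      qed (simp add: supp)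
    qed (simp_all add: q per)
    have "moebius_mean_zero (\<lambda>n. \<psi> 1 * (\<psi> n / \<psi> 1))"
      by (rule moebius_mean_zero_cmult) (simp only: moebius_mean_zero_def moebius_char_mean)
    then show ?thesis using False by simp
  qed
qed

text \<open>A unit \<open>g\<close> modulo \<open>q\<close> acts on the \<open>q\<close>-periodic functions by dilation, and \<open>g ^ k\<close> acts
  trivially for \<open>k = totient q\<close>. Hence each such function is the sum of its \<open>k\<close> spectral projections,
  which are weighted averages over the powers of \<open>g\<close>. Splitting for all units in turn leaves joint eigenfunctions, which are
  multiples of characters.\<close>

lemma moebius_mean_zero_periodic_coprime:
  fixes \<psi> :: "nat \<Rightarrow> complex"
  assumes q: "q > 0" and per: "\<And>n. \<psi> (n + q) = \<psi> n"
    and supp: "\<And>n. \<not> coprime n q \<Longrightarrow> \<psi> n = 0"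
  shows "moebius_mean_zero \<psi>"
proof -
  define U where "U = {g. g < q \<and> coprime g q}"
  have "finite G \<Longrightarrow> G \<subseteq> U \<Longrightarrow> (\<And>n. \<psi> (n + q) = \<psi> n) \<Longrightarrow> (\<And>n. \<not> coprime n q \<Longrightarrow> \<psi> n = 0) \<Longrightarrow>
      (\<And>g. g \<in> U - G \<Longrightarrow> \<exists>w. \<forall>n. \<psi> (g * n) = w * \<psi> n) \<Longrightarrow> moebius_mean_zero \<psi>" for G and \<psi> :: "nat \<Rightarrow> complex"
  proof (induction G arbitrary: \<psi> rule: finite_induct)
    case empty
    then show ?case by (intro moebius_mean_zero_eigenfunction[OF q]) (auto simp: U_def)
  next
    case (insert g G)
    have g: "coprime g q" using insert.prems(1) by (auto simp: U_def)
    define k where "k = totient q"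
    have k: "k > 0" using q by (simp add: k_def)
    define z where "z = (\<lambda>j::nat. exp (2 * of_real pi * \<i> * of_nat j / of_nat k))"
    have zadd: "z (i + j) = z i * z j" for i j
      by (simp add: z_def exp_add[symmetric] add_divide_distrib distrib_left)
    have zk: "z j = 1 \<longleftrightarrow> k dvd j" for j unfolding z_def using k by (intro complex_root_unity_eq_1) simp
    have zpow: "z (i * j) = z i ^ j" for i j
      by (induction j) (simp_all add: zadd zk)
    have zn0: "z j \<noteq> 0" for j by (simp add: z_def)
    define P where "P = (\<lambda>j n. 1 / of_nat k * (\<Sum>i<k. z (i * j) * \<psi> (g ^ i * n)))"
    have gk: "\<psi> (g ^ k * n) = \<psi> n" for n
    proof (rule periodic_cong[of \<psi> q, OF insert.prems(2)])
      have "[g ^ k * n = 1 * n] (mod q)" unfolding k_def using euler_theorem[OF g] by (rule cong_scalar_right)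
      then show "[g ^ k * n = n] (mod q)" by simp
    qed
    have "moebius_mean_zero (P j)" for j
    proof (rule insert.IH)
      show "G \<subseteq> U" using insert.prems by auto
      show "P j (n + q) = P j n" for n
      proof -
        have "\<psi> (g ^ i * (n + q)) = \<psi> (g ^ i * n)" for i
          by (rule periodic_cong[of \<psi> q, OF insert.prems(2)]) (simp add: unique_euclidean_semiring_class.cong_def distrib_left)
        then show ?thesis by (simp add: P_def)
      qed
      show "P j n = 0" if "\<not> coprime n q" for n
        using insert.prems(3)[of "g ^ _ * n"] that by (simp add: P_def)
      fix h assume h: "h \<in> U - G"
      show "\<exists>w. \<forall>n. P j (h * n) = w * P j n"
      proof (cases "h = g")
        case True
        have "P j (g * n) = inverse (z j) * P j n" for n
        proof -
          let ?f = "\<lambda>i. z (i * j) * \<psi> (g ^ i * n)"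
          have inverse_cancel: "a = inverse c * b" if "c \<noteq> 0" "c * a = b" for a b c :: complex
            using that by auto
          have "z j * (\<Sum>i<k. z (i * j) * \<psi> (g ^ i * (g * n))) = (\<Sum>i<k. ?f (Suc i))"
            by (simp add: sum_distrib_left zadd mult_ac)
          also have "\<dots> = (\<Sum>i<k. ?f i)"
          proof -
            have "z (k * j) = 1" "z 0 = 1" by (simp_all add: zk)
            then have "?f k = ?f 0" using gk by simp
            then show ?thesis using sum.lessThan_Suc_shift[of ?f k] by simp
          qed
          finally have "z j * (\<Sum>i<k. z (i * j) * \<psi> (g ^ i * (g * n))) = (\<Sum>i<k. ?f i)" .
          then have "(\<Sum>i<k. z (i * j) * \<psi> (g ^ i * (g * n))) = inverse (z j) * (\<Sum>i<k. ?f i)"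
            using inverse_cancel[OF zn0[of j]] by blast
          then show ?thesis unfolding P_def by simp
        qed
        then show ?thesis using True by blast
      next
        case False
        then obtain w where w: "\<And>n. \<psi> (h * n) = w * \<psi> n" using h insert.prems(4)[of h] by auto
        have "P j (h * n) = w * P j n" for n
        proof -
          have "\<psi> (g ^ i * (h * n)) = w * \<psi> (g ^ i * n)" for i
            using w[of "g ^ i * n"] by (simp add: mult.left_commute)
          then show ?thesis by (simp add: P_def sum_distrib_left mult_ac)
        qed
        then show ?thesis by blast
      qed
    qed
    then have "moebius_mean_zero (\<lambda>n. \<Sum>j<k. P j n)" by (intro moebius_mean_zero_sum)
    also have "(\<lambda>n. \<Sum>j<k. P j n) = \<psi>"
    proof
      fix n
      have roots: "(\<Sum>j<k. z (i * j)) = (if i = 0 then of_nat k else 0)" if "i < k" for i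
      proof (cases "i = 0")
        case True
        then show ?thesis by (simp add: zk)
      next
        case False
        then have "z i \<noteq> 1" using zk[of i] that by (auto dest: dvd_imp_le)
        moreover have "z i ^ k = 1" unfolding zpow[symmetric] zk by simp
        ultimately show ?thesis using False by (simp add: zpow geometric_sum)
      qed
      have "(\<Sum>j<k. P j n) = 1 / of_nat k * (\<Sum>j<k. \<Sum>i<k. z (i * j) * \<psi> (g ^ i * n))"
        by (simp add: P_def sum_distrib_left)
      also have "(\<Sum>j<k. \<Sum>i<k. z (i * j) * \<psi> (g ^ i * n)) = (\<Sum>i<k. (\<Sum>j<k. z (i * j)) * \<psi> (g ^ i * n))"
        unfolding sum_distrib_right by (rule sum.swap)
      also have "\<dots> = (\<Sum>i<k. if i = 0 then of_nat k * \<psi> n else 0)"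
        by (rule sum.cong) (auto simp: roots)
      also have "\<dots> = of_nat k * \<psi> n" using k by simp
      finally show "(\<Sum>j<k. P j n) = \<psi> n" using k by simp
    qed
    finally show ?case .
  qed
  from this[of U \<psi>] show ?thesis using per supp by (auto simp: U_def)
qed

text \<open>The integers are sorted by \<open>g = gcd n q\<close>. As \<open>moebius_mu (g * m)\<close> vanishes unless \<open>g\<close> and \<open>m\<close> are
  coprime, only the \<open>m\<close> coprime to \<open>q\<close> remain, weighted with a function of period \<open>q\<close>.\<close>

lemma moebius_mean_root_of_unity:
  fixes l :: complex
  assumes q: "q > 0" and l: "l ^ q = 1"
  shows "moebius_mean_zero (\<lambda>n. l ^ n)"
proof -
  define T where "T = (\<lambda>g N. \<Sum>m=1..N. of_int (moebius_mu m) * (of_bool (coprime m q) * l ^ (g * m)))"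
  have gcd_term: "of_bool (gcd (g * m) q = g) * (of_int (moebius_mu (g * m)) * l ^ (g * m)) =
      of_int (moebius_mu g) * (of_int (moebius_mu m) * (of_bool (coprime m q) * l ^ (g * m)))"
    if g: "g dvd q" for g m
  proof (cases "coprime m q")
    case True
    then have "coprime m g" using g by (metis coprime_divisors dvd_refl)
    moreover have "gcd (g * m) q = g"
    proof -
      have "gcd (g * m) q dvd g"
      proof -
        have "coprime (gcd (g * m) q) m" using True by (metis coprime_commute coprime_divisors dvd_refl gcd_dvd2)
        then show ?thesis using coprime_dvd_mult_left_iff gcd_dvd1 by blast
      qed
      moreover have "g dvd gcd (g * m) q" using g by simp
      ultimately show ?thesis by (rule dvd_antisym)
    qed
    ultimately show ?thesis using True by (simp add: moebius_mu_mult_coprime coprime_commute)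
  next
    case False
    have "moebius_mu (g * m) = 0" if eq: "gcd (g * m) q = g"
    proof (rule moebius_mu_mult_not_coprime)
      from g obtain h where h: "q = g * h" by blast
      then have "g > 0" using q by auto
      moreover have "g * gcd m h = g" using eq h by (simp add: gcd_mult_distrib_nat)
      ultimately have "coprime m h" unfolding coprime_iff_gcd_eq_1 by simp
      then show "\<not> coprime g m" using False h by (simp add: coprime_commute)
    qed
    then show ?thesis using False by auto
  qed
  have decomp: "(\<Sum>n=1..N. of_int (moebius_mu n) * l ^ n) = (\<Sum>g | g dvd q. of_int (moebius_mu g) * T g (N div g))" for N
  proof -
    have "(\<Sum>n=1..N. of_int (moebius_mu n) * l ^ n) =
        (\<Sum>n=1..N. \<Sum>g | g dvd q. of_bool (gcd n q = g) * (of_int (moebius_mu n) * l ^ n))"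
    proof (rule sum.cong[OF refl])
      fix n
      have "(\<Sum>g | g dvd q. of_bool (gcd n q = g) * (of_int (moebius_mu n) * l ^ n)) =
          (\<Sum>g\<in>{gcd n q}. of_bool (gcd n q = g) * (of_int (moebius_mu n) * l ^ n))"
        using q by (intro sum.mono_neutral_right) auto
      then show "of_int (moebius_mu n) * l ^ n = (\<Sum>g | g dvd q. of_bool (gcd n q = g) * (of_int (moebius_mu n) * l ^ n))"
        by simp
    qed
    also have "\<dots> = (\<Sum>g | g dvd q. \<Sum>n=1..N. of_bool (gcd n q = g) * (of_int (moebius_mu n) * l ^ n))"
      by (rule sum.swap)
    also have "\<dots> = (\<Sum>g | g dvd q. of_int (moebius_mu g) * T g (N div g))"
    proof (rule sum.cong[OF refl])
      fix g assume "g \<in> {g. g dvd q}"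
      then have g: "g dvd q" "g > 0" using q by (auto intro!: Nat.gr0I)
      have "(\<Sum>n=1..N. of_bool (gcd n q = g) * (of_int (moebius_mu n) * l ^ n)) =
          (\<Sum>n | n \<in> {1..N} \<and> g dvd n. of_bool (gcd n q = g) * (of_int (moebius_mu n) * l ^ n))"
        by (rule sum.mono_neutral_right) auto
      also have "\<dots> = (\<Sum>m=1..N div g. of_bool (gcd (g * m) q = g) * (of_int (moebius_mu (g * m)) * l ^ (g * m)))"
        by (rule sum_multiples[OF g(2)])
      also have "\<dots> = of_int (moebius_mu g) * T g (N div g)"
        unfolding T_def sum_distrib_left gcd_term[OF g(1)] ..
      finally show "(\<Sum>n=1..N. of_bool (gcd n q = g) * (of_int (moebius_mu n) * l ^ n)) = of_int (moebius_mu g) * T g (N div g)" .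
    qed
    finally show ?thesis .
  qed
  have T0: "(\<lambda>N. T g (N div g) / of_nat N) \<longlonglongrightarrow> 0" if g: "g > 0" for g
  proof -
    have "moebius_mean_zero (\<lambda>m. of_bool (coprime m q) * l ^ (g * m))"
    proof (rule moebius_mean_zero_periodic_coprime[OF q])
      fix n
      have "l ^ (g * (n + q)) = l ^ (g * n) * (l ^ q) ^ g"
        by (simp add: distrib_left power_add power_mult[symmetric] mult.commute)
      moreover have "coprime (n + q) q \<longleftrightarrow> coprime n q" unfolding coprime_iff_gcd_eq_1 by simp
      ultimately show "of_bool (coprime (n + q) q) * l ^ (g * (n + q)) = of_bool (coprime n q) * l ^ (g * n)"
        using l by simp
    qed auto
    then have "(\<lambda>N. 1 / of_nat N * T g N) \<longlonglongrightarrow> 0" by (simp add: moebius_mean_zero_def T_def)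
    then have "(\<lambda>N. 1 / of_nat (N div g) * T g (N div g)) \<longlonglongrightarrow> 0"
      by (rule filterlim_compose) (rule filterlim_at_top_div_const_nat[OF g])
    then have lim: "(\<lambda>N. norm (1 / of_nat (N div g) * T g (N div g))) \<longlonglongrightarrow> 0" by (rule tendsto_norm_zero)
    show ?thesis
    proof (rule Lim_null_comparison[OF always_eventually lim], rule allI)
      fix N
      show "norm (T g (N div g) / of_nat N) \<le> norm (1 / of_nat (N div g) * T g (N div g))"
      proof (cases "N div g = 0")
        case True
        then show ?thesis by (simp add: T_def)
      next
        case False
        then have "N > 0" by (intro Nat.gr0I) auto
        then have "real (N div g) \<le> real N" "0 < real (N div g)" "0 < real N" using False by (auto simp: div_le_dividend)
        then have "norm (T g (N div g)) / real N \<le> norm (T g (N div g)) / real (N div g)"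
          by (intro divide_left_mono mult_pos_pos) auto
        then show ?thesis by (simp add: norm_mult norm_divide)
      qed
    qed
  qed
  have "(\<lambda>N. \<Sum>g | g dvd q. of_int (moebius_mu g) * (T g (N div g) / of_nat N)) \<longlonglongrightarrow>
      (\<Sum>g | g dvd q. of_int (moebius_mu g) * 0)"
    using q by (intro tendsto_sum tendsto_mult_left T0) (auto intro!: Nat.gr0I)
  then show ?thesis
    unfolding moebius_mean_zero_def decomp by (simp add: sum_divide_distrib)
qed

text \<open>Davenport's theorem for a single frequency.\<close>

theorem moebius_mean_unimodular:
  assumes "cmod l = 1"
  shows "moebius_mean_zero (\<lambda>n. l ^ n)"
proof (cases "\<exists>k>0. l ^ k = 1")
  case True
  then show ?thesis using moebius_mean_root_of_unity by blast
next
  case False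
  then show ?thesis
    unfolding moebius_mean_zero_def using moebius_mean_not_root_of_unity[OF assms] by blast
qed

section \<open>Operators with an adjoint\<close>

context chilbert_space
begin

subclass banach ..

end

lemma clinearI:
  assumes "\<And>x y. f (x + y) = f x + f y" "\<And>c x. f (c *\<^sub>C x) = c *\<^sub>C f x"
  shows "clinear f"
  by unfold_locales (fact assms)+

lemma clinear_module_hom: "clinear f \<Longrightarrow> module_hom scaleC scaleC f"
  by (simp add: Vector_Spaces.linear_def)

lemmas clinear_add = module_hom.add[OF clinear_module_hom]
  and clinear_scaleC = module_hom.scale[OF clinear_module_hom]
  and clinear_zero = module_hom.zero[OF clinear_module_hom]

lemma scaleC_blinfun_apply [simp]: "blinfun_apply (c *\<^sub>C A) x = c *\<^sub>C blinfun_apply A x"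
  by transfer simp

lemma norm_scaleC_blinfun: "norm (c *\<^sub>C A) \<le> cmod c * norm (A :: 'a::real_normed_vector \<Rightarrow>\<^sub>L 'b::complex_inner)"
proof (rule norm_blinfun_bound)
  fix x
  show "norm (blinfun_apply (c *\<^sub>C A) x) \<le> cmod c * norm A * norm x"
    by (simp add: norm_scaleC mult.assoc mult_left_mono norm_blinfun)
qed simp

lemma blinfun_diff_scaleC:
  "A - B = A + (-1) *\<^sub>C (B :: 'a::real_normed_vector \<Rightarrow>\<^sub>L 'b::complex_inner)"
  using complex_vector.scale_minus_left[of 1] complex_vector.scale_one
  by (auto intro!: blinfun_eqI simp: blinfun.add_left blinfun.diff_left blinfun.minus_left)

lemma cauchy_schwarz: "cmod (cinner x y) \<le> norm x * norm (y :: 'a::complex_inner)"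
proof (cases "y = 0")
  case False
  define c where "c = cinner x y / of_real ((norm y)\<^sup>2)"
  have yy: "cinner y y = of_real ((norm y)\<^sup>2)" by (rule cinner_self)
  have c: "c * cinner y y = cinner x y" unfolding c_def yy using False by simp
  have z: "cinner (x - c *\<^sub>C y) y = 0" using c by (simp add: cinner_diff_left cinner_scaleC_left)
  have "cinner (x - c *\<^sub>C y) (x - c *\<^sub>C y) = cinner (x - c *\<^sub>C y) x - cnj c * cinner (x - c *\<^sub>C y) y"
    using cinner_add_right[of "x - c *\<^sub>C y" "x - c *\<^sub>C y" "c *\<^sub>C y"]
    by (simp add: cinner_scaleC_right)
  also have "\<dots> = cinner x x - c * cinner y x"
    using z by (simp add: cinner_diff_left cinner_scaleC_left)
  also have "c * cinner y x = of_real ((cmod (cinner x y))\<^sup>2 / (norm y)\<^sup>2)"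
  proof -
    have "cinner x y * cnj (cinner x y) = of_real ((cmod (cinner x y))\<^sup>2)" by (rule complex_norm_square[symmetric])
    then show ?thesis unfolding c_def by (subst cinner_commute[of y x]) simp
  qed
  finally have "Re (cinner (x - c *\<^sub>C y) (x - c *\<^sub>C y)) = (norm x)\<^sup>2 - (cmod (cinner x y))\<^sup>2 / (norm y)\<^sup>2"
    by (simp only: cinner_self minus_complex.sel Re_complex_of_real)
  with cinner_ge_zero[of "x - c *\<^sub>C y"] have "(cmod (cinner x y))\<^sup>2 / (norm y)\<^sup>2 \<le> (norm x)\<^sup>2" by simp
  then have "(cmod (cinner x y))\<^sup>2 \<le> (norm x * norm y)\<^sup>2"
    using False by (simp add: field_simps power_mult_distrib)
  then show ?thesis by (rule power2_le_imp_le) simp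
qed simp

lemma cinner_eq_0_all:
  assumes "\<And>x. cinner x y = 0" shows "y = (0 :: 'a::complex_inner)"
  using assms[of y] by (simp add: cinner_self)

lemma bounded_bilinear_cinner: "bounded_bilinear (cinner :: 'a::complex_inner \<Rightarrow> 'a \<Rightarrow> complex)"
proof
  show "\<exists>K. \<forall>a b :: 'a. norm (cinner a b) \<le> norm a * norm b * K"
    by (intro exI[of _ 1] allI) (simp add: cauchy_schwarz)
qed (auto simp: cinner_add_left cinner_add_right scaleR_scaleC cinner_scaleC_left cinner_scaleC_right scaleR_conv_of_real)

lemmas tendsto_cinner = bounded_bilinear.tendsto[OF bounded_bilinear_cinner]

definition adjoint_pair :: "('a::complex_inner \<Rightarrow>\<^sub>L 'a) \<Rightarrow> ('a \<Rightarrow>\<^sub>L 'a) \<Rightarrow> bool" where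
  "adjoint_pair A B \<longleftrightarrow> clinear (blinfun_apply A) \<and> clinear (blinfun_apply B) \<and>
     (\<forall>x y. cinner (A x) y = cinner x (B y))"

text \<open>The existence of adjoints is carried along as a property: operators with an adjoint form a
  C*-algebra, and the creation operators will have explicit adjoints, so that all of \<open>CAR\<close> is covered
  without a representation theorem for functionals.\<close>

definition adjointable :: "('a::complex_inner \<Rightarrow>\<^sub>L 'a) set" where
  "adjointable = {A. \<exists>B. adjoint_pair A B}"

lemma adjoint_pair_sym: "adjoint_pair A B \<Longrightarrow> adjoint_pair B A"
  unfolding adjoint_pair_def by (metis cinner_commute)

lemma cadjoint_eq:
  assumes "adjoint_pair A B" shows "cadjoint A = B"
  unfolding cadjoint_def
proof (rule the_equality)
  show "\<forall>x y. cinner (A x) y = cinner x (B y)" using assms by (simp add: adjoint_pair_def)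
  fix B' assume B': "\<forall>x y. cinner (A x) y = cinner x (blinfun_apply B' y)"
  show "B' = B"
  proof (rule blinfun_eqI)
    fix y
    have "cinner x (B' y - B y) = 0" for x
      using B' assms cinner_add_right[of x "B' y - B y" "B y"] by (simp add: adjoint_pair_def)
    then have "B' y - B y = 0" by (rule cinner_eq_0_all)
    then show "B' y = B y" by simp
  qed
qed

lemma adjointable_pair: "A \<in> adjointable \<Longrightarrow> adjoint_pair A (cadjoint A)"
  unfolding adjointable_def using cadjoint_eq by fastforce

lemma adjoint_pair_norm:
  assumes "adjoint_pair A B" shows "norm B \<le> norm A"
proof (rule norm_blinfun_bound)
  fix y
  have "(norm (B y))\<^sup>2 = cmod (cinner (B y) (B y))" by (simp add: cinner_self norm_power)
  also have "cinner (B y) (B y) = cinner (A (B y)) y" using assms by (simp add: adjoint_pair_def)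
  also have "cmod \<dots> \<le> norm (A (B y)) * norm y" by (rule cauchy_schwarz)
  also have "\<dots> \<le> norm A * norm (B y) * norm y" by (intro mult_right_mono norm_blinfun) simp
  finally have *: "norm (B y) * norm (B y) \<le> norm (B y) * (norm A * norm y)"
    by (simp add: power2_eq_square mult_ac)
  show "norm (B y) \<le> norm A * norm y"
  proof (cases "norm (B y) = 0")
    case False
    then show ?thesis by (intro mult_left_le_imp_le[OF *]) simp
  qed simp
qed simp

lemma adjoint_pair_add: "adjoint_pair A B \<Longrightarrow> adjoint_pair A' B' \<Longrightarrow> adjoint_pair (A + A') (B + B')"
  unfolding adjoint_pair_def
  by (auto intro!: clinearI simp: blinfun.add_left clinear_add clinear_scaleC scaleC_add_right
      cinner_add_left cinner_add_right algebra_simps)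

lemma adjoint_pair_scaleC: "adjoint_pair A B \<Longrightarrow> adjoint_pair (c *\<^sub>C A) (cnj c *\<^sub>C B)"
  unfolding adjoint_pair_def
  by (auto intro!: clinearI simp: clinear_add clinear_scaleC scaleC_add_right scaleC_scaleC
      cinner_scaleC_left cinner_scaleC_right mult.commute)

lemma adjoint_pair_compose: "adjoint_pair A B \<Longrightarrow> adjoint_pair A' B' \<Longrightarrow> adjoint_pair (A o\<^sub>L A') (B' o\<^sub>L B)"
  unfolding adjoint_pair_def
  by (auto intro!: clinearI simp: clinear_add clinear_scaleC)

lemma adjoint_pair_zero: "adjoint_pair 0 0"
  unfolding adjoint_pair_def by (auto intro!: clinearI)

lemma adjoint_pair_limit:
  assumes "\<And>n. adjoint_pair (A n) (B n)" "A \<longlonglongrightarrow> A'" "B \<longlonglongrightarrow> B'"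
  shows "adjoint_pair A' B'"
  unfolding adjoint_pair_def
proof (intro conjI allI clinearI)
  have A: "(\<lambda>n. A n x) \<longlonglongrightarrow> A' x" and B: "(\<lambda>n. B n x) \<longlonglongrightarrow> B' x" for x
    using assms by (auto intro: blinfun.tendsto)
  have lin: "clinear (blinfun_apply (A n))" "clinear (blinfun_apply (B n))" for n
    using assms(1) by (auto simp: adjoint_pair_def)
  have sc: "X \<longlonglongrightarrow> y \<Longrightarrow> (\<lambda>n. c *\<^sub>C X n) \<longlonglongrightarrow> c *\<^sub>C y" for X and y :: 'a and c
    by (rule bounded_linear.tendsto[OF bounded_linear_scaleC_right])
  show "A' (x + y) = A' x + A' y" for x y
    by (rule LIMSEQ_unique[OF A]) (use tendsto_add[OF A A] in \<open>simp add: clinear_add[OF lin(1)]\<close>)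
  show "B' (x + y) = B' x + B' y" for x y
    by (rule LIMSEQ_unique[OF B]) (use tendsto_add[OF B B] in \<open>simp add: clinear_add[OF lin(2)]\<close>)
  show "A' (c *\<^sub>C x) = c *\<^sub>C A' x" for c x
    by (rule LIMSEQ_unique[OF A]) (use sc[OF A] in \<open>simp add: clinear_scaleC[OF lin(1)]\<close>)
  show "B' (c *\<^sub>C x) = c *\<^sub>C B' x" for c x
    by (rule LIMSEQ_unique[OF B]) (use sc[OF B] in \<open>simp add: clinear_scaleC[OF lin(2)]\<close>)
  fix x y
  have "(\<lambda>n. cinner (A n x) y) \<longlonglongrightarrow> cinner (A' x) y" by (intro tendsto_cinner A tendsto_const)
  moreover have "(\<lambda>n. cinner (A n x) y) \<longlonglongrightarrow> cinner x (B' y)"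
  proof -
    have "(\<lambda>n. cinner x (B n y)) \<longlonglongrightarrow> cinner x (B' y)" by (intro tendsto_cinner B tendsto_const)
    then show ?thesis using assms(1) by (simp add: adjoint_pair_def)
  qed
  ultimately show "cinner (A' x) y = cinner x (B' y)" by (rule LIMSEQ_unique)
qed

lemma adjoint_pair_diff:
  assumes "adjoint_pair A B" "adjoint_pair A' B'"
  shows "adjoint_pair (A - A') (B - B')"
  using adjoint_pair_add[OF assms(1) adjoint_pair_scaleC[OF assms(2), of "-1"]]
  unfolding blinfun_diff_scaleC by simp

text \<open>Passing to adjoints is isometric, so that the adjoints of a convergent sequence converge as well.\<close>

lemma adjointable_cstar_algebra: "cstar_algebra (adjointable :: ('a::chilbert_space \<Rightarrow>\<^sub>L 'a) set)"
  unfolding cstar_algebra_def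
proof (intro conjI ballI allI)
  show "clinear (blinfun_apply A)" if "A \<in> adjointable" for A :: "'a \<Rightarrow>\<^sub>L 'a"
    using adjointable_pair[OF that] by (simp add: adjoint_pair_def)
  show "(0 :: 'a \<Rightarrow>\<^sub>L 'a) \<in> adjointable" using adjoint_pair_zero by (auto simp: adjointable_def)
  show "A + B \<in> adjointable" "A o\<^sub>L B \<in> adjointable" if "A \<in> adjointable" "B \<in> adjointable" for A B :: "'a \<Rightarrow>\<^sub>L 'a"
    using that adjoint_pair_add adjoint_pair_compose unfolding adjointable_def by blast+
  show "c *\<^sub>C A \<in> adjointable" if "A \<in> adjointable" for c and A :: "'a \<Rightarrow>\<^sub>L 'a"
    using that adjoint_pair_scaleC unfolding adjointable_def by blast
  show "cadjoint A \<in> adjointable" if "A \<in> adjointable" for A :: "'a \<Rightarrow>\<^sub>L 'a"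
    using adjoint_pair_sym[OF adjointable_pair[OF that]] unfolding adjointable_def by blast
  show "closed (adjointable :: ('a \<Rightarrow>\<^sub>L 'a) set)"
    unfolding closed_sequential_limits
  proof (intro allI impI, elim conjE)
    fix A :: "nat \<Rightarrow> ('a \<Rightarrow>\<^sub>L 'a)" and A'
    assume A: "\<forall>n. A n \<in> adjointable" "A \<longlonglongrightarrow> A'"
    have p: "adjoint_pair (A n) (cadjoint (A n))" for n using A by (auto intro: adjointable_pair)
    have "Cauchy A" using A(2) by (rule LIMSEQ_imp_Cauchy)
    have "Cauchy (\<lambda>n. cadjoint (A n))"
    proof (rule CauchyI)
      fix e :: real assume "e > 0"
      then obtain M where "\<And>m n. m \<ge> M \<Longrightarrow> n \<ge> M \<Longrightarrow> norm (A m - A n) < e"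
        using CauchyD[OF \<open>Cauchy A\<close>] by blast
      then show "\<exists>M. \<forall>m\<ge>M. \<forall>n\<ge>M. norm (cadjoint (A m) - cadjoint (A n)) < e"
        using adjoint_pair_norm[OF adjoint_pair_diff[OF p p]] order.strict_trans1 by blast
    qed
    then obtain B where "(\<lambda>n. cadjoint (A n)) \<longlonglongrightarrow> B"
      using Cauchy_convergent convergent_def by blast
    then show "A' \<in> adjointable"
      using adjoint_pair_limit[OF p A(2)] unfolding adjointable_def by blast
  qed
qed

section \<open>Automorphisms of C*-algebras are contractive\<close>

locale operator_algebra =
  fixes \<A> :: "('a::chilbert_space \<Rightarrow>\<^sub>L 'a) set"
  assumes cstar: "cstar_algebra \<A>" and sub: "\<A> \<subseteq> adjointable"
begin

lemma add_mem: "A \<in> \<A> \<Longrightarrow> B \<in> \<A> \<Longrightarrow> A + B \<in> \<A>"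
  and compose_mem: "A \<in> \<A> \<Longrightarrow> B \<in> \<A> \<Longrightarrow> A o\<^sub>L B \<in> \<A>"
  and scaleC_mem: "A \<in> \<A> \<Longrightarrow> c *\<^sub>C A \<in> \<A>"
  and cadjoint_mem: "A \<in> \<A> \<Longrightarrow> cadjoint A \<in> \<A>"
  and zero_mem: "0 \<in> \<A>"
  and closed: "closed \<A>"
  using cstar by (auto simp: cstar_algebra_def)

lemma pair: "A \<in> \<A> \<Longrightarrow> adjoint_pair A (cadjoint A)"
  using sub adjointable_pair by blast

lemma diff_mem: "A \<in> \<A> \<Longrightarrow> B \<in> \<A> \<Longrightarrow> A - B \<in> \<A>"
  unfolding blinfun_diff_scaleC by (intro add_mem scaleC_mem)

text \<open>The equation \<open>1 - B = (1 - C)\<^sup>2\<close> is the fixed point equation for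
  \<open>C \<mapsto> (B + C\<^sup>2) / 2\<close>, a contraction of the ball of radius \<open>norm B < 1\<close>. It gives a square
  root without leaving a possibly non-unital algebra.\<close>

lemma square_root_exists:
  assumes B: "B \<in> \<A>" "cadjoint B = B" and b: "norm B < 1"
  shows "\<exists>C\<in>\<A>. cadjoint C = C \<and> C = (1/2) *\<^sub>C (B + (C o\<^sub>L C))"
proof -
  define b where "b = norm B"
  define S where "S = {C \<in> \<A>. cadjoint C = C \<and> norm C \<le> b}"
  let ?f = "\<lambda>C. (1/2) *\<^sub>C (B + (C o\<^sub>L C))"
  have selfadj: "adjoint_pair C C" if "C \<in> S" for C using pair that unfolding S_def by force
  have cS: "complete S"
  proof -
    have "closed S"
      unfolding closed_sequential_limits
    proof (intro allI impI, elim conjE)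
      fix C C' assume C: "\<forall>n. C n \<in> S" "C \<longlonglongrightarrow> C'"
      have "adjoint_pair C' C'" by (rule adjoint_pair_limit[of C C]) (use C selfadj in auto)
      moreover have "C' \<in> \<A>" using closed C by (auto simp: closed_sequential_limits S_def)
      moreover have "norm C' \<le> b"
        using C by (intro LIMSEQ_le_const2[OF tendsto_norm[OF C(2)]]) (auto simp: S_def)
      ultimately show "C' \<in> S" by (simp add: S_def cadjoint_eq)
    qed
    then show ?thesis by (simp add: complete_eq_closed)
  qed
  have norm_half: "norm ((1/2) *\<^sub>C X) \<le> norm X / 2" for X :: "'a \<Rightarrow>\<^sub>L 'a"
    using norm_scaleC_blinfun[of "1/2" X] by (simp add: norm_divide)
  have "\<exists>!C\<in>S. ?f C = C"
  proof (rule Banach_fix[OF cS])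
    show "0 \<le> b" "b < 1" using b by (auto simp: b_def)
    show "S \<noteq> {}" using zero_mem \<open>0 \<le> b\<close> cadjoint_eq[OF adjoint_pair_zero] by (auto simp: S_def)
    show "?f ` S \<subseteq> S"
    proof
      fix X assume "X \<in> ?f ` S"
      then obtain C where C: "C \<in> S" and X: "X = ?f C" by blast
      have "X \<in> \<A>" unfolding X using C B by (auto simp: S_def intro!: scaleC_mem add_mem compose_mem)
      moreover have "adjoint_pair X (cnj (1/2) *\<^sub>C (B + (C o\<^sub>L C)))"
        unfolding X using pair[OF B(1)] B(2) selfadj[OF C]
        by (intro adjoint_pair_scaleC adjoint_pair_add adjoint_pair_compose) simp_all
      then have "cadjoint X = X" unfolding X by (simp add: cadjoint_eq)
      moreover have "norm X \<le> b"
      proof -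
        have "norm (C o\<^sub>L C) \<le> norm C * norm C" by (rule norm_blinfun_compose)
        also have "\<dots> \<le> b * b" using C \<open>0 \<le> b\<close> by (intro mult_mono) (auto simp: S_def)
        also have "\<dots> \<le> b * 1" using \<open>0 \<le> b\<close> \<open>b < 1\<close> by (intro mult_left_mono) auto
        finally have "norm (B + (C o\<^sub>L C)) \<le> b + b" using norm_triangle_ineq[of B "C o\<^sub>L C"] by (simp add: b_def)
        then show ?thesis unfolding X using norm_half[of "B + (C o\<^sub>L C)"] by simp
      qed
      ultimately show "X \<in> S" by (simp add: S_def)
    qed
    show "dist (?f C) (?f D) \<le> b * dist C D" if "C \<in> S" "D \<in> S" for C D
    proof -
      have "?f C - ?f D = (1/2) *\<^sub>C ((C o\<^sub>L (C - D)) + ((C - D) o\<^sub>L D))"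
      proof (rule blinfun_eqI)
        fix x
        have "(1/2) *\<^sub>C (u - v) = (1/2) *\<^sub>C u - (1/2) *\<^sub>C v" for u v :: 'a
          by (rule complex_vector.scale_right_diff_distrib)
        then show "blinfun_apply (?f C - ?f D) x = blinfun_apply ((1/2) *\<^sub>C ((C o\<^sub>L (C - D)) + ((C - D) o\<^sub>L D))) x"
          by (simp add: blinfun.add_left blinfun.diff_left blinfun.diff_right flip: complex_vector.scale_right_diff_distrib)
      qed
      then have "norm (?f C - ?f D) \<le> norm ((C o\<^sub>L (C - D)) + ((C - D) o\<^sub>L D)) / 2" using norm_half by simp
      also have "\<dots> \<le> (norm C * norm (C - D) + norm (C - D) * norm D) / 2"
        by (intro divide_right_mono order.trans[OF norm_triangle_ineq] add_mono norm_blinfun_compose) simp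
      also have "\<dots> \<le> (b * norm (C - D) + norm (C - D) * b) / 2"
        using that by (intro divide_right_mono add_mono mult_left_mono mult_right_mono) (auto simp: S_def)
      finally show ?thesis by (simp add: dist_norm)
    qed
  qed
  then obtain C where "C \<in> S" "?f C = C" by blast
  then show ?thesis by (auto simp: S_def)
qed

end

locale automorphism = operator_algebra +
  fixes \<alpha>
  assumes auto: "star_automorphism \<A> \<alpha>"
begin

lemma \<alpha>_mem: "A \<in> \<A> \<Longrightarrow> \<alpha> A \<in> \<A>"
  and \<alpha>_add: "A \<in> \<A> \<Longrightarrow> B \<in> \<A> \<Longrightarrow> \<alpha> (A + B) = \<alpha> A + \<alpha> B"
  and \<alpha>_compose: "A \<in> \<A> \<Longrightarrow> B \<in> \<A> \<Longrightarrow> \<alpha> (A o\<^sub>L B) = \<alpha> A o\<^sub>L \<alpha> B"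
  and \<alpha>_scaleC: "A \<in> \<A> \<Longrightarrow> \<alpha> (c *\<^sub>C A) = c *\<^sub>C \<alpha> A"
  and \<alpha>_cadjoint: "A \<in> \<A> \<Longrightarrow> \<alpha> (cadjoint A) = cadjoint (\<alpha> A)"
  using auto by (auto simp: star_automorphism_def dest: bij_betwE)

text \<open>With \<open>B = cadjoint A o\<^sub>L A\<close> and \<open>C\<close> from \<open>square_root_exists\<close>, the operator
  \<open>1 - \<alpha> B = (1 - \<alpha> C)\<^sup>2\<close> is positive, which says that \<open>norm (\<alpha> A x) \<le> norm x\<close>. The argument is
  purely algebraic and so applies to \<open>\<alpha>\<close> before its continuity is known.\<close>

lemma contractive_unit:
  assumes A: "A \<in> \<A>" and n: "norm A < 1"
  shows "norm (\<alpha> A) \<le> 1"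
proof -
  define B where "B = cadjoint A o\<^sub>L A"
  have BA: "B \<in> \<A>" unfolding B_def using A by (intro compose_mem cadjoint_mem)
  have "adjoint_pair B B" unfolding B_def
    using pair[OF A] adjoint_pair_sym by (intro adjoint_pair_compose) auto
  then have Bs: "cadjoint B = B" by (rule cadjoint_eq)
  have "norm B \<le> norm (cadjoint A) * norm A" unfolding B_def by (rule norm_blinfun_compose)
  also have "\<dots> \<le> norm A * norm A" by (intro mult_right_mono adjoint_pair_norm[OF pair[OF A]]) auto
  also have "\<dots> < 1" using n by (metis abs_square_less_1 abs_norm_cancel power2_eq_square)
  finally have Bn: "norm B < 1" .
  obtain C where C: "C \<in> \<A>" "cadjoint C = C" "C = (1/2) *\<^sub>C (B + (C o\<^sub>L C))"
    using square_root_exists[OF BA Bs Bn] by blast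
  have CC: "C o\<^sub>L C \<in> \<A>" using C by (intro compose_mem)
  have aC: "adjoint_pair (\<alpha> C) (\<alpha> C)" using pair[OF \<alpha>_mem[OF C(1)]] \<alpha>_cadjoint[OF C(1)] C(2) by simp
  have aA: "adjoint_pair (\<alpha> A) (cadjoint (\<alpha> A))" using pair[OF \<alpha>_mem[OF A]] .
  have eq: "\<alpha> C = (1/2) *\<^sub>C ((cadjoint (\<alpha> A) o\<^sub>L \<alpha> A) + (\<alpha> C o\<^sub>L \<alpha> C))"
  proof -
    have "\<alpha> C = \<alpha> ((1/2) *\<^sub>C (B + (C o\<^sub>L C)))" using C(3) by simp
    also have "\<dots> = (1/2) *\<^sub>C (\<alpha> B + (\<alpha> C o\<^sub>L \<alpha> C))"
      using BA CC C(1) by (simp add: \<alpha>_scaleC \<alpha>_add \<alpha>_compose add_mem)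
    also have "\<alpha> B = cadjoint (\<alpha> A) o\<^sub>L \<alpha> A"
      unfolding B_def using A by (simp add: \<alpha>_compose \<alpha>_cadjoint cadjoint_mem)
    finally show ?thesis .
  qed
  show ?thesis
  proof (rule norm_blinfun_bound)
    fix x
    define y where "y = \<alpha> C x"
    have two: "cinner (\<alpha> C x) x * 2 = cinner (\<alpha> A x) (\<alpha> A x) + cinner y y"
    proof -
      have 1: "cinner (cadjoint (\<alpha> A) u) v = cinner u (\<alpha> A v)" for u v
        using adjoint_pair_sym[OF aA] by (simp add: adjoint_pair_def)
      have 2: "cinner (\<alpha> C u) v = cinner u (\<alpha> C v)" for u v
        using aC by (simp add: adjoint_pair_def)
      have "cinner (\<alpha> C x) x = cinner (blinfun_apply ((1/2) *\<^sub>C ((cadjoint (\<alpha> A) o\<^sub>L \<alpha> A) + (\<alpha> C o\<^sub>L \<alpha> C))) x) x"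
        using eq by simp
      also have "\<dots> = 1/2 * (cinner (cadjoint (\<alpha> A) (\<alpha> A x)) x + cinner (\<alpha> C (\<alpha> C x)) x)"
        by (simp add: cinner_scaleC_left cinner_add_left blinfun.add_left)
      also have "\<dots> = 1/2 * (cinner (\<alpha> A x) (\<alpha> A x) + cinner y y)" unfolding y_def 1 2 ..
      finally show ?thesis by simp
    qed
    have yx: "cinner y x = cinner x y" unfolding y_def using aC by (simp add: adjoint_pair_def)
    have "cinner (x - y) (x - y) = cinner (x - y) x - cinner (x - y) y"
      using cinner_add_right[of "x - y" "x - y" y] by simp
    also have "\<dots> = cinner x x - (cinner y x * 2 - cinner y y)"
      using yx by (simp add: cinner_diff_left)
    also have "\<dots> = cinner x x - cinner (\<alpha> A x) (\<alpha> A x)"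
      using two by (simp add: y_def)
    finally have "Re (cinner (x - y) (x - y)) = (norm x)\<^sup>2 - (norm (\<alpha> A x))\<^sup>2"
      by (simp only: cinner_self minus_complex.sel Re_complex_of_real)
    with cinner_ge_zero[of "x - y"] have "(norm (\<alpha> A x))\<^sup>2 \<le> (norm x)\<^sup>2" by simp
    then show "norm (\<alpha> A x) \<le> 1 * norm x" using power2_le_imp_le by fastforce
  qed simp
qed

lemma contractive:
  assumes A: "A \<in> \<A>"
  shows "norm (\<alpha> A) \<le> norm A"
proof (rule field_le_epsilon)
  fix e :: real assume e: "e > 0"
  define t where "t = norm A + e"
  have t: "t > 0" "norm A < t" using e by (auto simp: t_def add_nonneg_pos)
  have "norm (complex_of_real (1/t) *\<^sub>C A) \<le> norm A / t"
    using norm_scaleC_blinfun[of "complex_of_real (1/t)" A] t by (simp add: norm_divide)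
  also have "\<dots> < 1" using t by simp
  finally have 1: "norm (\<alpha> (complex_of_real (1/t) *\<^sub>C A)) \<le> 1"
    by (rule contractive_unit[OF scaleC_mem[OF A]])
  have "\<alpha> A = complex_of_real t *\<^sub>C (complex_of_real (1/t) *\<^sub>C \<alpha> A)"
    using t by (intro blinfun_eqI) (simp add: scaleC_scaleC scaleC_one)
  also have "norm \<dots> \<le> t * norm (complex_of_real (1/t) *\<^sub>C \<alpha> A)"
    using norm_scaleC_blinfun[of "complex_of_real t"] t by simp
  also have "\<dots> \<le> t * 1" using 1 t A by (intro mult_left_mono) (auto simp: \<alpha>_scaleC)
  finally show "norm (\<alpha> A) \<le> norm A + e" by (simp add: t_def)
qed

end

section \<open>Creation operators\<close>

subsection \<open>Expansion of the Gram determinant along its first row\<close>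

definition omit :: "nat \<Rightarrow> 'a list \<Rightarrow> 'a list" where
  "omit j ys = take j ys @ drop (Suc j) ys"

lemma length_omit [simp]: "j < length ys \<Longrightarrow> length (omit j ys) = length ys - 1"
  by (simp add: omit_def)

lemma nth_omit: "j < length ys \<Longrightarrow> i < length ys - 1 \<Longrightarrow> omit j ys ! i = (if i < j then ys ! i else ys ! Suc i)"
  by (auto simp: omit_def nth_append min_def)

lemma omit_Cons [simp]: "omit 0 (y # ys) = ys" "omit (Suc j) (y # ys) = y # omit j ys"
  by (simp_all add: omit_def)

lemma gram_eq_det:
  fixes xs ys :: "'a::complex_inner list"
  assumes "length xs = n" "length ys = n"
  shows "gram xs ys = Determinant.det (Matrix.mat n n (\<lambda>(i, j). cinner (xs ! i) (ys ! j)))"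
proof -
  have "gram xs ys = (\<Sum>p | p permutes {..<n}. of_int (sign p) * (\<Prod>i<n. cinner (xs ! i) (ys ! p i)))"
    using assms by (simp add: gram_def)
  also have "\<dots> = (\<Sum>p | p permutes {0..<n}. signof p *
      (\<Prod>i = 0..<n. Matrix.mat n n (\<lambda>(i, j). cinner (xs ! i) (ys ! j)) $$ (i, p i)))"
    unfolding lessThan_atLeast0
  proof (rule sum.cong[OF refl])
    fix p assume "p \<in> {p. p permutes {0..<n}}"
    then have p: "p permutes {0..<n}" by simp
    have "(\<Prod>i = 0..<n. Matrix.mat n n (\<lambda>(i, j). cinner (xs ! i) (ys ! j)) $$ (i, p i)) =
        (\<Prod>i = 0..<n. cinner (xs ! i) (ys ! p i))"
      using permutes_in_image[OF p] by (intro prod.cong refl) auto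
    then show "of_int (sign p) * (\<Prod>i = 0..<n. cinner (xs ! i) (ys ! p i)) = signof p *
      (\<Prod>i = 0..<n. Matrix.mat n n (\<lambda>(i, j). cinner (xs ! i) (ys ! j)) $$ (i, p i))"
      by (simp add: sign_def)
  qed
  finally show ?thesis by (simp add: Determinant.det_def)
qed

lemma gram_Cons:
  fixes xs ys :: "'a::complex_inner list"
  shows "gram (f # xs) ys = (\<Sum>j<length ys. (-1) ^ j * cinner f (ys ! j) * gram xs (omit j ys))"
proof (cases "length ys = Suc (length xs)")
  case True
  define n where "n = length xs"
  define A where "A = Matrix.mat (Suc n) (Suc n) (\<lambda>(i, j). cinner ((f # xs) ! i) (ys ! j))"
  have A: "A \<in> carrier_mat (Suc n) (Suc n)" by (simp add: A_def)
  have "gram (f # xs) ys = Determinant.det A"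
    unfolding A_def by (rule gram_eq_det) (simp_all add: True n_def)
  also have "\<dots> = (\<Sum>j<Suc n. A $$ (0, j) * cofactor A 0 j)"
    by (rule laplace_expansion_row[OF A]) simp
  also have "\<dots> = (\<Sum>j<Suc n. (-1) ^ j * cinner f (ys ! j) * gram xs (omit j ys))"
  proof (rule sum.cong[OF refl])
    fix j assume "j \<in> {..<Suc n}"
    then have j: "j < Suc n" by simp
    have len: "length ys = Suc n" using True by (simp add: n_def)
    have "mat_delete A 0 j = Matrix.mat n n (\<lambda>(i, j'). cinner (xs ! i) (omit j ys ! j'))"
      using j len by (intro eq_matI) (auto simp: mat_delete_def A_def nth_omit)
    then have "Determinant.det (mat_delete A 0 j) = gram xs (omit j ys)"
      using j len by (subst gram_eq_det[of xs n]) (simp_all add: n_def)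
    then show "A $$ (0, j) * cofactor A 0 j = (-1) ^ j * cinner f (ys ! j) * gram xs (omit j ys)"
      using j by (simp add: A_def cofactor_def)
  qed
  finally show ?thesis using True by (simp add: n_def)
next
  case False
  have "gram xs (omit j ys) = 0" if "j < length ys" for j
    using False that by (auto simp: gram_def)
  then show ?thesis using False by (auto simp: gram_def[of "f # xs"])
qed

subsection \<open>Creation and annihilation on formal combinations\<close>

abbreviation basic :: "'a list \<Rightarrow> 'a formal" where
  "basic xs \<equiv> Poly_Mapping.single xs 1"

text \<open>The linear extension of a map that is given on basic lists.\<close>

definition flift :: "('a list \<Rightarrow> 'a formal) \<Rightarrow> 'a formal \<Rightarrow> 'a formal" where
  "flift T v = (\<Sum>xs\<in>Poly_Mapping.keys v. fscale (Poly_Mapping.lookup v xs) (T xs))"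

lemma fscale_add_left: "fscale (c + d) u = fscale c u + fscale d u"
  and fscale_add_right: "fscale c (u + v) = fscale c u + fscale c v"
  and fscale_fscale: "fscale c (fscale d u) = fscale (c * d) u"
  and fscale_zero_left [simp]: "fscale 0 u = 0"
  and fscale_zero_right [simp]: "fscale c 0 = 0"
  and fscale_one [simp]: "fscale 1 u = u"
  by (rule poly_mapping_eqI, simp add: lookup_add algebra_simps)+

lemma fscale_sum: "fscale c (sum g A) = (\<Sum>i\<in>A. fscale c (g i))"
  by (induction A rule: infinite_finite_induct) (simp_all add: fscale_add_right)

lemma flift_superset:
  assumes "finite A" "Poly_Mapping.keys v \<subseteq> A"
  shows "flift T v = (\<Sum>xs\<in>A. fscale (Poly_Mapping.lookup v xs) (T xs))"
  unfolding flift_def using assms by (intro sum.mono_neutral_left) (auto simp: in_keys_iff)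

lemma flift_add: "flift T (u + v) = flift T u + flift T v"
proof -
  let ?A = "Poly_Mapping.keys u \<union> Poly_Mapping.keys v"
  show ?thesis
    using keys_add[of u v]
    by (simp add: flift_superset[of ?A] lookup_add sum.distrib fscale_add_left)
qed

lemma flift_fscale: "flift T (fscale c v) = fscale c (flift T v)"
  using keys_fscale[of c v]
  by (simp add: flift_superset[of "Poly_Mapping.keys v"] fscale_sum fscale_fscale)

lemma flift_zero [simp]: "flift T 0 = 0"
  by (simp add: flift_def)

lemma flift_sum: "flift T (sum g A) = (\<Sum>i\<in>A. flift T (g i))"
  by (induction A rule: infinite_finite_induct) (simp_all add: flift_add)

lemma flift_basic [simp]: "flift T (basic xs) = T xs"
  by (simp add: flift_def)

lemma flift_id: "flift basic v = v"
proof (rule poly_mapping_eqI)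
  fix k
  have "Poly_Mapping.lookup (flift basic v) k =
      (\<Sum>xs\<in>Poly_Mapping.keys v. if xs = k then Poly_Mapping.lookup v xs else 0)"
    unfolding flift_def lookup_sum by (intro sum.cong refl) (simp add: lookup_single when_def)
  then show "Poly_Mapping.lookup (flift basic v) k = Poly_Mapping.lookup v k"
    by (simp add: in_keys_iff)
qed

lemma flift_compose: "flift S (flift T v) = flift (\<lambda>xs. flift S (T xs)) v"
  by (simp add: flift_def[of T] flift_def[of "\<lambda>xs. flift S (T xs)"] flift_sum flift_fscale)

lemma flift_pointwise_diff: "flift (\<lambda>xs. S xs - T xs) v = flift S v - flift T v"
  unfolding flift_def fscale_diff[symmetric] by (rule sum_subtractf)

lemma flift_pointwise_fscale: "flift (\<lambda>xs. fscale c (S xs)) v = fscale c (flift S v)"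
  unfolding flift_def fscale_sum fscale_fscale by (simp only: mult.commute)

lemma finner_sum_left: "finner (sum g A) w = (\<Sum>i\<in>A. finner (g i) w)"
  by (induction A rule: infinite_finite_induct) (simp_all add: finner_add_left)

lemma finner_sum_right: "finner w (sum g A) = (\<Sum>i\<in>A. finner w (g i))"
proof -
  have "finner w 0 = 0" by (subst finner_commute) simp
  then show ?thesis by (induction A rule: infinite_finite_induct) (simp_all add: finner_add_right)
qed

lemma finner_basic: "finner (basic xs) (basic ys) = gram xs ys"
  by (simp add: finner_def)

lemma finner_flift_left: "finner (flift S u) v =
    (\<Sum>xs\<in>Poly_Mapping.keys u. \<Sum>ys\<in>Poly_Mapping.keys v.
      Poly_Mapping.lookup u xs * cnj (Poly_Mapping.lookup v ys) * finner (S xs) (basic ys))"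
proof -
  have "finner (flift S u) (flift basic v) = (\<Sum>xs\<in>Poly_Mapping.keys u. \<Sum>ys\<in>Poly_Mapping.keys v.
      Poly_Mapping.lookup u xs * cnj (Poly_Mapping.lookup v ys) * finner (S xs) (basic ys))"
    by (simp only: flift_def finner_sum_left finner_scale_left)
       (simp add: finner_sum_right finner_scale_right sum_distrib_left mult.assoc)
  then show ?thesis by (simp add: flift_id)
qed

lemma finner_flift_right: "finner u (flift T v) =
    (\<Sum>xs\<in>Poly_Mapping.keys u. \<Sum>ys\<in>Poly_Mapping.keys v.
      Poly_Mapping.lookup u xs * cnj (Poly_Mapping.lookup v ys) * finner (basic xs) (T ys))"
proof -
  have "finner (flift basic u) (flift T v) = (\<Sum>xs\<in>Poly_Mapping.keys u. \<Sum>ys\<in>Poly_Mapping.keys v.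
      Poly_Mapping.lookup u xs * cnj (Poly_Mapping.lookup v ys) * finner (basic xs) (T ys))"
    by (simp only: flift_def finner_sum_left finner_scale_left)
       (simp add: finner_sum_right finner_scale_right sum_distrib_left mult.assoc)
  then show ?thesis by (simp add: flift_id)
qed

definition fcreate :: "'a::complex_inner \<Rightarrow> 'a formal \<Rightarrow> 'a formal" where
  "fcreate f = flift (\<lambda>xs. basic (f # xs))"

text \<open>The interior product with \<open>f\<close>. It is antilinear in \<open>f\<close>, because it is made to be adjoint to
  exterior multiplication by \<open>f\<close>.\<close>

definition contract :: "'a::complex_inner \<Rightarrow> 'a list \<Rightarrow> 'a formal" where
  "contract f ys = (\<Sum>j<length ys. fscale ((-1) ^ j * cinner (ys ! j) f) (basic (omit j ys)))"

definition fannihilate :: "'a::complex_inner \<Rightarrow> 'a formal \<Rightarrow> 'a formal" where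
  "fannihilate f = flift (contract f)"

text \<open>On basic lists this is the expansion of the determinant along its first row.\<close>

lemma finner_fcreate: "finner (fcreate f u) v = finner u (fannihilate f v)"
proof -
  have "finner (basic (f # xs)) (basic ys) = finner (basic xs) (contract f ys)" for xs ys
    by (simp add: finner_basic contract_def finner_sum_right finner_scale_right gram_Cons flip: cinner_commute)
  then show ?thesis
    by (simp add: fcreate_def fannihilate_def finner_flift_left finner_flift_right)
qed

text \<open>Omitting the leading \<open>f\<close> gives the scalar term; omitting a later factor is a contraction of the
  rest, with its sign reversed by the shifted position.\<close>

lemma fannihilate_fcreate:
  "fannihilate f (fcreate f v) = fscale (cinner f f) v - fcreate f (fannihilate f v)"
proof -
  have "contract f (f # xs) = fscale (cinner f f) (basic xs) - fcreate f (contract f xs)" for xs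
  proof -
    have "contract f (f # xs) = fscale (cinner f f) (basic xs) +
        (\<Sum>j<length xs. fscale ((-1) ^ Suc j * cinner (xs ! j) f) (basic (f # omit j xs)))"
      unfolding contract_def by (simp add: sum.lessThan_Suc_shift del: sum.lessThan_Suc)
    also have "(\<Sum>j<length xs. fscale ((-1) ^ Suc j * cinner (xs ! j) f) (basic (f # omit j xs))) =
        - fcreate f (contract f xs)"
      unfolding contract_def fcreate_def flift_sum flift_fscale flift_basic sum_negf[symmetric]
      by (intro sum.cong refl poly_mapping_eqI) simp
    finally show ?thesis by simp
  qed
  then have "fannihilate f (fcreate f v) = flift (\<lambda>xs. fscale (cinner f f) (basic xs) - fcreate f (contract f xs)) v"
    by (simp add: fannihilate_def fcreate_def flift_compose)
  also have "\<dots> = fscale (cinner f f) (flift basic v) - fcreate f (fannihilate f v)"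
    unfolding fannihilate_def fcreate_def flift_compose by (simp add: flift_pointwise_diff flift_pointwise_fscale)
  finally show ?thesis by (simp add: flift_id)
qed

text \<open>By the anticommutation relation, \<open>norm (f \<and> v)\<^sup>2\<close> and the squared norm of the contraction
  of \<open>v\<close> by \<open>f\<close> add up to \<open>(norm f * norm v)\<^sup>2\<close>.\<close>

lemma fnorm_fcreate_le: "fnorm (fcreate f v) \<le> norm f * fnorm v"
proof (rule power2_le_imp_le)
  let ?w = "fannihilate f v"
  have "finner (fcreate f v) (fcreate f v) = finner v (fscale (cinner f f) v) - finner v (fcreate f ?w)"
    by (simp add: finner_fcreate fannihilate_fcreate finner_diff_right)
  also have "finner v (fcreate f ?w) = finner ?w ?w"
    by (metis finner_commute finner_fcreate)
  also have "finner v (fscale (cinner f f) v) = of_real ((norm f * fnorm v)\<^sup>2)"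
    by (simp add: finner_scale_right finner_self cinner_self power_mult_distrib)
  finally have "complex_of_real ((fnorm (fcreate f v))\<^sup>2) = of_real ((norm f * fnorm v)\<^sup>2 - (fnorm ?w)\<^sup>2)"
    unfolding finner_self by (simp only: of_real_diff)
  then have "(fnorm (fcreate f v))\<^sup>2 = (norm f * fnorm v)\<^sup>2 - (fnorm ?w)\<^sup>2"
    by (simp only: of_real_eq_iff)
  then show "(fnorm (fcreate f v))\<^sup>2 \<le> (norm f * fnorm v)\<^sup>2" by simp
qed simp

lemma fnorm_fannihilate_le: "fnorm (fannihilate f v) \<le> norm f * fnorm v"
proof (cases "fnorm (fannihilate f v) = 0")
  case False
  let ?w = "fannihilate f v"
  have "(fnorm ?w)\<^sup>2 = cmod (finner ?w ?w)" by (simp add: finner_self norm_power)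
  also have "finner ?w ?w = finner (fcreate f ?w) v" by (simp add: finner_fcreate)
  also have "cmod \<dots> \<le> fnorm (fcreate f ?w) * fnorm v" by (rule finner_cauchy_schwarz)
  also have "\<dots> \<le> (norm f * fnorm ?w) * fnorm v" by (intro mult_right_mono fnorm_fcreate_le) simp
  finally have "fnorm ?w * fnorm ?w \<le> fnorm ?w * (norm f * fnorm v)" by (simp add: power2_eq_square mult_ac)
  moreover have "0 < fnorm ?w" using False fnorm_nonneg[of ?w] by linarith
  ultimately show ?thesis by (rule mult_left_le_imp_le)
qed simp

subsection \<open>Extension to the Fock space\<close>

text \<open>A bounded map preserves Cauchy sequences and null sequences, hence acts on the completion.\<close>

lemma fock_extension:
  fixes T :: "'a::complex_inner formal \<Rightarrow> 'a formal"
  assumes add: "\<And>u v. T (u + v) = T u + T v" and scale: "\<And>c v. T (fscale c v) = fscale c (T v)"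
    and bound: "\<And>v. fnorm (T v) \<le> K * fnorm v" and K: "K \<ge> 0"
  obtains A :: "'a fock \<Rightarrow>\<^sub>L 'a fock" where "clinear (blinfun_apply A)" "norm A \<le> K"
    "\<And>X. fcauchy X \<Longrightarrow> fcauchy (\<lambda>n. T (X n)) \<and> blinfun_apply A (abs_fock X) = abs_fock (\<lambda>n. T (X n))"
proof -
  have diff: "T (u - v) = T u - T v" for u v
    using add[of "u - v" v] by (simp add: algebra_simps)
  have cauchy: "fcauchy (\<lambda>n. T (X n))" if X: "fcauchy X" for X
    unfolding fcauchy_def
  proof (intro allI impI)
    fix e :: real assume e: "e > 0"
    then have "e / (K + 1) > 0" using K by simp
    then obtain M where M: "\<And>m n. m \<ge> M \<Longrightarrow> n \<ge> M \<Longrightarrow> fnorm (X m - X n) < e / (K + 1)"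
      using X unfolding fcauchy_def by blast
    have "fnorm (T (X m) - T (X n)) < e" if "m \<ge> M" "n \<ge> M" for m n
    proof -
      have "fnorm (T (X m) - T (X n)) \<le> K * fnorm (X m - X n)" using bound[of "X m - X n"] by (simp add: diff)
      also have "\<dots> \<le> (K + 1) * fnorm (X m - X n)" by (intro mult_right_mono) auto
      also have "\<dots> < (K + 1) * (e / (K + 1))" using M[OF that] K by (intro mult_strict_left_mono) auto
      also have "\<dots> = e" using K by simp
      finally show ?thesis .
    qed
    then show "\<exists>M. \<forall>m\<ge>M. \<forall>n\<ge>M. fnorm (T (X m) - T (X n)) < e" by blast
  qed
  define R where "R = (\<lambda>x :: 'a fock. SOME X. fcauchy X \<and> x = abs_fock X)"
  have R: "fcauchy (R x)" "x = abs_fock (R x)" for x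
    using someI_ex[OF fock_cases, of x] unfolding R_def by auto
  define op where "op = (\<lambda>x. abs_fock (\<lambda>n. T (R x n)))"
  have op_eq: "op (abs_fock X) = abs_fock (\<lambda>n. T (X n))" if X: "fcauchy X" for X
  proof -
    have "frel (R (abs_fock X)) X"
      using Quotient_rel[OF Quotient_fock, of "R (abs_fock X)" X] R[of "abs_fock X"] X frel_refl by metis
    then have "(\<lambda>n. fnorm (R (abs_fock X) n - X n)) \<longlonglongrightarrow> 0" by (simp add: frel_def)
    then have "(\<lambda>n. K * fnorm (R (abs_fock X) n - X n)) \<longlonglongrightarrow> K * 0" by (rule tendsto_mult_left)
    then have "(\<lambda>n. fnorm (T (R (abs_fock X) n) - T (X n))) \<longlonglongrightarrow> 0"
      using bound by (intro fnorm_squeeze[where g = "\<lambda>n. K * fnorm (R (abs_fock X) n - X n)"]) (auto simp flip: diff)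
    then have "frel (\<lambda>n. T (R (abs_fock X) n)) (\<lambda>n. T (X n))"
      using cauchy R(1) X by (simp add: frel_def)
    then show ?thesis unfolding op_def by (rule abs_fock_eqI)
  qed
  have op_add: "op (x + y) = op x + op y" for x y
  proof -
    have "op (x + y) = op (abs_fock (\<lambda>n. R x n + R y n))"
      using R plus_abs_fock by metis
    also have "\<dots> = abs_fock (\<lambda>n. T (R x n) + T (R y n))" by (simp add: op_eq fcauchy_add R add)
    also have "\<dots> = op x + op y" by (simp add: op_def plus_abs_fock cauchy R)
    finally show ?thesis .
  qed
  have op_scale: "op (c *\<^sub>C x) = c *\<^sub>C op x" for c x
  proof -
    have "op (c *\<^sub>C x) = op (abs_fock (\<lambda>n. fscale c (R x n)))"
      using R scaleC_abs_fock by metis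
    also have "\<dots> = abs_fock (\<lambda>n. fscale c (T (R x n)))" by (simp add: op_eq fcauchy_fscale R scale)
    also have "\<dots> = c *\<^sub>C op x" by (simp add: op_def scaleC_abs_fock cauchy R)
    finally show ?thesis .
  qed
  have op_norm: "norm (op x) \<le> K * norm x" for x
  proof (rule LIMSEQ_le)
    show "(\<lambda>n. fnorm (T (R x n))) \<longlonglongrightarrow> norm (op x)" unfolding op_def by (rule norm_abs_fock[OF cauchy[OF R(1)]])
    have "(\<lambda>n. fnorm (R x n)) \<longlonglongrightarrow> norm x" using norm_abs_fock[OF R(1)] R(2) by metis
    then show "(\<lambda>n. K * fnorm (R x n)) \<longlonglongrightarrow> K * norm x" by (rule tendsto_mult_left)
  qed (use bound in auto)
  have bl: "bounded_linear op"
    by (rule bounded_linear_intro[where K = K]) (use op_norm in \<open>auto simp: op_add op_scale scaleR_scaleC mult.commute\<close>)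
  then have ap: "blinfun_apply (Blinfun op) = op" by (rule bounded_linear_Blinfun_apply)
  show ?thesis
  proof (rule that[of "Blinfun op"])
    show "clinear (blinfun_apply (Blinfun op))" unfolding ap by (rule clinearI) (fact op_add op_scale)+
    show "norm (Blinfun op) \<le> K" by (rule norm_blinfun_bound) (use K op_norm in \<open>auto simp: ap\<close>)
  qed (auto simp: ap op_eq cauchy)
qed

lemma wedge_ext:
  fixes A B :: "'a::chilbert_space fock \<Rightarrow>\<^sub>L 'a fock"
  assumes "clinear (blinfun_apply A)" "clinear (blinfun_apply B)" "\<And>xs. A (wedge xs) = B (wedge xs)"
  shows "A = B"
proof (rule blinfun_eqI)
  fix x
  let ?S = "{x. A x = B x}"
  have "y \<in> ?S" if "y \<in> cspan (range wedge)" for y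
    using that
  proof (induction rule: complex_vector.span_induct_alt)
    case base
    then show ?case by simp
  next
    case (step c x y)
    then show ?case using assms
      by (auto simp: clinear_add clinear_scaleC)
  qed
  then have "closure (cspan (range wedge)) \<subseteq> ?S"
    by (intro closure_minimal closed_Collect_eq continuous_intros) auto
  then show "A x = B x" using wedge_dense by blast
qed

lemma creation_annihilation:
  fixes f :: "'a::chilbert_space"
  shows "clinear (blinfun_apply (creation f))" "blinfun_apply (creation f) (wedge xs) = wedge (f # xs)"
    "norm (creation f) \<le> norm f" "creation f \<in> adjointable"
proof -
  obtain A :: "'a fock \<Rightarrow>\<^sub>L 'a fock" where A: "clinear (blinfun_apply A)" "norm A \<le> norm f"
    "\<And>X. fcauchy X \<Longrightarrow> fcauchy (\<lambda>n. fcreate f (X n)) \<and> A (abs_fock X) = abs_fock (\<lambda>n. fcreate f (X n))"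
    by (rule fock_extension[of "fcreate f" "norm f"])
       (auto simp: fcreate_def flift_add flift_fscale fnorm_fcreate_le[unfolded fcreate_def])
  obtain B :: "'a fock \<Rightarrow>\<^sub>L 'a fock" where B: "clinear (blinfun_apply B)" "norm B \<le> norm f"
    "\<And>X. fcauchy X \<Longrightarrow> fcauchy (\<lambda>n. fannihilate f (X n)) \<and> B (abs_fock X) = abs_fock (\<lambda>n. fannihilate f (X n))"
    by (rule fock_extension[of "fannihilate f" "norm f"])
       (auto simp: fannihilate_def flift_add flift_fscale fnorm_fannihilate_le[unfolded fannihilate_def])
  have Aw: "A (wedge xs) = wedge (f # xs)" for xs
    using A(3)[OF fcauchy_const] by (simp add: wedge_def fembed_def fcreate_def)
  have "creation f = A"
    unfolding creation_def
  proof (rule the_equality)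
    show "clinear (blinfun_apply A) \<and> (\<forall>xs. A (wedge xs) = wedge (f # xs))" using A Aw by blast
  qed (rule wedge_ext, use A Aw in auto)
  then show "clinear (blinfun_apply (creation f))" "creation f (wedge xs) = wedge (f # xs)"
    "norm (creation f) \<le> norm f" using A Aw by auto
  have "cinner (A x) y = cinner x (B y)" for x y
  proof -
    obtain X where X: "fcauchy X" "x = abs_fock X" using fock_cases by blast
    obtain Y where Y: "fcauchy Y" "y = abs_fock Y" using fock_cases by blast
    have "(\<lambda>n. finner (fcreate f (X n)) (Y n)) \<longlonglongrightarrow> cinner (A x) y"
      using A(3)[OF X(1)] X Y by (simp add: cinner_abs_fock)
    moreover have "(\<lambda>n. finner (X n) (fannihilate f (Y n))) \<longlonglongrightarrow> cinner x (B y)"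
      using B(3)[OF Y(1)] X Y by (simp add: cinner_abs_fock)
    ultimately show ?thesis unfolding finner_fcreate by (rule LIMSEQ_unique)
  qed
  then have "adjoint_pair A B" using A B by (simp add: adjoint_pair_def)
  then show "creation f \<in> adjointable" using \<open>creation f = A\<close> by (auto simp: adjointable_def)
qed

text \<open>The difference of the two sides is orthogonal to all decomposable tensors, hence to itself.\<close>

lemma wedge_eqI:
  assumes "\<And>ys. gram (f # xs) ys = c * gram (g # xs) ys + d * gram (h # xs) ys"
  shows "wedge (f # xs) = c *\<^sub>C wedge (g # xs) + d *\<^sub>C wedge (h # xs)"
proof -
  let ?d = "wedge (f # xs) - (c *\<^sub>C wedge (g # xs) + d *\<^sub>C wedge (h # xs))"
  have orth: "cinner ?d (wedge ys) = 0" for ys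
    by (simp add: cinner_diff_left cinner_add_left cinner_scaleC_left cinner_wedge assms)
  have "cinner ?d ?d = cinner ?d (wedge (f # xs)) - cinner ?d (c *\<^sub>C wedge (g # xs) + d *\<^sub>C wedge (h # xs))"
    using cinner_add_right[of ?d ?d "c *\<^sub>C wedge (g # xs) + d *\<^sub>C wedge (h # xs)"] by simp
  also have "\<dots> = 0" by (simp only: cinner_add_right cinner_scaleC_right orth) simp
  finally show ?thesis by (simp add: cinner_self)
qed

lemma creation_linear: "creation (c *\<^sub>C g + d *\<^sub>C h) = c *\<^sub>C creation g + d *\<^sub>C creation h"
proof (rule wedge_ext)
  show "clinear (blinfun_apply (c *\<^sub>C creation g + d *\<^sub>C creation h))"
    by (intro clinearI) (simp_all add: blinfun.add_left clinear_add[OF creation_annihilation(1)]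
        clinear_scaleC[OF creation_annihilation(1)] scaleC_add_right scaleC_scaleC mult.commute)
  show "creation (c *\<^sub>C g + d *\<^sub>C h) (wedge xs) = (c *\<^sub>C creation g + d *\<^sub>C creation h) (wedge xs)" for xs
    unfolding blinfun.add_left scaleC_blinfun_apply creation_annihilation(2)
    by (rule wedge_eqI)
       (simp add: gram_Cons cinner_add_left cinner_scaleC_left sum_distrib_left sum.distrib[symmetric] algebra_simps)
qed (rule creation_annihilation(1))

lemma creation_add: "creation (g + h) = creation g + creation h"
  and creation_scaleC: "creation (c *\<^sub>C g) = c *\<^sub>C creation g"
proof -
  have one: "1 *\<^sub>C A = A" for A :: "'a fock \<Rightarrow>\<^sub>L 'a fock" by (rule blinfun_eqI) (simp add: scaleC_one)
  have zero: "0 *\<^sub>C A = 0" for A :: "'a fock \<Rightarrow>\<^sub>L 'a fock" by (rule blinfun_eqI) simp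
  show "creation (g + h) = creation g + creation h"
    using creation_linear[of 1 g 1 h] by (simp add: scaleC_one one)
  show "creation (c *\<^sub>C g) = c *\<^sub>C creation g"
    using creation_linear[of c g 0 g] by (simp add: zero)
qed

section \<open>Eigenoperators span a dense subspace\<close>

text \<open>The finite sums of operators on which \<open>\<alpha>\<close> acts by a unimodular factor. They form a
  selfadjoint algebra, because \<open>\<alpha>\<close> is multiplicative and compatible with adjoints; so their closure
  is a C*-algebra, and it contains \<open>CAR\<close> as soon as it contains the creation operators.\<close>

inductive_set eigensums :: "('a::chilbert_space \<Rightarrow>\<^sub>L 'a) set \<Rightarrow> (('a \<Rightarrow>\<^sub>L 'a) \<Rightarrow> ('a \<Rightarrow>\<^sub>L 'a)) \<Rightarrow> ('a \<Rightarrow>\<^sub>L 'a) set"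
  for \<A> \<alpha> where
    eigen: "X \<in> \<A> \<Longrightarrow> cmod l = 1 \<Longrightarrow> \<alpha> X = l *\<^sub>C X \<Longrightarrow> X \<in> eigensums \<A> \<alpha>"
  | add: "X \<in> eigensums \<A> \<alpha> \<Longrightarrow> Y \<in> eigensums \<A> \<alpha> \<Longrightarrow> X + Y \<in> eigensums \<A> \<alpha>"

lemma scaleC_scaleC_blinfun: "c *\<^sub>C d *\<^sub>C A = (c * d) *\<^sub>C (A :: 'a::real_normed_vector \<Rightarrow>\<^sub>L 'b::complex_inner)"
  by (rule blinfun_eqI) (simp add: scaleC_scaleC)

lemma scaleC_add_right_blinfun: "c *\<^sub>C (A + B) = c *\<^sub>C A + c *\<^sub>C (B :: 'a::real_normed_vector \<Rightarrow>\<^sub>L 'b::complex_inner)"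
  by (rule blinfun_eqI) (simp add: blinfun.add_left scaleC_add_right)

lemma tendsto_scaleC_blinfun:
  fixes X :: "nat \<Rightarrow> ('a::real_normed_vector \<Rightarrow>\<^sub>L 'b::complex_inner)"
  assumes "X \<longlonglongrightarrow> A" shows "(\<lambda>n. c *\<^sub>C X n) \<longlonglongrightarrow> c *\<^sub>C A"
proof (rule LIM_zero_cancel, rule Lim_null_comparison)
  have "c *\<^sub>C X n - c *\<^sub>C A = c *\<^sub>C (X n - A)" for n
    by (rule blinfun_eqI) (simp add: blinfun.diff_left complex_vector.scale_right_diff_distrib)
  then show "\<forall>\<^sub>F n in sequentially. norm (c *\<^sub>C X n - c *\<^sub>C A) \<le> cmod c * norm (X n - A)"
    using norm_scaleC_blinfun by (intro always_eventually allI) simp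
  show "(\<lambda>n. cmod c * norm (X n - A)) \<longlonglongrightarrow> 0"
    using assms by (intro tendsto_mult_right_zero) (simp add: LIM_zero tendsto_norm_zero)
qed

context automorphism
begin

lemma eigensums_sub: "X \<in> eigensums \<A> \<alpha> \<Longrightarrow> X \<in> \<A>"
  by (induction rule: eigensums.induct) (auto intro: add_mem)

lemma eigensums_scaleC: "X \<in> eigensums \<A> \<alpha> \<Longrightarrow> c *\<^sub>C X \<in> eigensums \<A> \<alpha>"
proof (induction rule: eigensums.induct)
  case (eigen X l)
  then show ?case
    by (intro eigensums.eigen[of _ _ l]) (auto simp: scaleC_mem \<alpha>_scaleC scaleC_scaleC_blinfun mult.commute)
next
  case (add X Y)
  then show ?case unfolding scaleC_add_right_blinfun by (intro eigensums.add)
qed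

lemma eigensums_cadjoint: "X \<in> eigensums \<A> \<alpha> \<Longrightarrow> cadjoint X \<in> eigensums \<A> \<alpha>"
proof (induction rule: eigensums.induct)
  case (eigen X l)
  have "\<alpha> (cadjoint X) = cadjoint (l *\<^sub>C X)" using eigen by (simp add: \<alpha>_cadjoint)
  also have "\<dots> = cnj l *\<^sub>C cadjoint X"
    by (rule cadjoint_eq[OF adjoint_pair_scaleC[OF pair[OF eigen(1)]]])
  finally show ?case using eigen by (intro eigensums.eigen[of _ _ "cnj l"] cadjoint_mem) auto
next
  case (add X Y)
  have "cadjoint (X + Y) = cadjoint X + cadjoint Y"
    using add(1,2)[THEN eigensums_sub] by (intro cadjoint_eq adjoint_pair_add pair)
  then show ?case using add by (auto intro: eigensums.add)
qed

lemma eigensums_compose: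
  assumes "X \<in> eigensums \<A> \<alpha>" "Y \<in> eigensums \<A> \<alpha>"
  shows "X o\<^sub>L Y \<in> eigensums \<A> \<alpha>"
  using assms(1)
proof (induction rule: eigensums.induct)
  case X: (eigen X l)
  show ?case using assms(2)
  proof (induction rule: eigensums.induct)
    case Y: (eigen Y k)
    have lin: "clinear (blinfun_apply X)" using pair[OF X(1)] by (simp add: adjoint_pair_def)
    have "\<alpha> (X o\<^sub>L Y) = (l *\<^sub>C X) o\<^sub>L (k *\<^sub>C Y)" using X Y by (simp add: \<alpha>_compose)
    also have "\<dots> = (l * k) *\<^sub>C (X o\<^sub>L Y)"
      by (rule blinfun_eqI) (simp add: clinear_scaleC[OF lin] scaleC_scaleC)
    finally show ?case using X Y by (intro eigensums.eigen[of _ _ "l * k"] compose_mem) (auto simp: norm_mult)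
  next
    case (add Y Y')
    then show ?case unfolding bounded_bilinear.add_right[OF bounded_bilinear_blinfun_compose] by (intro eigensums.add)
  qed
next
  case (add X X')
  then show ?case unfolding bounded_bilinear.add_left[OF bounded_bilinear_blinfun_compose] by (intro eigensums.add)
qed

lemma cstar_closure_eigensums: "cstar_algebra (closure (eigensums \<A> \<alpha>))"
proof -
  let ?S = "closure (eigensums \<A> \<alpha>)"
  have sub\<A>: "?S \<subseteq> \<A>" using eigensums_sub closed by (intro closure_minimal) auto
  have zero: "0 \<in> eigensums \<A> \<alpha>"
  proof -
    have "0 *\<^sub>C (0 :: 'a \<Rightarrow>\<^sub>L 'a) = 0" by (rule blinfun_eqI) simp
    then have "\<alpha> 0 = 0 *\<^sub>C \<alpha> 0" using \<alpha>_scaleC[OF zero_mem, of 0] by simp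
    moreover have "0 *\<^sub>C \<alpha> 0 = (0 :: 'a \<Rightarrow>\<^sub>L 'a)" "1 *\<^sub>C (0 :: 'a \<Rightarrow>\<^sub>L 'a) = 0" by (rule blinfun_eqI, simp)+
    ultimately show ?thesis using zero_mem by (intro eigensums.eigen[of _ _ 1]) auto
  qed
  show ?thesis
    unfolding cstar_algebra_def
  proof (intro conjI ballI allI)
    show "clinear (blinfun_apply A)" if "A \<in> ?S" for A
      using that sub\<A> pair by (auto simp: adjoint_pair_def)
    show "0 \<in> ?S" using zero closure_subset by blast
    fix A assume "A \<in> ?S"
    then obtain X where X: "\<And>n. X n \<in> eigensums \<A> \<alpha>" "X \<longlonglongrightarrow> A"
      unfolding closure_sequential by blast
    have A: "A \<in> \<A>" using \<open>A \<in> ?S\<close> sub\<A> by blast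
    show "c *\<^sub>C A \<in> ?S" for c
      unfolding closure_sequential
      using X tendsto_scaleC_blinfun[OF X(2)] by (intro exI[of _ "\<lambda>n. c *\<^sub>C X n"]) (simp add: eigensums_scaleC)
    have "(\<lambda>n. cadjoint (X n)) \<longlonglongrightarrow> cadjoint A"
    proof (rule LIM_zero_cancel, rule Lim_null_comparison)
      show "\<forall>\<^sub>F n in sequentially. norm (cadjoint (X n) - cadjoint A) \<le> norm (X n - A)"
        by (intro always_eventually allI)
           (rule adjoint_pair_norm[OF adjoint_pair_diff[OF pair[OF eigensums_sub[OF X(1)]] pair[OF A]]])
      show "(\<lambda>n. norm (X n - A)) \<longlonglongrightarrow> 0" using X(2) by (simp add: LIM_zero tendsto_norm_zero)
    qed
    then show "cadjoint A \<in> ?S"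
      unfolding closure_sequential using X(1) by (intro exI[of _ "\<lambda>n. cadjoint (X n)"]) (simp add: eigensums_cadjoint)
    fix B assume "B \<in> ?S"
    then obtain Y where Y: "\<And>n. Y n \<in> eigensums \<A> \<alpha>" "Y \<longlonglongrightarrow> B"
      unfolding closure_sequential by blast
    show "A + B \<in> ?S"
      unfolding closure_sequential using X Y by (intro exI[of _ "\<lambda>n. X n + Y n"]) (auto intro: eigensums.add tendsto_add)
    show "A o\<^sub>L B \<in> ?S"
      unfolding closure_sequential using X Y
      by (intro exI[of _ "\<lambda>n. X n o\<^sub>L Y n"]) (auto intro: eigensums_compose bounded_bilinear.tendsto[OF bounded_bilinear_blinfun_compose])
  qed simp
qed

lemma iterate_mem: "A \<in> \<A> \<Longrightarrow> (\<alpha> ^^ n) A \<in> \<A>"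
  by (induction n) (auto intro: \<alpha>_mem)

lemma iterate_add: "A \<in> \<A> \<Longrightarrow> B \<in> \<A> \<Longrightarrow> (\<alpha> ^^ n) (A + B) = (\<alpha> ^^ n) A + (\<alpha> ^^ n) B"
  by (induction n) (auto simp: \<alpha>_add iterate_mem)

lemma iterate_contractive: "A \<in> \<A> \<Longrightarrow> norm ((\<alpha> ^^ n) A) \<le> norm A"
  by (induction n) (auto intro: order.trans[OF contractive] iterate_mem)

lemma iterate_eigen: "X \<in> \<A> \<Longrightarrow> \<alpha> X = l *\<^sub>C X \<Longrightarrow> (\<alpha> ^^ n) X = l ^ n *\<^sub>C X"
proof (induction n)
  case 0
  then show ?case by (intro blinfun_eqI) (simp add: scaleC_one)
next
  case (Suc n)
  then show ?case by (simp add: \<alpha>_scaleC scaleC_scaleC_blinfun mult.commute)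
qed

lemma moebius_mean_zero_eigensum:
  assumes \<rho>: "state \<A> \<rho>" and X: "X \<in> eigensums \<A> \<alpha>"
  shows "moebius_mean_zero (\<lambda>n. \<rho> ((\<alpha> ^^ n) X))"
  using X
proof (induction rule: eigensums.induct)
  case (eigen X l)
  have "\<rho> ((\<alpha> ^^ n) X) = \<rho> X * l ^ n" for n
    using \<rho> eigen by (simp add: iterate_eigen[OF eigen(1,3)] state_def)
  then show ?case using moebius_mean_zero_cmult[OF moebius_mean_unimodular[OF eigen(2)], of "\<rho> X"] by simp
next
  case (add X Y)
  have "\<rho> ((\<alpha> ^^ n) (X + Y)) = (\<Sum>Z\<in>{False, True}. \<rho> ((\<alpha> ^^ n) (if Z then X else Y)))" for n
    using \<rho> add(1,2)[THEN eigensums_sub] by (simp add: iterate_add iterate_mem state_def add.commute)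
  moreover have "moebius_mean_zero (\<lambda>n. \<Sum>Z\<in>{False, True}. \<rho> ((\<alpha> ^^ n) (if Z then X else Y)))"
    using add.IH by (intro moebius_mean_zero_sum) auto
  ultimately show ?case by simp
qed

text \<open>On eigenoperators the Moebius averages are those of powers of a unimodular number. As \<open>\<alpha>\<close> is
  contractive and states have norm one, approximating the operator changes the averages by no
  more than the error of the approximation.\<close>

lemma moebius_disjoint_dense:
  assumes dense: "\<A> \<subseteq> closure (eigensums \<A> \<alpha>)"
  shows "moebius_disjoint \<A> \<alpha>"
  unfolding moebius_disjoint_def
proof (intro allI impI, elim conjE)
  fix \<rho> A assume \<rho>: "state \<A> \<rho>" and A: "A \<in> \<A>"
  let ?m = "\<lambda>X N. 1 / of_nat N * (\<Sum>n=1..N. of_int (moebius_mu n) * \<rho> ((\<alpha> ^^ n) X))"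
  show "(\<lambda>N. ?m A N) \<longlonglongrightarrow> 0"
  proof (rule LIMSEQ_I)
    fix e :: real assume e: "e > 0"
    then obtain X where X: "X \<in> eigensums \<A> \<alpha>" "dist X A < e / 2"
      using A dense closure_approachable[of A] by (meson half_gt_zero subsetD)
    have XA: "X \<in> \<A>" using X(1) by (rule eigensums_sub)
    have D: "A - X \<in> \<A>" "norm (A - X) < e / 2"
      using X A XA diff_mem by (auto simp: dist_norm norm_minus_commute)
    have "?m X \<longlonglongrightarrow> 0" using moebius_mean_zero_eigensum[OF \<rho> X(1)] by (simp add: moebius_mean_zero_def)
    then obtain N0 where N0: "\<And>N. N \<ge> N0 \<Longrightarrow> norm (?m X N) < e / 2"
      using LIMSEQ_D[of "?m X" 0 "e / 2"] e by auto
    have small: "norm (?m (A - X) N) < e / 2" for N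
    proof -
      have "cmod (\<Sum>n=1..N. of_int (moebius_mu n) * \<rho> ((\<alpha> ^^ n) (A - X))) \<le> (\<Sum>n=1..N. norm (A - X))"
      proof (rule order.trans[OF norm_sum], rule sum_mono)
        fix n
        have "cmod (\<rho> ((\<alpha> ^^ n) (A - X))) \<le> norm ((\<alpha> ^^ n) (A - X))"
          using \<rho> iterate_mem[OF D(1)] by (simp add: state_def)
        then have "cmod (of_int (moebius_mu n)) * cmod (\<rho> ((\<alpha> ^^ n) (A - X))) \<le> 1 * norm ((\<alpha> ^^ n) (A - X))"
          by (intro mult_mono norm_moebius_mu_le_1) auto
        also have "\<dots> \<le> norm (A - X)" using iterate_contractive[OF D(1)] by simp
        finally show "cmod (of_int (moebius_mu n) * \<rho> ((\<alpha> ^^ n) (A - X))) \<le> norm (A - X)" by (simp add: norm_mult)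
      qed
      then have "norm (?m (A - X) N) \<le> 1 / real N * (real N * norm (A - X))"
        unfolding norm_mult by (intro mult_mono) (auto simp: norm_divide)
      also have "\<dots> \<le> norm (A - X)" by (cases "N = 0") auto
      finally show ?thesis using D(2) by simp
    qed
    have "?m A N = ?m X N + ?m (A - X) N" for N
    proof -
      have "\<rho> ((\<alpha> ^^ n) A) = \<rho> ((\<alpha> ^^ n) X) + \<rho> ((\<alpha> ^^ n) (A - X))" for n
        using iterate_add[OF XA D(1), of n] iterate_mem[OF XA, of n] iterate_mem[OF D(1), of n] \<rho>
        by (simp add: state_def)
      then show ?thesis by (simp add: sum.distrib distrib_left)
    qed
    then have "norm (?m A N - 0) < e" if "N \<ge> N0" for N
      using norm_triangle_ineq[of "?m X N" "?m (A - X) N"] N0[OF that] small[of N] by simp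
    then show "\<exists>N0. \<forall>N\<ge>N0. norm (?m A N - 0) < e" by blast
  qed
qed

end

section \<open>The CAR algebra\<close>

lemma CAR_sub_adjointable: "CAR \<subseteq> adjointable"
  unfolding CAR_def
  using adjointable_cstar_algebra creation_annihilation(4) by (intro hull_minimal) auto

lemma cstar_algebraD:
  assumes "cstar_algebra \<A>"
  shows "0 \<in> \<A>" "A \<in> \<A> \<Longrightarrow> B \<in> \<A> \<Longrightarrow> A + B \<in> \<A>"
    "A \<in> \<A> \<Longrightarrow> B \<in> \<A> \<Longrightarrow> A o\<^sub>L B \<in> \<A>"
    "A \<in> \<A> \<Longrightarrow> c *\<^sub>C A \<in> \<A>" "A \<in> \<A> \<Longrightarrow> cadjoint A \<in> \<A>" "closed \<A>"
  using assms by (simp_all add: cstar_algebra_def)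

text \<open>The family of algebras that is intersected must not be empty, since otherwise the operators in the
  intersection need not be complex-linear; \<open>adjointable\<close> belongs to it.\<close>

lemma CAR_cstar_algebra: "cstar_algebra CAR"
proof -
  let ?F = "{t. cstar_algebra t \<and> range creation \<subseteq> t}"
  have CAR: "CAR = \<Inter>?F" by (simp add: CAR_def hull_def)
  have CARI: "A \<in> CAR" if "\<And>t. cstar_algebra t \<Longrightarrow> range creation \<subseteq> t \<Longrightarrow> A \<in> t" for A
    using that unfolding CAR by blast
  have CARD: "A \<in> t" if "A \<in> CAR" "cstar_algebra t" "range creation \<subseteq> t" for A t
    using that unfolding CAR by blast
  show ?thesis
    unfolding cstar_algebra_def
  proof (intro conjI ballI allI)
    show "clinear (blinfun_apply A)" if "A \<in> CAR" for A :: "'a fock \<Rightarrow>\<^sub>L 'a fock"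
      using adjointable_pair[OF subsetD[OF CAR_sub_adjointable that]] by (simp add: adjoint_pair_def)
    show "closed CAR" unfolding CAR by (intro closed_Inter) (auto dest: cstar_algebraD(6))
    show "0 \<in> CAR" by (rule CARI) (rule cstar_algebraD)
    fix A :: "'a fock \<Rightarrow>\<^sub>L 'a fock" assume A: "A \<in> CAR"
    show "c *\<^sub>C A \<in> CAR" for c by (rule CARI) (rule cstar_algebraD(4), assumption, rule CARD[OF A])
    show "cadjoint A \<in> CAR" by (rule CARI) (rule cstar_algebraD(5), assumption, rule CARD[OF A])
    fix B :: "'a fock \<Rightarrow>\<^sub>L 'a fock" assume B: "B \<in> CAR"
    show "A + B \<in> CAR" by (rule CARI) (rule cstar_algebraD(2), assumption, rule CARD[OF A], assumption+, rule CARD[OF B])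
    show "A o\<^sub>L B \<in> CAR" by (rule CARI) (rule cstar_algebraD(3), assumption, rule CARD[OF A], assumption+, rule CARD[OF B])
  qed
qed

lemma creation_CAR: "creation f \<in> CAR"
  unfolding CAR_def by (rule subsetD[OF hull_subset rangeI])

lemma unitary_eigenvalue:
  assumes "unitary U" "x \<noteq> 0" "U x = c *\<^sub>C x"
  shows "cmod c = 1"
proof -
  have "cinner (U x) (U x) = cinner x x" using assms(1) by (simp add: unitary_def)
  then have "norm (U x) = norm x" by (simp add: norm_eq_sqrt_cinner)
  then show ?thesis using assms by (simp add: norm_scaleC)
qed

theorem proposition5p3:
  fixes U :: "'h::chilbert_space \<Rightarrow> 'h"
    and \<alpha> :: "('h fock \<Rightarrow>\<^sub>L 'h fock) \<Rightarrow> ('h fock \<Rightarrow>\<^sub>L 'h fock)"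
  assumes "unitary U"
    and "pure_point_spectrum U"
    and "bogoliubov_automorphism U \<alpha>"
  shows "moebius_disjoint CAR \<alpha>"
proof -
  interpret automorphism CAR \<alpha>
    by unfold_locales
       (use assms(3) CAR_cstar_algebra CAR_sub_adjointable in \<open>auto simp: bogoliubov_automorphism_def\<close>)
  have \<alpha>: "\<alpha> (creation f) = creation (U f)" for f
    using assms(3) by (simp add: bogoliubov_automorphism_def)
  have span: "creation f \<in> eigensums CAR \<alpha>" if "f \<in> cspan (eigenvectors U)" for f
    using that
  proof (induction rule: complex_vector.span_induct_alt)
    case base
    have "\<alpha> (creation 0) = 1 *\<^sub>C creation 0"
    proof -
      have "U 0 = 0" using assms(1) by (auto simp: unitary_def intro: clinear_zero)
      moreover have "1 *\<^sub>C creation (0 :: 'h) = creation 0" by (rule blinfun_eqI) (simp add: scaleC_one)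
      ultimately show ?thesis by (simp add: \<alpha>)
    qed
    then show ?case by (intro eigensums.eigen[of _ _ 1] creation_CAR) auto
  next
    case (step c f g)
    then obtain l where l: "f \<noteq> 0" "U f = l *\<^sub>C f" by (auto simp: eigenvectors_def)
    have "creation f \<in> eigensums CAR \<alpha>"
      using unitary_eigenvalue[OF assms(1) l] l
      by (intro eigensums.eigen[of _ _ l] creation_CAR) (auto simp: \<alpha> creation_scaleC)
    then show ?case using step unfolding creation_add creation_scaleC by (intro eigensums.add eigensums_scaleC)
  qed
  have "creation f \<in> closure (eigensums CAR \<alpha>)" for f
    unfolding closure_approachable
  proof (intro allI impI)
    fix e :: real assume "e > 0"
    have "f \<in> closure (cspan (eigenvectors U))" using assms(2) by (simp add: pure_point_spectrum_def)
    then obtain g where g: "g \<in> cspan (eigenvectors U)" "dist g f < e"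
      using \<open>e > 0\<close> closure_approachable[of f] by blast
    have "creation g - creation f = creation (g - f)"
      using creation_add[of "g - f" f] by simp
    then have "dist (creation g) (creation f) \<le> dist g f"
      using creation_annihilation(3)[of "g - f"] by (simp add: dist_norm)
    then show "\<exists>Y\<in>eigensums CAR \<alpha>. dist Y (creation f) < e" using g span by (intro bexI[of _ "creation g"]) auto
  qed
  then have "CAR \<subseteq> closure (eigensums CAR \<alpha>)"
    unfolding CAR_def by (intro hull_minimal) (use cstar_closure_eigensums in \<open>auto simp: CAR_def\<close>)
  then show ?thesis by (rule moebius_disjoint_dense)
qed

end
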